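(* There exist a compact metric space $G$ and a current $T\in\mathbf I_1(G)$ such that: (i) $G$ is geodesic, doubling, and $1$-Ahlfors regular; (ii) $\partial T=0$ and $\operatorname{set}(T)=G$; (iii) there is no $S\in\mathbf I_1(G)$ satisfying $\operatorname{set}(S)=G$ and having multiplicity one $\mathcal H^1$-almost everywhere (i.e. $\theta_S=1$ $\mathcal H^1$-a.e. on $G$). Consequently, the following question (Basso's Question 25) has a negative answer already for $n=1$: given an $n$-dimensional integral current space $X$, does there exist an integral $n$-current $S$ in the metric completion of $X$ such that $\operatorname{set}(S)=X$ and the multiplicity of $S$ is equal to one $\mathcal H^n$-almost everywhere?
   Context: Currents are metric currents in the sense of Ambrosio–Kirchheim in a complete metric space $Z$; $\mathbf I_k(Z)$ is the group of integral $k$-currents (integer rectifiable currents of finite mass whose boundary is also integer rectifiable of finite mass), $\|T\|$ is the mass measure of $T$ and $\partial T$ its boundary. The characteristic set of $T\in\mathbf I_k(Z)$ is $$\operatorname{set}(T)=\Big\{x\in Z:\ \liminf_{r\downarrow0}\frac{\|T\|(B(x,r))}{\omega_k r^k}>0\Big\},$$ where $\omega_k$ is the volume of the Euclidean unit $k$-ball. For an integer rectifiable current $S$, $\theta_S$ denotes the intrinsic nonnegative integer multiplicity in the Ambrosio–Kirchheim rectifiable representation. An $n$-dimensional integral current space (Sormani–Wenger) is a triple $(X,d,T)$ with $(X,d)$ a metric space with completion $\overline X$, $T\in\mathbf I_n(\overline X)$ and $\operatorname{set}(T)=X$. A metric space $X$ is $n$-Ahlfors regular if there is $C\ge1$ with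 $C^{-1}r^n\le\mathcal H^n(B(x,r))\le Cr^n$ for all $x\in X$ and $0<r\le\operatorname{diam}X$, where $\mathcal H^n$ is $n$-dimensional Hausdorff measure. *)

theory Defs
  imports "HOL-Analysis.Analysis" "HOL-Combinatorics.Permutations"
begin

section \<open>Metric spaces\<close>

text \<open>Metric spaces are elements of the library type \<open>'a metric\<close>, that is, a carrier set in
  \<open>'a\<close> together with a distance. Functions are total on \<open>'a\<close>, but only their values on the
  carrier are relevant.\<close>

definition geodesic_metric :: "'a metric \<Rightarrow> bool" where
  "geodesic_metric Z \<longleftrightarrow>
     (\<forall>x\<in>mspace Z. \<forall>y\<in>mspace Z. \<exists>\<gamma> :: real \<Rightarrow> 'a.
        \<gamma> ` {0..mdist Z x y} \<subseteq> mspace Z \<and> \<gamma> 0 = x \<and> \<gamma> (mdist Z x y) = y \<and>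
        (\<forall>s\<in>{0..mdist Z x y}. \<forall>t\<in>{0..mdist Z x y}. mdist Z (\<gamma> s) (\<gamma> t) = \<bar>s - t\<bar>))"

definition doubling_metric :: "'a metric \<Rightarrow> bool" where
  "doubling_metric Z \<longleftrightarrow>
     (\<exists>N :: nat. \<forall>x\<in>mspace Z. \<forall>r>0. \<exists>F. finite F \<and> card F \<le> N \<and> F \<subseteq> mspace Z \<and>
        mball_of Z x r \<subseteq> (\<Union>y\<in>F. mball_of Z y (r / 2)))"

definition metric_diam :: "'a metric \<Rightarrow> 'a set \<Rightarrow> ennreal" where
  "metric_diam Z A = (SUP x\<in>A. SUP y\<in>A. ennreal (mdist Z x y))"

text \<open>The Hausdorff (outer) measure, normalised so that it agrees with Lebesgue measure on
  Euclidean \<open>k\<close>-space. The empty set is singled out because of \<open>k = 0\<close>, where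
  \<open>diam ^ 0 = 1\<close>.\<close>

definition hausdorff_gauge :: "nat \<Rightarrow> 'a metric \<Rightarrow> 'a set \<Rightarrow> ennreal" where
  "hausdorff_gauge k Z C =
     (if C = {} then 0 else ennreal (unit_ball_vol (real k) / 2 ^ k) * metric_diam Z C ^ k)"

definition hausdorff_pre :: "nat \<Rightarrow> 'a metric \<Rightarrow> real \<Rightarrow> 'a set \<Rightarrow> ennreal" where
  "hausdorff_pre k Z \<delta> A =
     (INF C \<in> {C :: nat \<Rightarrow> 'a set. (\<forall>i. C i \<subseteq> mspace Z \<and> metric_diam Z (C i) \<le> ennreal \<delta>)
                                   \<and> A \<subseteq> (\<Union>i. C i)}.
        (\<Sum>i. hausdorff_gauge k Z (C i)))"

definition hausdorff :: "nat \<Rightarrow> 'a metric \<Rightarrow> 'a set \<Rightarrow> ennreal" where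
  "hausdorff k Z A = (SUP \<delta>\<in>{0<..}. hausdorff_pre k Z \<delta> A)"

definition ahlfors_regular :: "nat \<Rightarrow> 'a metric \<Rightarrow> bool" where
  "ahlfors_regular n Z \<longleftrightarrow>
     (\<exists>C\<ge>1 :: real. \<forall>x\<in>mspace Z. \<forall>r>0. ennreal r \<le> metric_diam Z (mspace Z) \<longrightarrow>
        ennreal (r ^ n / C) \<le> hausdorff n Z (mball_of Z x r) \<and>
        hausdorff n Z (mball_of Z x r) \<le> ennreal (C * r ^ n))"

definition metric_borel :: "'a metric \<Rightarrow> 'a measure" where
  "metric_borel Z = sigma (mspace Z) {U. openin (mtopology_of Z) U}"

abbreviation lipschitz_fun :: "'a metric \<Rightarrow> ('a \<Rightarrow> real) \<Rightarrow> bool" where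
  "lipschitz_fun Z f \<equiv> Lipschitz_continuous_map Z euclidean_metric f"

definition lip_const :: "'a metric \<Rightarrow> ('a \<Rightarrow> real) \<Rightarrow> real" where
  "lip_const Z f =
     Inf {L. 0 \<le> L \<and> (\<forall>x\<in>mspace Z. \<forall>y\<in>mspace Z. \<bar>f x - f y\<bar> \<le> L * mdist Z x y)}"

section \<open>Euclidean \<open>k\<close>-space for a variable natural number \<open>k\<close>\<close>

definition euclid :: "nat \<Rightarrow> (nat \<Rightarrow> real) metric" where
  "euclid k = metric ({..<k} \<rightarrow>\<^sub>E UNIV, \<lambda>x y. L2_set (\<lambda>i. x i - y i) {..<k})"

definition leb :: "nat \<Rightarrow> (nat \<Rightarrow> real) measure" where
  "leb k = Pi\<^sub>M {..<k} (\<lambda>_. lborel)"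

lemma Metric_space_euclid:
  "Metric_space ({..<k::nat} \<rightarrow>\<^sub>E (UNIV :: real set)) (\<lambda>x y. L2_set (\<lambda>i. x i - y i) {..<k})"
proof
  fix x y z :: "nat \<Rightarrow> real"
  show "0 \<le> L2_set (\<lambda>i. x i - y i) {..<k}"
    by (rule L2_set_nonneg)
  show "L2_set (\<lambda>i. x i - y i) {..<k} = L2_set (\<lambda>i. y i - x i) {..<k}"
    by (simp add: L2_set_def power2_commute)
  show "L2_set (\<lambda>i. x i - y i) {..<k} = 0 \<longleftrightarrow> x = y"
    if "x \<in> {..<k} \<rightarrow>\<^sub>E UNIV" "y \<in> {..<k} \<rightarrow>\<^sub>E UNIV"
    using that by (auto simp: L2_set_eq_0_iff intro: PiE_ext)
  show "L2_set (\<lambda>i. x i - z i) {..<k}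
      \<le> L2_set (\<lambda>i. x i - y i) {..<k} + L2_set (\<lambda>i. y i - z i) {..<k}"
    using L2_set_triangle_ineq[of "\<lambda>i. x i - y i" "\<lambda>i. y i - z i" "{..<k}"] by simp
qed

lemma mspace_euclid [simp]: "mspace (euclid k) = {..<k} \<rightarrow>\<^sub>E UNIV"
  and mdist_euclid [simp]: "mdist (euclid k) = (\<lambda>x y. L2_set (\<lambda>i. x i - y i) {..<k})"
  unfolding euclid_def
  by (rule Metric_space.mspace_metric[OF Metric_space_euclid],
      rule Metric_space.mdist_metric[OF Metric_space_euclid])

definition partial_deriv :: "nat \<Rightarrow> ((nat \<Rightarrow> real) \<Rightarrow> real) \<Rightarrow> (nat \<Rightarrow> real) \<Rightarrow> real" where
  "partial_deriv j g x = deriv (\<lambda>t. g (x(j := t))) (x j)"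

text \<open>By Rademacher's theorem the Jacobian determinant of a tuple of Lipschitz functions is
  meaningful almost everywhere; it is only used under an integral.\<close>

definition jacobian_det ::
    "nat \<Rightarrow> ((nat \<Rightarrow> real) \<Rightarrow> real) list \<Rightarrow> (nat \<Rightarrow> real) \<Rightarrow> real" where
  "jacobian_det k \<pi> x =
     (\<Sum>p\<in>{p. p permutes {..<k}}. of_int (sign p) * (\<Prod>i<k. partial_deriv (p i) (\<pi> ! i) x))"

section \<open>Metric currents\<close>

text \<open>A functional on \<open>k\<close>-forms takes a function \<open>f\<close> and a list \<open>\<pi>\<close> of \<open>k\<close> functions; its
  values outside of \<open>test_form k Z\<close> play no role.\<close>

type_synonym 'a functional = "('a \<Rightarrow> real) \<Rightarrow> ('a \<Rightarrow> real) list \<Rightarrow> real"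

definition test_form :: "nat \<Rightarrow> 'a metric \<Rightarrow> ('a \<Rightarrow> real) \<Rightarrow> ('a \<Rightarrow> real) list \<Rightarrow> bool" where
  "test_form k Z f \<pi> \<longleftrightarrow>
     lipschitz_fun Z f \<and> bounded (f ` mspace Z) \<and> length \<pi> = k \<and> (\<forall>p\<in>set \<pi>. lipschitz_fun Z p)"

definition zero_current :: "nat \<Rightarrow> 'a metric \<Rightarrow> 'a functional \<Rightarrow> bool" where
  "zero_current k Z T \<longleftrightarrow> (\<forall>f \<pi>. test_form k Z f \<pi> \<longrightarrow> T f \<pi> = 0)"

definition mass_bound :: "nat \<Rightarrow> 'a metric \<Rightarrow> 'a functional \<Rightarrow> 'a measure \<Rightarrow> bool" where
  "mass_bound k Z T \<mu> \<longleftrightarrow>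
     space \<mu> = mspace Z \<and> sets \<mu> = sets (metric_borel Z) \<and> finite_measure \<mu> \<and>
     (\<forall>f \<pi>. test_form k Z f \<pi> \<longrightarrow>
        \<bar>T f \<pi>\<bar> \<le> prod_list (map (lip_const Z) \<pi>) * (\<integral>x. \<bar>f x\<bar> \<partial>\<mu>))"

definition mass_measure :: "nat \<Rightarrow> 'a metric \<Rightarrow> 'a functional \<Rightarrow> 'a measure" where
  "mass_measure k Z T =
     (THE \<mu>. mass_bound k Z T \<mu> \<and>
        (\<forall>\<nu>. mass_bound k Z T \<nu> \<longrightarrow> (\<forall>B\<in>sets \<mu>. emeasure \<mu> B \<le> emeasure \<nu> B)))"

definition current_mass :: "nat \<Rightarrow> 'a metric \<Rightarrow> 'a functional \<Rightarrow> real" where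
  "current_mass k Z T = measure (mass_measure k Z T) (mspace Z)"

text \<open>Ambrosio--Kirchheim currents (of finite mass). The first conjunct says that \<open>T\<close> only
  depends on the restrictions of its arguments to the carrier; the other ones are linearity in
  \<open>f\<close>, linearity in each \<open>\<pi>\<^sub>i\<close>, continuity, locality and finite mass.\<close>

definition current :: "nat \<Rightarrow> 'a metric \<Rightarrow> 'a functional \<Rightarrow> bool" where
  "current k Z T \<longleftrightarrow>
     (\<forall>f f' \<pi> \<pi>'. test_form k Z f \<pi> \<longrightarrow> test_form k Z f' \<pi>' \<longrightarrow>
        (\<forall>x\<in>mspace Z. f x = f' x \<and> (\<forall>i<k. (\<pi> ! i) x = (\<pi>' ! i) x)) \<longrightarrow> T f \<pi> = T f' \<pi>') \<and>
     (\<forall>f g \<pi> a b. test_form k Z f \<pi> \<longrightarrow> test_form k Z g \<pi> \<longrightarrow>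
        T (\<lambda>x. a * f x + b * g x) \<pi> = a * T f \<pi> + b * T g \<pi>) \<and>
     (\<forall>f \<pi> i p q a b. test_form k Z f \<pi> \<longrightarrow> i < k \<longrightarrow> lipschitz_fun Z p \<longrightarrow> lipschitz_fun Z q \<longrightarrow>
        T f (\<pi>[i := \<lambda>x. a * p x + b * q x]) = a * T f (\<pi>[i := p]) + b * T f (\<pi>[i := q])) \<and>
     (\<forall>f \<pi> \<rho> C. test_form k Z f \<pi> \<longrightarrow> (\<forall>j :: nat. test_form k Z f (\<rho> j)) \<longrightarrow>
        (\<forall>j. \<forall>i<k. lip_const Z (\<rho> j ! i) \<le> C) \<longrightarrow>
        (\<forall>i<k. \<forall>x\<in>mspace Z. (\<lambda>j. (\<rho> j ! i) x) \<longlonglongrightarrow> (\<pi> ! i) x) \<longrightarrow>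
        (\<lambda>j. T f (\<rho> j)) \<longlonglongrightarrow> T f \<pi>) \<and>
     (\<forall>f \<pi>. test_form k Z f \<pi> \<longrightarrow>
        (\<exists>i<k. \<exists>U c. openin (mtopology_of Z) U \<and> {x\<in>mspace Z. f x \<noteq> 0} \<subseteq> U \<and>
                     (\<forall>x\<in>U. (\<pi> ! i) x = c)) \<longrightarrow>
        T f \<pi> = 0) \<and>
     (\<exists>\<mu>. mass_bound k Z T \<mu>)"

text \<open>The boundary of a \<open>k\<close>-current, \<open>k \<ge> 1\<close>.\<close>

definition current_boundary :: "'a functional \<Rightarrow> 'a functional" where
  "current_boundary T f \<pi> = T (\<lambda>_. 1) (f # \<pi>)"

text \<open>Extension of \<open>T\<close> to bounded Borel functions \<open>g\<close> in place of \<open>f\<close>: bounded Lipschitz functions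
  are dense in \<open>L\<^sup>1\<close> of the mass measure, and \<open>h \<mapsto> T h \<pi>\<close> is \<open>L\<^sup>1\<close>-continuous by the mass
  bound.\<close>

definition current_extension :: "nat \<Rightarrow> 'a metric \<Rightarrow> 'a functional \<Rightarrow> 'a functional" where
  "current_extension k Z T g \<pi> =
     (THE c. \<forall>h :: nat \<Rightarrow> 'a \<Rightarrow> real. (\<forall>j. test_form k Z (h j) \<pi>) \<longrightarrow>
        (\<lambda>j. \<integral>x. \<bar>h j x - g x\<bar> \<partial>mass_measure k Z T) \<longlonglongrightarrow> 0 \<longrightarrow>
        (\<lambda>j. T (h j) \<pi>) \<longlonglongrightarrow> c)"

definition current_restrict ::
    "nat \<Rightarrow> 'a metric \<Rightarrow> 'a functional \<Rightarrow> 'a set \<Rightarrow> 'a functional" where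
  "current_restrict k Z T A f \<pi> = current_extension k Z T (\<lambda>x. indicator A x * f x) \<pi>"

definition pushforward :: "('a \<Rightarrow> 'b) \<Rightarrow> 'a functional \<Rightarrow> 'b functional" where
  "pushforward \<phi> T f \<pi> = T (f \<circ> \<phi>) (map (\<lambda>p. p \<circ> \<phi>) \<pi>)"

definition euclid_current :: "nat \<Rightarrow> ((nat \<Rightarrow> real) \<Rightarrow> int) \<Rightarrow> (nat \<Rightarrow> real) functional" where
  "euclid_current k \<theta> f \<pi> = (\<integral>x. of_int (\<theta> x) * f x * jacobian_det k \<pi> x \<partial>leb k)"

section \<open>Integer rectifiable and integral currents\<close>

definition countably_rectifiable :: "nat \<Rightarrow> 'a metric \<Rightarrow> 'a set \<Rightarrow> bool" where
  "countably_rectifiable k Z S \<longleftrightarrow>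
     (\<exists>A g. (\<forall>j :: nat. A j \<subseteq> mspace (euclid k) \<and>
                Lipschitz_continuous_map (submetric (euclid k) (A j)) Z (g j)) \<and>
            hausdorff k Z (S - (\<Union>j. g j ` A j)) = 0)"

text \<open>For \<open>k = 0\<close> an integer rectifiable current is \<open>f \<mapsto> \<Sum>\<^sub>h \<theta>\<^sub>h f(x\<^sub>h)\<close> with \<open>\<theta>\<^sub>h\<close> integers and
  \<open>\<Sum>\<^sub>h \<bar>\<theta>\<^sub>h\<bar> < \<infinity>\<close>, so that the sum is finite.\<close>

definition integer_rectifiable :: "nat \<Rightarrow> 'a metric \<Rightarrow> 'a functional \<Rightarrow> bool" where
  "integer_rectifiable k Z T \<longleftrightarrow> current k Z T \<and>
     (if k = 0 then
        (\<exists>F m. finite F \<and> F \<subseteq> mspace Z \<and>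
           (\<forall>f. test_form 0 Z f [] \<longrightarrow> T f [] = (\<Sum>x\<in>F. of_int (m x) * f x)))
      else
        (\<exists>S\<in>sets (metric_borel Z). countably_rectifiable k Z S \<and>
           emeasure (mass_measure k Z T) (mspace Z - S) = 0) \<and>
        (\<forall>N\<in>sets (metric_borel Z). hausdorff k Z N = 0 \<longrightarrow> emeasure (mass_measure k Z T) N = 0) \<and>
        (\<forall>\<phi> A. Lipschitz_continuous_map Z (euclid k) \<phi> \<longrightarrow> openin (mtopology_of Z) A \<longrightarrow>
           (\<exists>\<theta>. integrable (leb k) (\<lambda>x. of_int (\<theta> x) :: real) \<and>
              (\<forall>f \<pi>. test_form k (euclid k) f \<pi> \<longrightarrow>
                 pushforward \<phi> (current_restrict k Z T A) f \<pi> = euclid_current k \<theta> f \<pi>))))"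

definition integral_currents :: "nat \<Rightarrow> 'a metric \<Rightarrow> 'a functional set" where
  "integral_currents k Z =
     {T. integer_rectifiable k Z T \<and>
         (0 < k \<longrightarrow> integer_rectifiable (k - 1) Z (current_boundary T))}"

definition current_set :: "nat \<Rightarrow> 'a metric \<Rightarrow> 'a functional \<Rightarrow> 'a set" where
  "current_set k Z T =
     {x\<in>mspace Z. 0 < Liminf (at_right 0) (\<lambda>r. emeasure (mass_measure k Z T) (mball_of Z x r)
                                                  / ennreal (unit_ball_vol (real k) * r ^ k))}"

section \<open>Multiplicity\<close>

definition lipschitz_extension ::
    "nat \<Rightarrow> (nat \<Rightarrow> real) set \<Rightarrow> ((nat \<Rightarrow> real) \<Rightarrow> real) \<Rightarrow> (nat \<Rightarrow> real) \<Rightarrow> real" where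
  "lipschitz_extension k K g = (SOME h. lipschitz_fun (euclid k) h \<and> (\<forall>x\<in>K. h x = g x))"

text \<open>The push-forward under \<open>\<phi>\<close> of the Euclidean current with density \<open>\<theta>\<close> on \<open>K\<close>, where \<open>\<phi>\<close> is
  Lipschitz on \<open>K\<close> only. At Lebesgue density points of \<open>K\<close> the Jacobian does not depend on the
  choice of the Lipschitz extensions.\<close>

definition chart_current ::
    "nat \<Rightarrow> (nat \<Rightarrow> real) set \<Rightarrow> ((nat \<Rightarrow> real) \<Rightarrow> 'a) \<Rightarrow> ((nat \<Rightarrow> real) \<Rightarrow> int) \<Rightarrow> 'a functional" where
  "chart_current k K \<phi> \<theta> f \<pi> =
     (\<integral>y. indicator K y * of_int (\<theta> y) * f (\<phi> y) *
           jacobian_det k (map (\<lambda>p. lipschitz_extension k K (p \<circ> \<phi>)) \<pi>) y \<partial>leb k)"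

definition bilipschitz_on ::
    "'b metric \<Rightarrow> 'a metric \<Rightarrow> 'b set \<Rightarrow> ('b \<Rightarrow> 'a) \<Rightarrow> bool" where
  "bilipschitz_on E Z K \<phi> \<longleftrightarrow> \<phi> ` K \<subseteq> mspace Z \<and>
     (\<exists>L>0. \<forall>x\<in>K. \<forall>y\<in>K. mdist E x y / L \<le> mdist Z (\<phi> x) (\<phi> y) \<and>
                          mdist Z (\<phi> x) (\<phi> y) \<le> L * mdist E x y)"

text \<open>The Ambrosio--Kirchheim representation of an integer rectifiable current by countably many
  bi-Lipschitz charts with compact domains and disjoint images.\<close>

definition rectifiable_representation ::
    "nat \<Rightarrow> 'a metric \<Rightarrow> 'a functional \<Rightarrow> (nat \<Rightarrow> (nat \<Rightarrow> real) set) \<Rightarrow>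
     (nat \<Rightarrow> (nat \<Rightarrow> real) \<Rightarrow> 'a) \<Rightarrow> (nat \<Rightarrow> (nat \<Rightarrow> real) \<Rightarrow> int) \<Rightarrow> bool" where
  "rectifiable_representation k Z T K \<phi> \<theta> \<longleftrightarrow>
     (\<forall>i. compactin (mtopology_of (euclid k)) (K i) \<and> bilipschitz_on (euclid k) Z (K i) (\<phi> i) \<and>
          integrable (leb k) (\<lambda>x. of_int (\<theta> i x) :: real)) \<and>
     disjoint_family (\<lambda>i. \<phi> i ` K i) \<and>
     (\<forall>f \<pi>. test_form k Z f \<pi> \<longrightarrow>
        (\<lambda>i. chart_current k (K i) (\<phi> i) (\<theta> i) f \<pi>) sums T f \<pi>) \<and>
     (\<lambda>i. current_mass k Z (chart_current k (K i) (\<phi> i) (\<theta> i))) sums current_mass k Z T"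

text \<open>\<open>\<Theta>\<close> is (a representative of) the multiplicity of \<open>T\<close>. It is determined up to \<open>k\<close>-dimensional
  Hausdorff null sets; the sign of the \<open>\<theta>\<^sub>i\<close> belongs to the orientation.\<close>

definition is_multiplicity :: "nat \<Rightarrow> 'a metric \<Rightarrow> 'a functional \<Rightarrow> ('a \<Rightarrow> nat) \<Rightarrow> bool" where
  "is_multiplicity k Z T \<Theta> \<longleftrightarrow>
     (\<exists>K \<phi> \<theta>. rectifiable_representation k Z T K \<phi> \<theta> \<and>
        (\<forall>i. \<forall>y\<in>K i. \<Theta> (\<phi> i y) = nat \<bar>\<theta> i y\<bar>) \<and>
        (\<forall>x\<in>mspace Z - (\<Union>i. \<phi> i ` K i). \<Theta> x = 0))"

definition multiplicity_one_ae :: "nat \<Rightarrow> 'a metric \<Rightarrow> 'a functional \<Rightarrow> 'a set \<Rightarrow> bool" where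
  "multiplicity_one_ae k Z T A \<longleftrightarrow>
     (\<exists>\<Theta>. is_multiplicity k Z T \<Theta> \<and> hausdorff k Z {x\<in>A. \<Theta> x \<noteq> 1} = 0)"

section \<open>Integral current spaces\<close>

definition metric_completion :: "'a metric \<Rightarrow> 'b metric \<Rightarrow> ('a \<Rightarrow> 'b) \<Rightarrow> bool" where
  "metric_completion X Y \<iota> \<longleftrightarrow>
     mcomplete_of Y \<and> \<iota> ` mspace X \<subseteq> mspace Y \<and>
     (\<forall>x\<in>mspace X. \<forall>y\<in>mspace X. mdist Y (\<iota> x) (\<iota> y) = mdist X x y) \<and>
     mtopology_of Y closure_of (\<iota> ` mspace X) = mspace Y"

text \<open>\<open>X\<close> with the current \<open>T\<close> in its completion \<open>\<iota> : X \<rightarrow> Y\<close>.\<close>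

definition integral_current_space ::
    "nat \<Rightarrow> 'a metric \<Rightarrow> 'b metric \<Rightarrow> ('a \<Rightarrow> 'b) \<Rightarrow> 'b functional \<Rightarrow> bool" where
  "integral_current_space n X Y \<iota> T \<longleftrightarrow>
     metric_completion X Y \<iota> \<and> T \<in> integral_currents n Y \<and> current_set n Y T = \<iota> ` mspace X"

text \<open>Basso's question in dimension \<open>n\<close>, for spaces with carrier in the type \<open>'a\<close>. For the type
  \<open>real\<close> these are, up to isometry, all spaces of cardinality at most that of the continuum; they
  include all separable spaces, and the completion of such a space is again one.\<close>

definition basso_question :: "'a itself \<Rightarrow> nat \<Rightarrow> bool" where
  "basso_question _ n \<longleftrightarrow>
     (\<forall>(X :: 'a metric) (Y :: 'a metric) \<iota> T. integral_current_space n X Y \<iota> T \<longrightarrow>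
        (\<exists>S\<in>integral_currents n Y. current_set n Y S = \<iota> ` mspace X \<and>
           multiplicity_one_ae n Y S (\<iota> ` mspace X)))"

end

theory Submission
  imports Defs
begin

text \<open>Glue two copies of a circle along a closed set whose complement consists of infinitely many
  arcs (gaps) shrinking to a point, and let \<open>T\<close> run once through each copy. Every end of a gap is a
  branch point of order three, where the single strand of multiplicity two splits into two strands
  of multiplicity one. If \<open>S\<close> has multiplicity one almost everywhere, its density along the
  strands is \<open>\<plusminus>1\<close>. The boundary of \<open>S\<close> is an integral \<open>0\<close>-current, so it has finite support and
  misses some end of a gap. Near that end the signed number of sheets of \<open>S\<close> over the circle folded
  onto \<open>[0, 1/2]\<close> is constant; but it is a sum of two signs on one side and of three signs on the
  other.\<close>

section \<open>Lipschitz functions on the real line\<close>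

text \<open>A finite number of gaps would not suffice: with every strand oriented at will, the
  boundary of a multiplicity one current then consists of finitely many atoms at the branch points
  and is integral. Infinitely many ends cannot all carry atoms of an integral
  \<open>0\<close>-current.

  Nothing is known about the orientation of \<open>S\<close> along a strand beyond measurability,
  and no decomposition of \<open>S\<close> into curves is used. Instead \<open>S\<close> is only
  tested with functions of the fold \<open>circ x 0\<close>, a globally defined Lipschitz function;
  this turns it into one bounded function on an interval. Folding adds the sheet
  \<open>1 - s\<close> to every fibre, but this sheet is glued throughout, so it contributes one
  sign on both sides of a gap end and leaves the parities different.

  Two obstacles shape the work. A chart has a compact domain and enters through an arbitrarily
  chosen Lipschitz extension, so derivatives can be compared only at limit points of the domain. The
  mass measure is a least measure, so the mass of \<open>T\<close> has to be bounded from below by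
  test forms; this succeeds because both layers are traversed in the same direction and the fold has
  derivative \<open>1\<close> or \<open>- 1\<close> along them.\<close>

lemma open_bounded_real_disjoint_intervals:
  fixes U :: "real set"
  assumes U: "open U" "bounded U"
  obtains a b :: "nat \<Rightarrow> real"
    where "\<And>n. a n \<le> b n" "disjoint_family (\<lambda>n. {a n<..<b n})" "U = (\<Union>n. {a n<..<b n})"
proof -
  define S where "S = components U"
  have S_open: "open C" if "C \<in> S" for C
    using that U(1) by (simp add: S_def open_components)
  have "countable S"
    using S_open pairwise_disjoint_components[of U] countable_disjoint_open_subsets[of S]
    unfolding S_def disjnt_def pairwise_def by auto
  have iv: "\<exists>p. fst p < snd p \<and> C = {fst p<..<snd p}" if "C \<in> S" for C
  proof -
    have C: "connected C" "open C" "C \<noteq> {}" "bounded C"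
      using that in_components_connected in_components_nonempty S_open
        bounded_subset[OF U(2)] in_components_subset unfolding S_def by blast+
    have bd: "bdd_below C" "bdd_above C"
      using C(4) bounded_imp_bdd_below bounded_imp_bdd_above by auto
    have "C = {Inf C<..<Sup C}"
    proof (intro equalityI subsetI)
      fix x assume x: "x \<in> C"
      obtain e where e: "e > 0" "cball x e \<subseteq> C"
        using C(2) x open_contains_cball by blast
      have "x - e \<in> C" "x + e \<in> C"
        using e by (auto simp: dist_real_def)
      then have "Inf C \<le> x - e" "x + e \<le> Sup C"
        using bd cInf_lower cSup_upper by auto
      with e(1) show "x \<in> {Inf C<..<Sup C}" by auto
    next
      fix x assume x: "x \<in> {Inf C<..<Sup C}"
      obtain y z where "y \<in> C" "y < x" "z \<in> C" "x < z"
        using x C(3) bd by (meson cInf_less_iff greaterThanLessThan_iff less_cSup_iff)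
      then show "x \<in> C"
        using C(1) unfolding connected_iff_interval by (meson less_imp_le)
    qed
    moreover from this have "Inf C < Sup C"
      using C(3) by (metis greaterThanLessThan_empty_iff not_le)
    ultimately show ?thesis
      by (intro exI[of _ "(Inf C, Sup C)"]) auto
  qed
  then obtain p where p: "\<And>C. C \<in> S \<Longrightarrow> fst (p C) < snd (p C) \<and> C = {fst (p C)<..<snd (p C)}"
    by metis
  define idx where "idx = to_nat_on S"
  have inj: "inj_on idx S"
    unfolding idx_def using \<open>countable S\<close> by (rule inj_on_to_nat_on)
  define C where "C n = inv_into S idx n" for n
  \<comment> \<open>Indices that belong to no component get the empty interval with both ends
    \<open>0\<close>, so that the family is indexed by all of \<open>nat\<close> even when there are
    finitely many components.\<close>
  define a where "a n = (if n \<in> idx ` S then fst (p (C n)) else 0)" for n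
  define b where "b n = (if n \<in> idx ` S then snd (p (C n)) else 0)" for n
  have C_in: "C n \<in> S" "idx (C n) = n" if "n \<in> idx ` S" for n
    using that by (auto simp: C_def inv_into_into f_inv_into_f)
  have ab: "{a n<..<b n} = C n" if "n \<in> idx ` S" for n
    using p[OF C_in(1)[OF that]] that by (auto simp: a_def b_def)
  have ab0: "{a n<..<b n} = {}" if "n \<notin> idx ` S" for n
    using that by (auto simp: a_def b_def)
  show thesis
  proof
    show "a n \<le> b n" for n
      using p[OF C_in(1), of n] by (auto simp: a_def b_def less_imp_le)
    show "disjoint_family (\<lambda>n. {a n<..<b n})"
      unfolding disjoint_family_on_def
    proof (intro ballI impI)
      fix m n :: nat assume "m \<noteq> n"
      show "{a m<..<b m} \<inter> {a n<..<b n} = {}"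
      proof (cases "m \<in> idx ` S \<and> n \<in> idx ` S")
        case True
        with \<open>m \<noteq> n\<close> C_in have "C m \<in> S" "C n \<in> S" "C m \<noteq> C n" by metis+
        then have "C m \<inter> C n = {}"
          using pairwise_disjoint_components[of U] by (auto simp: S_def pairwise_def disjnt_def)
        with True ab show ?thesis by simp
      next
        case False
        then have "{a m<..<b m} = {} \<or> {a n<..<b n} = {}"
          using ab0 by metis
        then show ?thesis by (metis Int_empty_left Int_empty_right)
      qed
    qed
    have "(\<Union>n. {a n<..<b n}) = (\<Union>n\<in>idx ` S. {a n<..<b n})"
    proof (intro equalityI subsetI)
      fix x assume "x \<in> (\<Union>n. {a n<..<b n})"
      then obtain n where n: "x \<in> {a n<..<b n}" by blast
      with ab0[of n] have "n \<in> idx ` S" by (metis empty_iff)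
      with n show "x \<in> (\<Union>n\<in>idx ` S. {a n<..<b n})" by blast
    qed blast
    also have "\<dots> = (\<Union>n\<in>idx ` S. C n)"
      by (intro SUP_cong refl ab)
    also have "\<dots> = \<Union>S"
      using inj by (auto simp: C_def)
    also have "\<dots> = U"
      by (simp add: S_def)
    finally show "U = (\<Union>n. {a n<..<b n})" by simp
  qed
qed

text \<open>A Lipschitz distribution function gives an interval at most \<open>L\<close> times its
  length. Covering a null set by an open set of small length and summing over the intervals of that
  set gives measure zero; Radon-Nikodym then becomes applicable.\<close>

lemma interval_measure_absolutely_continuous:
  fixes F :: "real \<Rightarrow> real"
  assumes mono: "\<And>x y. x \<le> y \<Longrightarrow> F x \<le> F y" and lip: "L-lipschitz_on UNIV F"
  shows "absolutely_continuous lborel (interval_measure F)"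
  unfolding absolutely_continuous_def
proof
  fix N :: "real set" assume N: "N \<in> null_sets lborel"
  have cont: "continuous_on UNIV F"
    using lip lipschitz_on_continuous_on by blast
  have L: "L \<ge> 0" using lip lipschitz_on_nonneg by blast
  have lip': "F y - F x \<le> L * (y - x)" if "x \<le> y" for x y
    using lipschitz_onD[OF lip, of x y] mono[OF that] that by (auto simp: dist_real_def)
  \<comment> \<open>Bounded windows keep the covering open set bounded, as the decomposition into
    intervals requires.\<close>
  have bd0: "emeasure (interval_measure F) (N \<inter> {-real n<..<real n}) = 0" for n
  proof -
    let ?N = "N \<inter> {-real n<..<real n}"
    have N': "?N \<in> null_sets lborel"
      using N by (intro null_set_Int2) auto
    have "emeasure (interval_measure F) ?N \<le> ennreal e" if "e > 0" for e
    proof -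
      \<comment> \<open>The divisor \<open>L + 1\<close> instead of \<open>L\<close> stays positive
        when \<open>L = 0\<close>.\<close>
      obtain V where V: "open V" "?N \<subseteq> V" "emeasure lborel (V - ?N) < ennreal (e / (L + 1))"
        using outer_regular_lborel[of ?N "e / (L+1)"] N' \<open>e > 0\<close> L by (auto simp: null_sets_def)
      define U where "U = V \<inter> {-real n<..<real n}"
      have "emeasure lborel U \<le> emeasure lborel (V - ?N) + emeasure lborel ?N"
        unfolding U_def using V N' by (intro order_trans[OF emeasure_mono emeasure_subadditive]) auto
      with V N' have Ue: "emeasure lborel U < ennreal (e / (L+1))"
        by (simp add: null_sets_def)
      have U: "open U" "bounded U"
        using V unfolding U_def by (auto intro: bounded_subset[of "{-real n<..<real n}"])
      obtain a b where ab: "\<And>k. a k \<le> b k" "disjoint_family (\<lambda>k::nat. {a k<..<b k})"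
        "U = (\<Union>k. {a k<..<b k})"
        using open_bounded_real_disjoint_intervals[OF U] by blast
      have "emeasure (interval_measure F) ?N \<le> emeasure (interval_measure F) U"
        using V U(1) N unfolding U_def by (intro emeasure_mono) auto
      also have "\<dots> \<le> (\<Sum>k. emeasure (interval_measure F) {a k<..<b k})"
        unfolding ab(3) by (intro emeasure_subadditive_countably) auto
      also have "\<dots> \<le> (\<Sum>k. ennreal L * emeasure lborel {a k<..<b k})"
      proof (intro suminf_le)
        fix k
        have "emeasure (interval_measure F) {a k<..<b k} \<le> emeasure (interval_measure F) {a k..b k}"
          by (intro emeasure_mono) auto
        also have "\<dots> = ennreal (F (b k) - F (a k))"
          using ab(1) mono cont by (intro emeasure_interval_measure_Icc) auto
        also have "\<dots> \<le> ennreal (L * (b k - a k))"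
          using lip' ab(1) by (intro ennreal_leI) auto
        also have "\<dots> = ennreal L * emeasure lborel {a k<..<b k}"
          using ab(1) L by (simp add: ennreal_mult)
        finally show "emeasure (interval_measure F) {a k<..<b k} \<le> \<dots>" .
      qed auto
      also have "\<dots> = ennreal L * emeasure lborel U"
        unfolding ab(3) using ab(2) by (subst ennreal_suminf_cmult, subst suminf_emeasure) auto
      also have "\<dots> \<le> ennreal L * ennreal (e / (L+1))"
        using Ue by (intro mult_left_mono) auto
      also have "\<dots> \<le> ennreal e"
        using L \<open>e > 0\<close> by (subst ennreal_mult[symmetric]) (auto intro!: ennreal_leI simp: field_simps)
      finally show ?thesis .
    qed
    then show ?thesis
      by (metis ennreal_le_epsilon add_0 le_zero_eq zero_less_one)
  qed
  have "N = (\<Union>n::nat. N \<inter> {-real n<..<real n})"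
  proof -
    have "\<exists>n::nat. x \<in> {-real n<..<real n}" for x
    proof -
      obtain n where "\<bar>x\<bar> < real n" using reals_Archimedean2 by blast
      then have "x \<in> {-real n<..<real n}" by (auto simp: abs_less_iff)
      then show ?thesis by blast
    qed
    then show ?thesis by blast
  qed
  moreover have "(\<Union>n::nat. N \<inter> {-real n<..<real n}) \<in> null_sets (interval_measure F)"
    using bd0 N by (intro null_sets_UN) (auto simp: null_sets_def)
  ultimately show "N \<in> null_sets (interval_measure F)" by simp
qed

text \<open>Adding \<open>L * x\<close> makes \<open>h\<close> nondecreasing and keeps it Lipschitz,
  so the sum is the distribution function of an absolutely continuous measure. Its density, lowered
  by \<open>L\<close>, is the integrand.\<close>

lemma lipschitz_real_eq_indefinite_integral:
  fixes h :: "real \<Rightarrow> real"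
  assumes lip: "L-lipschitz_on UNIV h"
  obtains g where "\<And>a b. g integrable_on {a..b}" "\<And>a b. a \<le> b \<Longrightarrow> integral {a..b} g = h b - h a"
proof -
  define F where "F x = h x + L * x" for x
  have L: "L \<ge> 0" using lip lipschitz_on_nonneg by blast
  have mono: "F x \<le> F y" if "x \<le> y" for x y
    using lipschitz_onD[OF lip, of x y] that by (auto simp: F_def dist_real_def algebra_simps abs_le_iff)
  have lipF: "(L + L)-lipschitz_on UNIV F"
    unfolding F_def by (intro lipschitz_on_add lip)
      (use L in \<open>auto intro!: lipschitz_onI simp: dist_real_def abs_mult simp flip: right_diff_distrib\<close>)
  have cont: "continuous_on UNIV F"
    using lipF lipschitz_on_continuous_on by blast
  obtain f where f[measurable]: "f \<in> borel_measurable lborel" and df: "density lborel f = interval_measure F"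
    using sigma_finite_measure.Radon_Nikodym[OF sigma_finite_lborel interval_measure_absolutely_continuous[OF mono lipF]] by auto
  define g where "g x = enn2real (f x)" for x
  have [measurable]: "g \<in> borel_measurable borel"
    unfolding g_def using f by measurable
  have nn: "(\<integral>\<^sup>+x. f x * indicator {a..b} x \<partial>lborel) = ennreal (F b - F a)" if "a \<le> b" for a b
    using emeasure_interval_measure_Icc[OF that mono cont] 
    by (simp add: df[symmetric] emeasure_density)
  \<comment> \<open>The density has extended nonnegative values. Its integrals over bounded
    intervals are finite, hence it is finite almost everywhere and \<open>enn2real\<close> loses
    nothing.\<close>
  have "AE x in lborel. x \<in> {-real n..real n} \<longrightarrow> f x < \<infinity>" for n
  proof -
    have "AE x in lborel. f x * indicator {-real n..real n} x \<noteq> \<infinity>"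
      using nn[of "-real n" "real n"] by (intro nn_integral_PInf_AE) auto
    then show ?thesis
      by eventually_elim (auto simp: indicator_def less_top)
  qed
  then have "AE x in lborel. \<forall>n. x \<in> {-real n..real n} \<longrightarrow> f x < \<infinity>"
    unfolding AE_all_countable by blast
  then have fin: "AE x in lborel. f x < \<infinity>"
  proof eventually_elim
    case (elim x)
    obtain n where "\<bar>x\<bar> < real n" using reals_Archimedean2 by blast
    then have "x \<in> {-real n..real n}" by (auto simp: abs_less_iff)
    with elim show ?case by blast
  qed
  have hi: "(g has_integral (F b - F a)) {a..b}" if "a \<le> b" for a b
  proof -
    have "((\<lambda>x. g x * indicator {a..b} x) has_integral (F b - F a)) UNIV"
    proof (rule nn_integral_has_integral)
      have "(\<integral>\<^sup>+x. ennreal (g x * indicator {a..b} x) \<partial>lborel) = (\<integral>\<^sup>+x. f x * indicator {a..b} x \<partial>lborel)"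
        by (intro nn_integral_cong_AE, use fin in eventually_elim) (auto simp: g_def indicator_def)
      then show "(\<integral>\<^sup>+x. ennreal (g x * indicator {a..b} x) \<partial>lborel) = ennreal (F b - F a)"
        using nn that by simp
      show "F b - F a \<ge> 0" using mono that by simp
    qed (auto simp: g_def)
    moreover have "(\<lambda>x. g x * indicator {a..b} x) = (\<lambda>x. if x \<in> {a..b} then g x else 0)"
      by (auto simp: indicator_def)
    ultimately show ?thesis using has_integral_restrict_UNIV[of "{a..b}" g] by simp
  qed
  have hi2: "((\<lambda>x. g x - L) has_integral (h b - h a)) {a..b}" if "a \<le> b" for a b
    using has_integral_diff[OF hi[OF that] has_integral_const_real[of L a b]] that
    by (simp add: F_def algebra_simps)
  show thesis
  proof
    show "(\<lambda>x. g x - L) integrable_on {a..b}" for a b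
      using hi2[of a b] integrable_on_empty by (cases "a \<le> b") auto
    show "integral {a..b} (\<lambda>x. g x - L) = h b - h a" if "a \<le> b" for a b
      using hi2[OF that] by (rule integral_unique)
  qed
qed


section \<open>Differentiability almost everywhere of Lipschitz functions\<close>

lemma negligible_AE_lborel:
  assumes "AE x in lborel. P x"
  shows "negligible {x. \<not> P x}"
proof -
  obtain N where "{x. \<not> P x} \<subseteq> N" "N \<in> null_sets lborel"
    using assms unfolding eventually_ae_filter by auto
  then show ?thesis
    using negligible_iff_null_sets negligible_subset null_sets_completionI by blast
qed

text \<open>Lebesgue differentiation is available for intervals to the right of a point and yields
  the right-hand derivative. Applied to the reflected integrand it yields the left-hand one, with an
  exceptional set that has to be reflected back.\<close>

lemma indefinite_integral_has_derivative_AE: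
  fixes g h :: "real \<Rightarrow> real"
  assumes int: "\<And>a b. g integrable_on {a..b}"
    and h: "\<And>a b. a \<le> b \<Longrightarrow> integral {a..b} g = h b - h a"
  shows "AE x in lborel. (h has_field_derivative g x) (at x)"
proof -
  obtain N1 where N1: "negligible N1" "\<And>x e. x \<notin> N1 \<Longrightarrow> 0 < e \<Longrightarrow>
      \<exists>d>0. \<forall>k. 0 < k \<and> k < d \<longrightarrow> \<bar>integral {x..x + k} g / k - g x\<bar> < e"
    using integrable_ccontinuous_explicit[of g] int
    by (auto simp: divide_inverse mult.commute)
  define g' where "g' x = g (- x)" for x
  have int': "g' integrable_on {a..b}" for a b
    unfolding g'_def using iffD2[OF Henstock_Kurzweil_Integration.integrable_reflect_real[where f=g and a="-b" and b="-a"] int]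
    by (simp only: minus_minus)
  have refl: "integral {- x.. - x + k} g' = integral {x - k..x} g" for x k
    unfolding g'_def using Henstock_Kurzweil_Integration.integral_reflect_real[where f=g and a="x - k" and b=x] by simp
  obtain N2 where N2: "negligible N2" "\<And>x e. x \<notin> N2 \<Longrightarrow> 0 < e \<Longrightarrow>
      \<exists>d>0. \<forall>k. 0 < k \<and> k < d \<longrightarrow> \<bar>integral {x..x + k} g' / k - g' x\<bar> < e"
    using integrable_ccontinuous_explicit[of g'] int'
    by (auto simp: divide_inverse mult.commute)
  have "negligible (N1 \<union> uminus ` N2)"
    using N1(1) N2(1) by (intro negligible_Un negligible_differentiable_image_negligible differentiable_on_minus
        differentiable_on_id[unfolded id_def]) auto
  then have "AE x in lebesgue. x \<notin> N1 \<union> uminus ` N2"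
    unfolding negligible_iff_null_sets by (rule AE_not_in)
  then have "AE x in lborel. x \<notin> N1 \<union> uminus ` N2"
    by (simp add: AE_completion_iff)
  then show ?thesis
  proof eventually_elim
    case (elim x)
    then have x1: "x \<notin> N1" and x2: "- x \<notin> N2" by (auto intro: image_eqI[of _ _ "-x"])
    have "((\<lambda>k. (h (x + k) - h x) / k) \<longlongrightarrow> g x) (at 0)"
    proof (rule LIM_I)
      fix e :: real assume "e > 0"
      obtain d1 where d1: "d1 > 0" "\<And>k. 0 < k \<Longrightarrow> k < d1 \<Longrightarrow> \<bar>integral {x..x + k} g / k - g x\<bar> < e"
        using N1(2)[OF x1 \<open>e > 0\<close>] by blast
      obtain d2 where d2: "d2 > 0"
        "\<And>k. 0 < k \<Longrightarrow> k < d2 \<Longrightarrow> \<bar>integral {-x..-x + k} g' / k - g x\<bar> < e"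
        using N2(2)[OF x2 \<open>e > 0\<close>] by (auto simp: g'_def)
      show "\<exists>d>0. \<forall>k. k \<noteq> 0 \<and> norm (k - 0) < d \<longrightarrow> norm ((h (x + k) - h x) / k - g x) < e"
      proof (intro exI conjI allI impI)
        show "min d1 d2 > 0" using d1 d2 by simp
        fix k :: real assume k: "k \<noteq> 0 \<and> norm (k - 0) < min d1 d2"
        show "norm ((h (x + k) - h x) / k - g x) < e"
        proof (cases "k > 0")
          case True
          with d1(2)[of k] k h[of x "x + k"] show ?thesis by simp
        next
          case False
          with k have "0 < - k" "- k < d2" by auto
          moreover have "integral {x + k..x} g = h x - h (x + k)"
            using h[of "x + k" x] False by simp
          moreover have "(h x - h (x + k)) / (-k) = (h (x + k) - h x) / k"
            by (metis minus_diff_eq minus_divide_divide)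
          ultimately show ?thesis
            using d2(2)[of "-k"] refl[of x "-k"] by simp
        qed
      qed
    qed
    then show ?case by (simp add: DERIV_def)
  qed
qed

lemma lipschitz_real_has_derivative_AE:
  fixes h :: "real \<Rightarrow> real"
  assumes "L-lipschitz_on UNIV h"
  shows "AE x in lborel. (h has_field_derivative deriv h x) (at x)"
proof -
  obtain g where "\<And>a b. g integrable_on {a..b}" "\<And>a b. a \<le> b \<Longrightarrow> integral {a..b} g = h b - h a"
    using lipschitz_real_eq_indefinite_integral[OF assms] by blast
  then have "AE x in lborel. (h has_field_derivative g x) (at x)"
    by (rule indefinite_integral_has_derivative_AE)
  then show ?thesis
    by eventually_elim (simp add: DERIV_imp_deriv)
qed

lemma lipschitz_real_deriv_le:
  fixes h :: "real \<Rightarrow> real"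
  assumes lip: "L-lipschitz_on UNIV h" and D: "(h has_field_derivative D) (at x)"
  shows "\<bar>D\<bar> \<le> L"
proof -
  have "((\<lambda>y. \<bar>(h y - h x) / (y - x)\<bar>) \<longlongrightarrow> \<bar>D\<bar>) (at x)"
    using D by (intro tendsto_rabs) (simp add: has_field_derivative_iff)
  moreover have "\<forall>\<^sub>F y in at x. \<bar>(h y - h x) / (y - x)\<bar> \<le> L"
    using lipschitz_onD[OF lip, of _ x]
    by (auto simp: eventually_at_filter dist_real_def divide_le_eq)
  ultimately show ?thesis
    by (rule tendsto_upperbound) simp
qed

text \<open>At points without a derivative, \<^const>\<open>deriv\<close> has a value that does not depend on the
  point, so \<^const>\<open>deriv\<close> is Borel as soon as the set of points of differentiability is.\<close>

lemma borel_measurable_deriv: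
  fixes h :: "real \<Rightarrow> real"
  assumes cont: "continuous_on UNIV h"
  shows "deriv h \<in> borel_measurable borel"
proof -
  have [measurable]: "h \<in> borel_measurable borel"
    using cont by (rule borel_measurable_continuous_onI)
  define q where "q k x = (h (x + k) - h x) / k" for k x
  have [measurable]: "q k \<in> borel_measurable borel" for k
    unfolding q_def by measurable
  \<comment> \<open>A Cauchy criterion for the difference quotients at \<open>0\<close>. Quantifying
    over rational increments makes it a countable combination of Borel conditions; by continuity of
    \<open>h\<close> it extends to real increments, and so it characterises
    differentiability.\<close>
  define P where "P x \<longleftrightarrow> (\<forall>n::nat. \<exists>m::nat. \<forall>k l :: rat.
      real_of_rat k \<noteq> 0 \<longrightarrow> \<bar>real_of_rat k\<bar> < inverse (Suc m) \<longrightarrow>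
      real_of_rat l \<noteq> 0 \<longrightarrow> \<bar>real_of_rat l\<bar> < inverse (Suc m) \<longrightarrow>
      \<bar>q (of_rat k) x - q (of_rat l) x\<bar> \<le> inverse (Suc n))" for x :: real
  have [measurable]: "Measurable.pred borel P"
    unfolding P_def by measurable
  have q_ext: "\<bar>q k x - q l x\<bar> \<le> e"
    if P: "\<And>k l. k \<in> \<rat> \<Longrightarrow> l \<in> \<rat> \<Longrightarrow> k \<noteq> 0 \<Longrightarrow> \<bar>k\<bar> < d \<Longrightarrow> l \<noteq> 0 \<Longrightarrow> \<bar>l\<bar> < d \<Longrightarrow> \<bar>q k x - q l x\<bar> \<le> e"
      and k: "k \<noteq> 0" "\<bar>k\<bar> < d" and l: "l \<noteq> 0" "\<bar>l\<bar> < d" for k l x d e :: real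
  proof -
    have "\<exists>X. (\<forall>n. X n \<in> \<rat>) \<and> X \<longlonglongrightarrow> y" for y :: real
    proof -
      have "y \<in> closure \<rat>" by (simp add: Rats_closure_real)
      then show ?thesis unfolding closure_sequential by blast
    qed
    then obtain X Y where X: "\<And>n::nat. X n \<in> \<rat>" "X \<longlonglongrightarrow> k" and Y: "\<And>n. Y n \<in> \<rat>" "Y \<longlonglongrightarrow> l"
      by metis
    have ev: "\<forall>\<^sub>F n in sequentially. Z n \<noteq> 0 \<and> \<bar>Z n\<bar> < d"
      if "Z \<longlonglongrightarrow> z" "z \<noteq> 0" "\<bar>z\<bar> < d" for Z :: "nat \<Rightarrow> real" and z
      using that tendsto_imp_eventually_ne order_tendstoD(2)[OF tendsto_rabs] by (intro eventually_conj) blast+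
    have lim: "(\<lambda>n. q (Z n) x) \<longlonglongrightarrow> q z x" if "Z \<longlonglongrightarrow> z" "z \<noteq> 0" for Z :: "nat \<Rightarrow> real" and z
      unfolding q_def using that cont
      by (intro tendsto_intros continuous_on_tendsto_compose[OF cont]) auto
    have "(\<lambda>n. \<bar>q (X n) x - q (Y n) x\<bar>) \<longlonglongrightarrow> \<bar>q k x - q l x\<bar>"
      using X Y k l by (intro tendsto_intros lim)
    moreover have "\<forall>\<^sub>F n in sequentially. \<bar>q (X n) x - q (Y n) x\<bar> \<le> e"
      using ev[OF X(2) k] ev[OF Y(2) l] by eventually_elim (use P X(1) Y(1) in blast)
    ultimately show ?thesis
      by (rule tendsto_upperbound) simp
  qed
  have DP: "(\<exists>D. (h has_field_derivative D) (at x)) \<longleftrightarrow> P x" for x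
  proof
    assume "\<exists>D. (h has_field_derivative D) (at x)"
    then obtain D where D: "(\<lambda>k. q k x) \<midarrow>0\<rightarrow> D"
      by (auto simp: DERIV_def q_def)
    show "P x"
      unfolding P_def
    proof (intro allI)
      fix n :: nat
      obtain d where d: "d > 0" "\<And>k. k \<noteq> 0 \<Longrightarrow> \<bar>k\<bar> < d \<Longrightarrow> \<bar>q k x - D\<bar> < inverse (Suc n) / 2"
        using LIM_D[OF D, of "inverse (Suc n) / 2"] by auto
      obtain m where m: "inverse (Suc m) < d"
        using reals_Archimedean[OF d(1)] by blast
      have *: "\<bar>q k x - q l x\<bar> \<le> inverse (Suc n)"
        if "k \<noteq> 0" "\<bar>k\<bar> < inverse (Suc m)" "l \<noteq> 0" "\<bar>l\<bar> < inverse (Suc m)" for k l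
        using d(2)[of k] d(2)[of l] m that by linarith
      show "\<exists>m. \<forall>k l :: rat. real_of_rat k \<noteq> 0 \<longrightarrow> \<bar>real_of_rat k\<bar> < inverse (Suc m) \<longrightarrow>
          real_of_rat l \<noteq> 0 \<longrightarrow> \<bar>real_of_rat l\<bar> < inverse (Suc m) \<longrightarrow>
          \<bar>q (of_rat k) x - q (of_rat l) x\<bar> \<le> inverse (Suc n)"
        by (intro exI[of _ m] allI impI) (rule *)
    qed
  next
    assume "P x"
    have "\<exists>D. (\<lambda>n. q (inverse (Suc n)) x) \<longlonglongrightarrow> D \<and> (\<lambda>k. q k x) \<midarrow>0\<rightarrow> D"
    proof -
      have C: "\<exists>d>0. \<forall>k l. k \<noteq> 0 \<longrightarrow> \<bar>k\<bar> < d \<longrightarrow> l \<noteq> 0 \<longrightarrow> \<bar>l\<bar> < d \<longrightarrow> \<bar>q k x - q l x\<bar> < e"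
        if e: "e > 0" for e
      proof -
        obtain n where n: "inverse (Suc n) < e"
          using reals_Archimedean[OF e] by blast
        obtain m where m: "\<And>k l. k \<in> \<rat> \<Longrightarrow> l \<in> \<rat> \<Longrightarrow> k \<noteq> 0 \<Longrightarrow> \<bar>k\<bar> < inverse (Suc m) \<Longrightarrow>
            l \<noteq> 0 \<Longrightarrow> \<bar>l\<bar> < inverse (Suc m) \<Longrightarrow> \<bar>q k x - q l x\<bar> \<le> inverse (Suc n)"
          using \<open>P x\<close> unfolding P_def by (metis Rats_cases)
        from q_ext[of "inverse (Suc m)", OF m] n show ?thesis
          by (intro exI[of _ "inverse (Suc m)"]) (auto intro: order.strict_trans1)
      qed
      have inv: "(\<lambda>n. inverse (real (Suc n))) \<longlonglongrightarrow> 0"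
        by (rule LIMSEQ_inverse_real_of_nat)
      have ev: "\<forall>\<^sub>F n in sequentially. inverse (real (Suc n)) < d" if "d > 0" for d
        using order_tendstoD(2)[OF inv that] .
      have "Cauchy (\<lambda>n. q (inverse (Suc n)) x)"
      proof (rule metric_CauchyI)
        fix e :: real assume "e > 0"
        obtain d where d: "d > 0" "\<And>k l. k \<noteq> 0 \<Longrightarrow> \<bar>k\<bar> < d \<Longrightarrow> l \<noteq> 0 \<Longrightarrow> \<bar>l\<bar> < d \<Longrightarrow> \<bar>q k x - q l x\<bar> < e"
          using C[OF \<open>e > 0\<close>] by blast
        obtain M where "\<And>n. n \<ge> M \<Longrightarrow> inverse (real (Suc n)) < d"
          using ev[OF d(1)] by (auto simp: eventually_sequentially)
        then show "\<exists>M. \<forall>m\<ge>M. \<forall>n\<ge>M. dist (q (inverse (Suc m)) x) (q (inverse (Suc n)) x) < e"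
          using d(2) by (intro exI[of _ M]) (auto simp: dist_real_def)
      qed
      then obtain D where D: "(\<lambda>n. q (inverse (Suc n)) x) \<longlonglongrightarrow> D"
        using Cauchy_convergent convergent_def by blast
      have "(\<lambda>k. q k x) \<midarrow>0\<rightarrow> D"
      proof (rule LIM_I)
        fix e :: real assume "e > 0"
        obtain d where d: "d > 0" "\<And>k l. k \<noteq> 0 \<Longrightarrow> \<bar>k\<bar> < d \<Longrightarrow> l \<noteq> 0 \<Longrightarrow> \<bar>l\<bar> < d \<Longrightarrow> \<bar>q k x - q l x\<bar> < e / 2"
          using C[of "e / 2"] \<open>e > 0\<close> by auto
        have "\<bar>q k x - D\<bar> \<le> e / 2" if k: "k \<noteq> 0" "\<bar>k\<bar> < d" for k
        proof (rule tendsto_upperbound)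
          show "(\<lambda>n. \<bar>q k x - q (inverse (Suc n)) x\<bar>) \<longlonglongrightarrow> \<bar>q k x - D\<bar>"
            by (intro tendsto_intros D)
          show "\<forall>\<^sub>F n in sequentially. \<bar>q k x - q (inverse (Suc n)) x\<bar> \<le> e / 2"
            using ev[OF d(1)] by eventually_elim (use d(2) k in \<open>force intro: less_imp_le\<close>)
        qed simp
        then show "\<exists>s>0. \<forall>k. k \<noteq> 0 \<and> norm (k - 0) < s \<longrightarrow> norm (q k x - D) < e"
          using d(1) \<open>e > 0\<close> by (intro exI[of _ d]) force
      qed
      with D show ?thesis by blast
    qed
    then show "\<exists>D. (h has_field_derivative D) (at x)"
      by (auto simp: DERIV_def q_def)
  qed
  define c where "c = (SOME D::real. False)"
  have "deriv h x = (if P x then lim (\<lambda>n. q (inverse (Suc n)) x) else c)" for x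
  proof (cases "P x")
    case True
    then obtain D where D: "(h has_field_derivative D) (at x)"
      using DP by blast
    have "filterlim (\<lambda>n. inverse (real (Suc n))) (at 0) sequentially"
      by (rule filterlim_atI[OF LIMSEQ_inverse_real_of_nat]) auto
    then have "(\<lambda>n. q (inverse (Suc n)) x) \<longlonglongrightarrow> D"
      using D filterlim_compose[of "\<lambda>k. q k x" "nhds D" "at 0"] by (auto simp: DERIV_def q_def)
    with True DERIV_imp_deriv[OF D] show ?thesis by (simp add: limI)
  next
    case False
    then have "(\<lambda>D. (h has_field_derivative D) (at x)) = (\<lambda>D. False)"
      using DP by blast
    with False show ?thesis by (simp add: deriv_def c_def)
  qed
  moreover have "(\<lambda>x. if P x then lim (\<lambda>n. q (inverse (Suc n)) x) else c) \<in> borel_measurable borel"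
    by measurable
  ultimately show ?thesis by presburger
qed

section \<open>Integrals against the derivative of a Lipschitz function\<close>

lemma set_integrable_lipschitz_deriv:
  fixes f h :: "real \<Rightarrow> real"
  assumes f: "f \<in> borel_measurable borel" "\<And>x. x \<in> {a..b} \<Longrightarrow> \<bar>f x\<bar> \<le> B" and h: "L-lipschitz_on UNIV h"
  shows "set_integrable lborel {a..b} (\<lambda>x. f x * deriv h x)"
proof -
  have [measurable]: "deriv h \<in> borel_measurable borel"
    using h lipschitz_on_continuous_on borel_measurable_deriv by blast
  note f(1)[measurable]
  have "integrable lborel (\<lambda>x. indicator {a..b} x *\<^sub>R (f x * deriv h x))"
  proof (rule Bochner_Integration.integrable_bound)
    show "integrable lborel (\<lambda>x. B * L * indicator {a..b} x)"
      by (intro integrable_mult_right integrable_real_indicator) (auto simp: emeasure_lborel_Icc_eq)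
    show "AE x in lborel. norm (indicator {a..b} x *\<^sub>R (f x * deriv h x)) \<le> norm (B * L * indicator {a..b} x)"
      using lipschitz_real_has_derivative_AE[OF h]
    proof eventually_elim
      case (elim x)
      then have "\<bar>deriv h x\<bar> \<le> L" using lipschitz_real_deriv_le[OF h] by blast
      then have "\<bar>f x * deriv h x\<bar> \<le> \<bar>B * L\<bar>" if "x \<in> {a..b}"
        using f(2)[OF that] unfolding abs_mult by (intro mult_mono) auto
      then show ?case by (auto simp: indicator_def abs_mult)
    qed
  qed measurable
  then show ?thesis unfolding set_integrable_def .
qed

lemma set_integral_deriv_lipschitz:
  fixes h :: "real \<Rightarrow> real"
  assumes h: "L-lipschitz_on UNIV h" and "a \<le> b"
  shows "(LBINT x:{a..b}. deriv h x) = h b - h a"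
proof -
  obtain g where g: "\<And>a b. g integrable_on {a..b}" "\<And>a b. a \<le> b \<Longrightarrow> integral {a..b} g = h b - h a"
    using lipschitz_real_eq_indefinite_integral[OF h] by blast
  have "AE x in lborel. (h has_field_derivative g x) (at x)"
    using g by (rule indefinite_integral_has_derivative_AE)
  then have ae: "AE x in lborel. deriv h x = g x"
    by eventually_elim (simp add: DERIV_imp_deriv)
  have "set_integrable lborel {a..b} (\<lambda>x. 1 * deriv h x)"
    by (rule set_integrable_lipschitz_deriv[OF _ _ h, of _ _ _ 1]) auto
  then have si: "set_integrable lborel {a..b} (deriv h)" by simp
  have "(LBINT x:{a..b}. deriv h x) = integral {a..b} (deriv h)"
    using set_borel_integral_eq_integral(2)[OF si] .
  also have "\<dots> = integral {a..b} g"
  proof (rule integral_spike)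
    show "negligible {x. deriv h x \<noteq> g x}"
      using negligible_AE_lborel[OF ae] by simp
  qed auto
  finally show ?thesis using g(2)[OF \<open>a \<le> b\<close>] by simp
qed


lemma abs_set_integral_lipschitz_deriv_le:
  fixes f h :: "real \<Rightarrow> real"
  assumes f: "f \<in> borel_measurable borel" "\<And>x. x \<in> {a..b} \<Longrightarrow> \<bar>f x\<bar> \<le> B"
    and h: "L-lipschitz_on UNIV h" and "a \<le> b"
  shows "\<bar>LBINT x:{a..b}. f x * deriv h x\<bar> \<le> B * L * (b - a)"
proof -
  have B: "B \<ge> 0" using f(2)[of a] \<open>a \<le> b\<close> by auto
  have "\<bar>LBINT x:{a..b}. f x * deriv h x\<bar> \<le> (LBINT x. \<bar>indicator {a..b} x *\<^sub>R (f x * deriv h x)\<bar>)"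
    unfolding set_lebesgue_integral_def by (rule integral_abs_bound)
  also have "\<dots> \<le> (LBINT x:{a..b}. B * L)"
    unfolding set_lebesgue_integral_def
  proof (intro integral_mono_AE integrable_abs)
    show "integrable lborel (\<lambda>x. indicator {a..b} x *\<^sub>R (f x * deriv h x))"
      using set_integrable_lipschitz_deriv[OF f h] unfolding set_integrable_def .
    show "integrable lborel (\<lambda>x. indicator {a..b} x *\<^sub>R (B * L))"
      by (simp add: emeasure_lborel_Icc_eq)
    show "AE x in lborel. \<bar>indicator {a..b} x *\<^sub>R (f x * deriv h x)\<bar> \<le> indicator {a..b} x *\<^sub>R (B * L)"
      using lipschitz_real_has_derivative_AE[OF h]
    proof eventually_elim
      case (elim x)
      then have "\<bar>deriv h x\<bar> \<le> L" using lipschitz_real_deriv_le[OF h] by blast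
      then have "\<bar>f x * deriv h x\<bar> \<le> B * L" if "x \<in> {a..b}"
        using f(2)[OF that] B unfolding abs_mult by (intro mult_mono) auto
      then show ?case by (auto simp: indicator_def)
    qed
  qed
  also have "\<dots> = B * L * (b - a)"
    using \<open>a \<le> b\<close> by (simp add: set_lebesgue_integral_def)
  finally show ?thesis .
qed

text \<open>Composition with the retraction \<open>c\<close> onto \<open>{a..b}\<close> extends
  \<open>f\<close> to a Lipschitz function on the line with the same derivative inside the interval,
  which reduces the claim to the global fundamental theorem.\<close>

lemma set_integral_has_derivative_lipschitz_on:
  fixes f g :: "real \<Rightarrow> real"
  assumes lip: "L-lipschitz_on {a..b} f" and "a \<le> b" and g: "g \<in> borel_measurable borel"
    and D: "AE x in lborel. x \<in> {a<..<b} \<longrightarrow> (f has_field_derivative g x) (at x)"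
  shows "(LBINT x:{a..b}. g x) = f b - f a"
proof -
  define c where "c x = max a (min b x)" for x
  have c1: "\<bar>c x - c y\<bar> \<le> \<bar>x - y\<bar>" "c x \<in> {a..b}" for x y
    using \<open>a \<le> b\<close> by (auto simp: c_def)
  have lip': "L-lipschitz_on UNIV (f \<circ> c)"
  proof (rule lipschitz_onI)
    fix x y
    have "dist (f (c x)) (f (c y)) \<le> L * dist (c x) (c y)"
      using lipschitz_onD[OF lip c1(2) c1(2)] .
    also have "\<dots> \<le> L * dist x y"
      using c1(1)[of x y] lipschitz_on_nonneg[OF lip] by (intro mult_left_mono) (auto simp: dist_real_def)
    finally show "dist ((f \<circ> c) x) ((f \<circ> c) y) \<le> L * dist x y" by simp
  qed (use lip lipschitz_on_nonneg in blast)
  have "(LBINT x:{a..b}. g x) = (LBINT x:{a..b}. deriv (f \<circ> c) x)"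
  proof (rule set_lebesgue_integral_cong_AE)
    show "deriv (f \<circ> c) \<in> borel_measurable lborel"
      using borel_measurable_deriv[OF lipschitz_on_continuous_on[OF lip']] by simp
    have "AE x in lborel. x \<noteq> a \<and> x \<noteq> b"
      using AE_lborel_singleton[of a] AE_lborel_singleton[of b] by eventually_elim auto
    with D show "AE x\<in>{a..b} in lborel. g x = deriv (f \<circ> c) x"
    proof eventually_elim
      case (elim x)
      show ?case
      proof
        assume "x \<in> {a..b}"
        with elim have x: "x \<in> {a<..<b}" by auto
        have "((f \<circ> c) has_field_derivative g x) (at x)"
        proof (rule has_field_derivative_transform_within_open[where S="{a<..<b}"])
          show "(f has_field_derivative g x) (at x)" using elim x by blast
        qed (use x in \<open>auto simp: c_def\<close>)
        then show "g x = deriv (f \<circ> c) x" by (simp add: DERIV_imp_deriv)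
      qed
    qed
  qed (use g in auto)
  also have "\<dots> = f b - f a"
    using set_integral_deriv_lipschitz[OF lip' \<open>a \<le> b\<close>] \<open>a \<le> b\<close> by (simp add: c_def)
  finally show ?thesis .
qed

lemma lipschitz_on_Icc_bounded:
  fixes f :: "real \<Rightarrow> real"
  assumes "L-lipschitz_on UNIV f"
  obtains B where "B \<ge> 0" "\<And>x. x \<in> {a..b} \<Longrightarrow> \<bar>f x\<bar> \<le> B"
proof
  show "\<bar>f a\<bar> + L * \<bar>b - a\<bar> \<ge> 0"
    using lipschitz_on_nonneg[OF assms] by simp
  fix x assume x: "x \<in> {a..b}"
  have "\<bar>f x - f a\<bar> \<le> L * \<bar>x - a\<bar>"
    using lipschitz_onD[OF assms, of x a] by (simp add: dist_real_def)
  also have "\<dots> \<le> L * \<bar>b - a\<bar>"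
    using x lipschitz_on_nonneg[OF assms] by (intro mult_left_mono) auto
  finally show "\<bar>f x\<bar> \<le> \<bar>f a\<bar> + L * \<bar>b - a\<bar>" by linarith
qed

lemma borel_measurable_lipschitz:
  fixes f :: "real \<Rightarrow> real"
  assumes "L-lipschitz_on UNIV f"
  shows "f \<in> borel_measurable borel"
  using assms lipschitz_on_continuous_on borel_measurable_continuous_onI by blast

text \<open>The product is Lipschitz on the bounded interval, although not on the line, so the local
  fundamental theorem applies. The purpose is to free \<open>h\<close> from its derivative when a
  limit in \<open>h\<close> is taken.\<close>

lemma set_integral_lipschitz_by_parts:
  fixes f h :: "real \<Rightarrow> real"
  assumes f: "K-lipschitz_on UNIV f" and h: "L-lipschitz_on UNIV h" and "a \<le> b"
  shows "(LBINT x:{a..b}. f x * deriv h x) = f b * h b - f a * h a - (LBINT x:{a..b}. h x * deriv f x)"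
proof -
  obtain Bf where Bf: "Bf \<ge> 0" "\<And>x. x \<in> {a..b} \<Longrightarrow> \<bar>f x\<bar> \<le> Bf"
    using lipschitz_on_Icc_bounded[OF f] by blast
  obtain Bh where Bh: "Bh \<ge> 0" "\<And>x. x \<in> {a..b} \<Longrightarrow> \<bar>h x\<bar> \<le> Bh"
    using lipschitz_on_Icc_bounded[OF h] by blast
  note meas[measurable] = borel_measurable_lipschitz[OF f] borel_measurable_lipschitz[OF h]
    borel_measurable_deriv[OF lipschitz_on_continuous_on[OF f]]
    borel_measurable_deriv[OF lipschitz_on_continuous_on[OF h]]
  have lip: "(Bf * L + Bh * K)-lipschitz_on {a..b} (\<lambda>x. f x * h x)"
  proof (rule lipschitz_onI)
    fix x y assume xy: "x \<in> {a..b}" "y \<in> {a..b}"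
    have "\<bar>f x * h x - f y * h y\<bar> = \<bar>f x * (h x - h y) + h y * (f x - f y)\<bar>"
      by (simp add: algebra_simps)
    also have "\<dots> \<le> \<bar>f x\<bar> * \<bar>h x - h y\<bar> + \<bar>h y\<bar> * \<bar>f x - f y\<bar>"
      by (metis abs_mult abs_triangle_ineq)
    also have "\<dots> \<le> Bf * (L * \<bar>x - y\<bar>) + Bh * (K * \<bar>x - y\<bar>)"
      using lipschitz_onD[OF f, of x y] lipschitz_onD[OF h, of x y] Bf Bh xy
      by (intro add_mono mult_mono) (auto simp: dist_real_def)
    finally show "dist (f x * h x) (f y * h y) \<le> (Bf * L + Bh * K) * dist x y"
      by (simp add: dist_real_def algebra_simps)
  qed (use Bf Bh lipschitz_on_nonneg[OF f] lipschitz_on_nonneg[OF h] in auto)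
  have "(LBINT x:{a..b}. f x * deriv h x + h x * deriv f x) = f b * h b - f a * h a"
  proof (rule set_integral_has_derivative_lipschitz_on[OF lip \<open>a \<le> b\<close>])
    show "AE x in lborel. x \<in> {a<..<b} \<longrightarrow>
        ((\<lambda>x. f x * h x) has_field_derivative f x * deriv h x + h x * deriv f x) (at x)"
      using lipschitz_real_has_derivative_AE[OF f] lipschitz_real_has_derivative_AE[OF h]
      by eventually_elim (auto intro!: derivative_eq_intros)
  qed measurable
  moreover have "(LBINT x:{a..b}. f x * deriv h x + h x * deriv f x) =
      (LBINT x:{a..b}. f x * deriv h x) + (LBINT x:{a..b}. h x * deriv f x)"
    by (intro set_integral_add set_integrable_lipschitz_deriv[OF meas(1) Bf(2) h]
        set_integrable_lipschitz_deriv[OF meas(2) Bh(2) f])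
  ultimately show ?thesis by simp
qed

text \<open>No chain rule is available for \<open>p \<circ> \<phi>\<close>, since \<open>\<phi>\<close> may map a set of positive measure into
  the set where \<open>p\<close> is not differentiable. Instead, the primitive \<open>H\<close> of \<open>f p'\<close> satisfies
  \<open>H y - H x = f x (p y - p x) + O((y - x)\<^sup>2)\<close>, which gives the derivative of \<open>H \<circ> \<phi>\<close>.\<close>

lemma set_integral_lipschitz_substitution:
  fixes f p \<phi> :: "real \<Rightarrow> real"
  assumes f: "K-lipschitz_on UNIV f" and p: "M-lipschitz_on UNIV p" and \<phi>: "L-lipschitz_on UNIV \<phi>"
    and "a \<le> b"
  shows "(LBINT t:{a..b}. f (\<phi> t) * deriv (p \<circ> \<phi>) t) =
    sgn (\<phi> b - \<phi> a) * (LBINT x:{min (\<phi> a) (\<phi> b)..max (\<phi> a) (\<phi> b)}. f x * deriv p x)"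
proof -
  obtain R where R: "R \<ge> 0" "\<And>t. t \<in> {a..b} \<Longrightarrow> \<bar>\<phi> t\<bar> \<le> R"
    using lipschitz_on_Icc_bounded[OF \<phi>] by blast
  obtain B where B: "B \<ge> 0" "\<And>x. x \<in> {-R..R} \<Longrightarrow> \<bar>f x\<bar> \<le> B"
    using lipschitz_on_Icc_bounded[OF f] by blast
  have nn: "K \<ge> 0" "M \<ge> 0" "L \<ge> 0"
    using f p \<phi> lipschitz_on_nonneg by blast+
  have p\<phi>: "(M * L)-lipschitz_on UNIV (p \<circ> \<phi>)"
    using lipschitz_on_compose[OF \<phi>] p lipschitz_on_subset by blast
  note meas[measurable] = borel_measurable_lipschitz[OF f] borel_measurable_lipschitz[OF \<phi>]
    borel_measurable_deriv[OF lipschitz_on_continuous_on[OF p]]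
    borel_measurable_deriv[OF lipschitz_on_continuous_on[OF p\<phi>]]
  define H where "H x = (LBINT u:{-R..x}. f u * deriv p u)" for x
  have si: "set_integrable lborel {x..y} (\<lambda>u. f u * deriv p u)" if "-R \<le> x" "y \<le> R" for x y
    using set_integrable_lipschitz_deriv[OF meas(1) _ p, of x y B] B that by auto
  have H_diff: "H y - H x = (LBINT u:{x..y}. f u * deriv p u)" if "-R \<le> x" "x \<le> y" "y \<le> R" for x y
  proof -
    have "(LBINT u:{-R..y}. f u * deriv p u) = (LBINT u:{-R..x} \<union> {x<..y}. f u * deriv p u)"
      using that by (intro arg_cong[where f="\<lambda>A. set_lebesgue_integral lborel A _"]) auto
    also have "\<dots> = H x + (LBINT u:{x<..y}. f u * deriv p u)"
      unfolding H_def using that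
      by (intro set_integral_Un) (auto intro: si set_integrable_subset[OF si[of x y]])
    also have "(LBINT u:{x<..y}. f u * deriv p u) = (LBINT u:{x..y}. f u * deriv p u)"
      unfolding set_lebesgue_integral_def
    proof (rule integral_cong_AE)
      show "AE u in lborel. indicator {x<..y} u *\<^sub>R (f u * deriv p u) =
          indicator {x..y} u *\<^sub>R (f u * deriv p u)"
        using AE_lborel_singleton[of x] by eventually_elim (auto simp: indicator_def)
    qed measurable
    finally show ?thesis by (simp add: H_def)
  qed
  \<comment> \<open>The base point \<open>z\<close> may be either end, so that \<open>est\<close>
    can treat \<open>y < x\<close> by exchanging the two points.\<close>
  have est1: "\<bar>H y - H x - f z * (p y - p x)\<bar> \<le> K * M * (y - x)^2"
    if "-R \<le> x" "x \<le> y" "y \<le> R" "z = x \<or> z = y" for x y z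
  proof -
    have "H y - H x - f z * (p y - p x) =
        (LBINT u:{x..y}. f u * deriv p u) - (LBINT u:{x..y}. f z * deriv p u)"
      using H_diff that set_integral_deriv_lipschitz[OF p \<open>x \<le> y\<close>] by simp
    also have "\<dots> = (LBINT u:{x..y}. (f u - f z) * deriv p u)"
      using set_integrable_lipschitz_deriv[OF _ _ p, of "\<lambda>_. f z" x y "\<bar>f z\<bar>"] si[of x y] that
      by (subst set_integral_diff(2)[symmetric]) (auto simp: left_diff_distrib)
    finally have "\<bar>H y - H x - f z * (p y - p x)\<bar> = \<bar>LBINT u:{x..y}. (f u - f z) * deriv p u\<bar>"
      by simp
    also have "\<dots> \<le> K * (y - x) * M * (y - x)"
    proof (rule abs_set_integral_lipschitz_deriv_le[OF _ _ p \<open>x \<le> y\<close>])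
      fix u assume "u \<in> {x..y}"
      then have "\<bar>f u - f z\<bar> \<le> K * \<bar>u - z\<bar>" "\<bar>u - z\<bar> \<le> y - x"
        using lipschitz_onD[OF f, of u z] that(4) by (auto simp: dist_real_def)
      then show "\<bar>f u - f z\<bar> \<le> K * (y - x)"
        using nn by (meson mult_left_mono order_trans)
    qed measurable
    finally show ?thesis by (simp add: power2_eq_square mult_ac)
  qed
  have est: "\<bar>H y - H x - f x * (p y - p x)\<bar> \<le> K * M * (y - x)^2"
    if "x \<in> {-R..R}" "y \<in> {-R..R}" for x y
  proof (cases "x \<le> y")
    case True
    then show ?thesis using est1[of x y x] that by auto
  next
    case False
    then have "\<bar>H x - H y - f x * (p x - p y)\<bar> \<le> K * M * (x - y)^2"
      using est1[of y x x] that by auto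
    then show ?thesis by (simp add: power2_commute abs_if algebra_simps split: if_splits)
  qed
  have HL: "\<bar>H y - H x\<bar> \<le> B * M * \<bar>y - x\<bar>" if xy: "x \<in> {-R..R}" "y \<in> {-R..R}" for x y
  proof -
    have *: "\<bar>H y - H x\<bar> \<le> B * M * \<bar>y - x\<bar>" if "x \<in> {-R..R}" "y \<in> {-R..R}" "x \<le> y" for x y
      using H_diff[of x y] abs_set_integral_lipschitz_deriv_le[OF meas(1) _ p, of x y B] B(2) that by auto
    show ?thesis using *[of x y] *[of y x] xy by (cases "x \<le> y") (auto simp: abs_minus_commute)
  qed
  have R': "\<phi> t \<in> {-R..R}" if "t \<in> {a..b}" for t
    using R(2)[OF that] by (auto simp: abs_le_iff)
  have "(LBINT t:{a..b}. f (\<phi> t) * deriv (p \<circ> \<phi>) t) = H (\<phi> b) - H (\<phi> a)"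
  proof (rule set_integral_has_derivative_lipschitz_on[OF _ \<open>a \<le> b\<close>, of "B * M * L" "\<lambda>t. H (\<phi> t)"])
    show "(B * M * L)-lipschitz_on {a..b} (\<lambda>t. H (\<phi> t))"
    proof (rule lipschitz_onI)
      fix s t assume st: "s \<in> {a..b}" "t \<in> {a..b}"
      have "\<bar>H (\<phi> s) - H (\<phi> t)\<bar> \<le> B * M * \<bar>\<phi> s - \<phi> t\<bar>"
        using HL R' st by blast
      also have "\<dots> \<le> B * M * (L * \<bar>s - t\<bar>)"
        using lipschitz_onD[OF \<phi>, of s t] B nn by (intro mult_left_mono) (auto simp: dist_real_def)
      finally show "dist (H (\<phi> s)) (H (\<phi> t)) \<le> B * M * L * dist s t"
        by (simp add: dist_real_def mult_ac)
    qed (use B nn in auto)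
    show "AE t in lborel. t \<in> {a<..<b} \<longrightarrow>
        ((\<lambda>t. H (\<phi> t)) has_field_derivative f (\<phi> t) * deriv (p \<circ> \<phi>) t) (at t)"
      using lipschitz_real_has_derivative_AE[OF p\<phi>]
    proof eventually_elim
      case (elim t)
      show ?case
      proof
        assume t: "t \<in> {a<..<b}"
        let ?D = "f (\<phi> t) * deriv (p \<circ> \<phi>) t"
        have lim1: "((\<lambda>s. f (\<phi> t) * ((p (\<phi> s) - p (\<phi> t)) / (s - t))) \<longlongrightarrow> ?D) (at t)"
          using elim by (intro tendsto_intros) (simp add: has_field_derivative_iff)
        have "((\<lambda>s. (H (\<phi> s) - H (\<phi> t)) / (s - t) - f (\<phi> t) * ((p (\<phi> s) - p (\<phi> t)) / (s - t))) \<longlongrightarrow> 0) (at t)"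
        proof (rule Lim_null_comparison)
          have "\<forall>\<^sub>F s in at t. s \<in> {a<..<b} \<and> s \<noteq> t"
            using eventually_at_in_open[of "{a<..<b}" t] t by simp
          then show "\<forall>\<^sub>F s in at t. norm ((H (\<phi> s) - H (\<phi> t)) / (s - t) -
              f (\<phi> t) * ((p (\<phi> s) - p (\<phi> t)) / (s - t))) \<le> K * M * L^2 * \<bar>s - t\<bar>"
          proof eventually_elim
            case (elim s)
            have "norm ((H (\<phi> s) - H (\<phi> t)) / (s - t) - f (\<phi> t) * ((p (\<phi> s) - p (\<phi> t)) / (s - t)))
                = \<bar>H (\<phi> s) - H (\<phi> t) - f (\<phi> t) * (p (\<phi> s) - p (\<phi> t))\<bar> / \<bar>s - t\<bar>"
              by (simp add: diff_divide_distrib right_diff_distrib flip: abs_divide)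
            also have "\<dots> \<le> K * M * (\<phi> s - \<phi> t)^2 / \<bar>s - t\<bar>"
              using est R' elim t by (intro divide_right_mono) auto
            also have "\<dots> \<le> K * M * (L * \<bar>s - t\<bar>)^2 / \<bar>s - t\<bar>"
            proof -
              have "\<bar>\<phi> s - \<phi> t\<bar> \<le> L * \<bar>s - t\<bar>"
                using lipschitz_onD[OF \<phi>, of s t] by (simp add: dist_real_def)
              then have "(\<phi> s - \<phi> t)^2 \<le> (L * \<bar>s - t\<bar>)^2"
                by (metis abs_ge_zero power2_abs power_mono)
              then show ?thesis using nn by (intro divide_right_mono mult_left_mono) auto
            qed
            also have "\<dots> = K * M * L^2 * \<bar>s - t\<bar>"
              using elim by (simp add: power2_eq_square)
            finally show ?case .
          qed
          show "((\<lambda>s. K * M * L\<^sup>2 * \<bar>s - t\<bar>) \<longlongrightarrow> 0) (at t)"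
            by (auto intro!: tendsto_eq_intros)
        qed
        from tendsto_add[OF this lim1]
        show "((\<lambda>t. H (\<phi> t)) has_field_derivative ?D) (at t)"
          by (simp add: has_field_derivative_iff)
      qed
    qed
  qed measurable
  also have "\<dots> = sgn (\<phi> b - \<phi> a) * (LBINT x:{min (\<phi> a) (\<phi> b)..max (\<phi> a) (\<phi> b)}. f x * deriv p x)"
    using H_diff[of "\<phi> a" "\<phi> b"] H_diff[of "\<phi> b" "\<phi> a"] R'[of a] R'[of b] \<open>a \<le> b\<close>
    by (cases "\<phi> a" "\<phi> b" rule: linorder_cases) (auto simp: min_def max_def)
  finally show ?thesis .
qed

section \<open>Lipschitz functions and Borel sets of a metric space\<close>

lemma lipschitz_fun_iff:
  "lipschitz_fun Z f \<longleftrightarrow> (\<exists>L\<ge>0. \<forall>x\<in>mspace Z. \<forall>y\<in>mspace Z. \<bar>f x - f y\<bar> \<le> L * mdist Z x y)"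
proof
  assume "lipschitz_fun Z f"
  then show "\<exists>L\<ge>0. \<forall>x\<in>mspace Z. \<forall>y\<in>mspace Z. \<bar>f x - f y\<bar> \<le> L * mdist Z x y"
    by (auto simp: Lipschitz_continuous_map_pos dist_real_def intro: less_imp_le)
qed (auto simp: Lipschitz_continuous_map_def dist_real_def)

lemma lip_const_least:
  assumes "0 \<le> L" "\<And>x y. x \<in> mspace Z \<Longrightarrow> y \<in> mspace Z \<Longrightarrow> \<bar>f x - f y\<bar> \<le> L * mdist Z x y"
  shows "lip_const Z f \<le> L"
  unfolding lip_const_def using assms by (intro cInf_lower bdd_belowI[of _ 0]) auto

lemma lip_const_nonneg:
  assumes "lipschitz_fun Z f"
  shows "0 \<le> lip_const Z f"
  unfolding lip_const_def using assms[unfolded lipschitz_fun_iff] by (intro cInf_greatest) auto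

lemma abs_diff_le_lip_const:
  assumes f: "lipschitz_fun Z f" and xy: "x \<in> mspace Z" "y \<in> mspace Z"
  shows "\<bar>f x - f y\<bar> \<le> lip_const Z f * mdist Z x y"
proof (cases "mdist Z x y = 0")
  case True
  obtain L where "\<bar>f x - f y\<bar> \<le> L * mdist Z x y"
    using f[unfolded lipschitz_fun_iff] xy by blast
  with True show ?thesis by simp
next
  case False
  then have pos: "mdist Z x y > 0"
    using mdist_nonneg[of Z x y] by linarith
  have "\<bar>f x - f y\<bar> / mdist Z x y \<le> lip_const Z f"
    unfolding lip_const_def using f[unfolded lipschitz_fun_iff] xy pos
    by (intro cInf_greatest) (auto simp: divide_le_eq)
  with pos show ?thesis by (simp add: divide_le_eq)
qed

lemma lipschitz_fun_const [simp]: "lipschitz_fun Z (\<lambda>_. c)"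
  by (auto simp: lipschitz_fun_iff)

lemma lipschitz_fun_lincomb:
  assumes "lipschitz_fun Z f" "lipschitz_fun Z g"
  shows "lipschitz_fun Z (\<lambda>x. a * f x + b * g x)"
proof -
  obtain L where L: "L \<ge> 0" "\<And>x y. x \<in> mspace Z \<Longrightarrow> y \<in> mspace Z \<Longrightarrow> \<bar>f x - f y\<bar> \<le> L * mdist Z x y"
    using assms(1) unfolding lipschitz_fun_iff by blast
  obtain M where M: "M \<ge> 0" "\<And>x y. x \<in> mspace Z \<Longrightarrow> y \<in> mspace Z \<Longrightarrow> \<bar>g x - g y\<bar> \<le> M * mdist Z x y"
    using assms(2) unfolding lipschitz_fun_iff by blast
  have "\<bar>(a * f x + b * g x) - (a * f y + b * g y)\<bar> \<le> (\<bar>a\<bar> * L + \<bar>b\<bar> * M) * mdist Z x y"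
    if "x \<in> mspace Z" "y \<in> mspace Z" for x y
  proof -
    have "\<bar>(a * f x + b * g x) - (a * f y + b * g y)\<bar> = \<bar>a * (f x - f y) + b * (g x - g y)\<bar>"
      by (simp add: algebra_simps)
    also have "\<dots> \<le> \<bar>a\<bar> * \<bar>f x - f y\<bar> + \<bar>b\<bar> * \<bar>g x - g y\<bar>"
      by (metis abs_mult abs_triangle_ineq)
    also have "\<dots> \<le> \<bar>a\<bar> * (L * mdist Z x y) + \<bar>b\<bar> * (M * mdist Z x y)"
      using L(2) M(2) that by (intro add_mono mult_left_mono) auto
    finally show ?thesis by (simp add: algebra_simps)
  qed
  then show ?thesis
    unfolding lipschitz_fun_iff using L(1) M(1) by (intro exI[of _ "\<bar>a\<bar> * L + \<bar>b\<bar> * M"]) auto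
qed

lemma space_metric_borel [simp]: "space (metric_borel Z) = mspace Z"
  and sets_metric_borel: "sets (metric_borel Z) = sigma_sets (mspace Z) {U. openin (mtopology_of Z) U}"
  using openin_subset[of "mtopology_of Z"] unfolding metric_borel_def
  by (auto intro!: space_measure_of sets_measure_of)

lemma openin_in_metric_borel: "openin (mtopology_of Z) U \<Longrightarrow> U \<in> sets (metric_borel Z)"
  by (auto simp: sets_metric_borel)

lemma borel_measurable_metric_continuous:
  assumes "continuous_map (mtopology_of Z) euclideanreal f"
  shows "f \<in> borel_measurable (metric_borel Z)"
proof (rule borel_measurableI)
  fix S :: "real set" assume "open S"
  then have "openin (mtopology_of Z) {x \<in> topspace (mtopology_of Z). f x \<in> S}"
    using assms by (intro openin_continuous_map_preimage) auto
  moreover have "{x \<in> topspace (mtopology_of Z). f x \<in> S} = f -` S \<inter> space (metric_borel Z)"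
    by auto
  ultimately show "f -` S \<inter> space (metric_borel Z) \<in> sets (metric_borel Z)"
    using openin_in_metric_borel by metis
qed

lemma borel_measurable_lipschitz_fun:
  assumes "lipschitz_fun Z f"
  shows "f \<in> borel_measurable (metric_borel Z)"
  using Lipschitz_continuous_imp_continuous_map[OF assms] 
  by (intro borel_measurable_metric_continuous) simp

lemma test_form_1_iff:
  "test_form (Suc 0) Z f \<pi> \<longleftrightarrow> lipschitz_fun Z f \<and> bounded (f ` mspace Z) \<and> (\<exists>p. \<pi> = [p] \<and> lipschitz_fun Z p)"
  by (auto simp: test_form_def length_Suc_conv)

section \<open>The current carried by a Lipschitz curve\<close>

text \<open>The push-forward of the oriented interval \<open>{0..l}\<close> under the curve, written
  as an explicit integral.\<close>

definition curve_current :: "(real \<Rightarrow> 'a) \<Rightarrow> real \<Rightarrow> 'a functional" where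
  "curve_current \<gamma> l f \<pi> = (LBINT t:{0..l}. f (\<gamma> t) * deriv ((\<pi> ! 0) \<circ> \<gamma>) t)"

text \<open>The push-forward of length. For a 1-Lipschitz curve it dominates the mass of the
  current; equality requires unit speed and that passages through the same points do not
  cancel.\<close>

definition curve_measure :: "'a metric \<Rightarrow> (real \<Rightarrow> 'a) \<Rightarrow> real \<Rightarrow> 'a measure" where
  "curve_measure Z \<gamma> l = distr (restrict_space lborel {0..l}) (metric_borel Z) \<gamma>"

text \<open>The curve is defined and Lipschitz on the whole line although only \<open>{0..l}\<close>
  carries the current; compositions with it are then Lipschitz on the line, and no one-sided
  derivatives arise at the ends.\<close>

locale lipschitz_curve =
  fixes Z :: "'a metric" and \<gamma> :: "real \<Rightarrow> 'a" and l :: real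
  assumes curve_in [simp]: "\<gamma> t \<in> mspace Z"
    and curve_lip: "mdist Z (\<gamma> s) (\<gamma> t) \<le> \<bar>s - t\<bar>"
    and l_nonneg: "0 \<le> l"
begin

lemma comp_curve_lipschitz_le:
  assumes p: "lipschitz_fun Z p" and L: "lip_const Z p \<le> L"
  shows "L-lipschitz_on UNIV (p \<circ> \<gamma>)"
proof (rule lipschitz_onI)
  show "0 \<le> L" using lip_const_nonneg[OF p] L by simp
  fix s t
  have "\<bar>p (\<gamma> s) - p (\<gamma> t)\<bar> \<le> lip_const Z p * mdist Z (\<gamma> s) (\<gamma> t)"
    using p by (intro abs_diff_le_lip_const) auto
  also have "\<dots> \<le> L * \<bar>s - t\<bar>"
    using curve_lip L lip_const_nonneg[OF p] by (intro mult_mono) auto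
  finally show "dist ((p \<circ> \<gamma>) s) ((p \<circ> \<gamma>) t) \<le> L * dist s t"
    by (simp add: dist_real_def)
qed

lemmas comp_curve_lipschitz = comp_curve_lipschitz_le[OF _ order_refl]

lemma continuous_curve: "continuous_map euclidean (mtopology_of Z) \<gamma>"
proof -
  have "Lipschitz_continuous_map euclidean_metric Z \<gamma>"
    using curve_lip by (auto simp: Lipschitz_continuous_map_def dist_real_def intro!: exI[of _ 1])
  then show ?thesis
    using Lipschitz_continuous_imp_continuous_map by fastforce
qed

lemma open_curve_vimage: "openin (mtopology_of Z) U \<Longrightarrow> open (\<gamma> -` U)"
  using openin_continuous_map_preimage[OF continuous_curve] by (simp add: vimage_def)

lemma measurable_curve [measurable]: "\<gamma> \<in> borel \<rightarrow>\<^sub>M metric_borel Z"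
  unfolding metric_borel_def
proof (rule measurable_measure_of)
  fix U assume "U \<in> {U. openin (mtopology_of Z) U}"
  then show "\<gamma> -` U \<inter> space borel \<in> sets borel"
    using open_curve_vimage by simp
qed (use openin_subset in fastforce)+

lemma comp_curve_set_integrable:
  assumes f: "lipschitz_fun Z f" and p: "lipschitz_fun Z p"
  shows "set_integrable lborel {0..l} (\<lambda>t. f (\<gamma> t) * deriv (p \<circ> \<gamma>) t)"
proof -
  obtain B where B: "\<And>t. t \<in> {0..l} \<Longrightarrow> \<bar>(f \<circ> \<gamma>) t\<bar> \<le> B"
    using lipschitz_on_Icc_bounded[OF comp_curve_lipschitz[OF f]] by blast
  from set_integrable_lipschitz_deriv[OF borel_measurable_lipschitz[OF comp_curve_lipschitz[OF f]] B
      comp_curve_lipschitz[OF p]]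
  show ?thesis by simp
qed

lemma space_curve_measure [simp]: "space (curve_measure Z \<gamma> l) = mspace Z"
  and sets_curve_measure [simp]: "sets (curve_measure Z \<gamma> l) = sets (metric_borel Z)"
  by (simp_all add: curve_measure_def)

lemma measurable_curve_restrict:
  "\<gamma> \<in> restrict_space lborel {0..l} \<rightarrow>\<^sub>M metric_borel Z"
  by (intro measurable_restrict_space1) simp

lemma emeasure_curve_measure:
  assumes "B \<in> sets (metric_borel Z)"
  shows "emeasure (curve_measure Z \<gamma> l) B = emeasure lborel (\<gamma> -` B \<inter> {0..l})"
proof -
  have "emeasure (curve_measure Z \<gamma> l) B =
      emeasure (restrict_space lborel {0..l}) (\<gamma> -` B \<inter> space (restrict_space lborel {0..l}))"
    unfolding curve_measure_def using assms measurable_curve_restrict by (intro emeasure_distr) simp_all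
  also have "\<dots> = emeasure lborel (\<gamma> -` B \<inter> {0..l})"
    by (subst emeasure_restrict_space) (auto simp: space_restrict_space)
  finally show ?thesis .
qed

lemma finite_measure_curve_measure: "finite_measure (curve_measure Z \<gamma> l)"
proof (rule finite_measureI)
  have "mspace Z \<in> sets (metric_borel Z)"
    using sets.top[of "metric_borel Z"] by simp
  moreover have "\<gamma> -` mspace Z \<inter> {0..l} = {0..l}" by auto
  ultimately show "emeasure (curve_measure Z \<gamma> l) (space (curve_measure Z \<gamma> l)) \<noteq> \<infinity>"
    using l_nonneg by (simp add: emeasure_curve_measure)
qed

lemma integral_curve_measure:
  fixes f :: "'a \<Rightarrow> real"
  assumes "f \<in> borel_measurable (metric_borel Z)"
  shows "(\<integral>x. f x \<partial>curve_measure Z \<gamma> l) = (LBINT t:{0..l}. f (\<gamma> t))"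
  unfolding curve_measure_def using assms measurable_curve_restrict
  by (subst integral_distr) (simp_all add: integral_restrict_space set_lebesgue_integral_def)

lemma mass_bound_curve: "mass_bound 1 Z (curve_current \<gamma> l) (curve_measure Z \<gamma> l)"
  unfolding mass_bound_def
proof (intro conjI allI impI)
  fix f \<pi> assume "test_form 1 Z f \<pi>"
  then obtain p where f: "lipschitz_fun Z f" and \<pi>: "\<pi> = [p]" and p: "lipschitz_fun Z p"
    by (auto simp: test_form_1_iff)
  note fm[measurable] = borel_measurable_lipschitz[OF comp_curve_lipschitz[OF f]]
  let ?L = "lip_const Z p"
  obtain B where B: "\<And>t. t \<in> {0..l} \<Longrightarrow> \<bar>(f \<circ> \<gamma>) t\<bar> \<le> B"
    using lipschitz_on_Icc_bounded[OF comp_curve_lipschitz[OF f]] by blast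
  have [measurable]: "(\<lambda>t. f (\<gamma> t)) \<in> borel_measurable borel"
    using fm by (simp add: comp_def)
  have "\<bar>curve_current \<gamma> l f \<pi>\<bar> \<le> (LBINT t. \<bar>indicator {0..l} t *\<^sub>R (f (\<gamma> t) * deriv (p \<circ> \<gamma>) t)\<bar>)"
    unfolding curve_current_def \<pi> set_lebesgue_integral_def by simp
  also have "\<dots> \<le> (LBINT t:{0..l}. ?L * \<bar>f (\<gamma> t)\<bar>)"
    unfolding set_lebesgue_integral_def
  proof (intro integral_mono_AE integrable_abs)
    show "integrable lborel (\<lambda>t. indicat_real {0..l} t *\<^sub>R (f (\<gamma> t) * deriv (p \<circ> \<gamma>) t))"
      using comp_curve_set_integrable[OF f p] unfolding set_integrable_def .
    show "integrable lborel (\<lambda>t. indicat_real {0..l} t *\<^sub>R (?L * \<bar>f (\<gamma> t)\<bar>))"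
    proof (rule Bochner_Integration.integrable_bound)
      show "integrable lborel (\<lambda>t. indicator {0..l} t * (?L * B))"
        by (intro integrable_mult_left integrable_real_indicator) (auto simp: emeasure_lborel_Icc_eq)
      show "AE t in lborel. norm (indicat_real {0..l} t *\<^sub>R (?L * \<bar>f (\<gamma> t)\<bar>)) \<le> norm (indicator {0..l} t * (?L * B))"
        using B lip_const_nonneg[OF p]
        by (intro AE_I2) (fastforce simp: indicator_def abs_mult intro!: mult_left_mono)
    qed measurable
    show "AE t in lborel. \<bar>indicat_real {0..l} t *\<^sub>R (f (\<gamma> t) * deriv (p \<circ> \<gamma>) t)\<bar>
        \<le> indicat_real {0..l} t *\<^sub>R (?L * \<bar>f (\<gamma> t)\<bar>)"
      using lipschitz_real_has_derivative_AE[OF comp_curve_lipschitz[OF p]]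
    proof eventually_elim
      case (elim t)
      then have "\<bar>deriv (p \<circ> \<gamma>) t\<bar> \<le> ?L"
        by (rule lipschitz_real_deriv_le[OF comp_curve_lipschitz[OF p]])
      then have "\<bar>f (\<gamma> t)\<bar> * \<bar>deriv (p \<circ> \<gamma>) t\<bar> \<le> \<bar>f (\<gamma> t)\<bar> * ?L"
        by (rule mult_left_mono) simp
      then show ?case by (simp add: indicator_def abs_mult mult.commute)
    qed
  qed
  also have "\<dots> = ?L * (LBINT t:{0..l}. \<bar>f (\<gamma> t)\<bar>)"
    by simp
  also have "(LBINT t:{0..l}. \<bar>f (\<gamma> t)\<bar>) = (\<integral>x. \<bar>f x\<bar> \<partial>curve_measure Z \<gamma> l)"
    using borel_measurable_lipschitz_fun[OF f] by (subst integral_curve_measure) auto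
  finally show "\<bar>curve_current \<gamma> l f \<pi>\<bar> \<le> prod_list (map (lip_const Z) \<pi>) * (\<integral>x. \<bar>f x\<bar> \<partial>curve_measure Z \<gamma> l)"
    by (simp add: \<pi>)
qed (use finite_measure_curve_measure in auto)

text \<open>Pointwise convergence of the \<open>q j\<close> says nothing about their derivatives.
  Integration by parts moves the derivative to the fixed function \<open>f\<close>; the common
  Lipschitz bound, together with convergence at the initial point, then gives a dominating
  function.\<close>

lemma curve_current_continuous:
  assumes f: "lipschitz_fun Z f" and p: "lipschitz_fun Z p" and q: "\<And>j::nat. lipschitz_fun Z (q j)"
    and C: "\<And>j. lip_const Z (q j) \<le> C"
    and lim: "\<And>x. x \<in> mspace Z \<Longrightarrow> (\<lambda>j. q j x) \<longlonglongrightarrow> p x"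
  shows "(\<lambda>j. curve_current \<gamma> l f [q j]) \<longlonglongrightarrow> curve_current \<gamma> l f [p]"
proof -
  note qL = comp_curve_lipschitz_le[OF q C]
  have C0: "C \<ge> 0" using lipschitz_on_nonneg[OF qL] .
  have eq: "curve_current \<gamma> l f [r] =
      f (\<gamma> l) * r (\<gamma> l) - f (\<gamma> 0) * r (\<gamma> 0) - (LBINT t:{0..l}. r (\<gamma> t) * deriv (f \<circ> \<gamma>) t)"
    if "lipschitz_fun Z r" for r
    using set_integral_lipschitz_by_parts[OF comp_curve_lipschitz[OF f] comp_curve_lipschitz[OF that] l_nonneg]
    by (simp add: curve_current_def)
  have "(\<lambda>j. q j (\<gamma> 0)) \<longlonglongrightarrow> p (\<gamma> 0)" by (simp add: lim)
  then have "bounded (range (\<lambda>j. q j (\<gamma> 0)))"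
    using convergent_imp_bounded by blast
  then obtain B where B: "\<And>j. \<bar>q j (\<gamma> 0)\<bar> \<le> B"
    by (auto simp: bounded_iff)
  have bd: "\<bar>q j (\<gamma> t)\<bar> \<le> B + C * l" if "t \<in> {0..l}" for j t
  proof -
    have "\<bar>q j (\<gamma> t) - q j (\<gamma> 0)\<bar> \<le> C * \<bar>t\<bar>"
      using lipschitz_onD[OF qL[of j], of t 0] by (simp add: dist_real_def)
    also have "\<dots> \<le> C * l" using that C0 by (intro mult_left_mono) auto
    finally show ?thesis using B[of j] by linarith
  qed
  note [measurable] = borel_measurable_lipschitz[OF qL, unfolded comp_def]
    borel_measurable_lipschitz[OF comp_curve_lipschitz[OF p], unfolded comp_def]
    borel_measurable_deriv[OF lipschitz_on_continuous_on[OF comp_curve_lipschitz[OF f]]]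
  have "(\<lambda>j. LBINT t:{0..l}. q j (\<gamma> t) * deriv (f \<circ> \<gamma>) t) \<longlonglongrightarrow> (LBINT t:{0..l}. p (\<gamma> t) * deriv (f \<circ> \<gamma>) t)"
    unfolding set_lebesgue_integral_def
  proof (rule integral_dominated_convergence)
    show "integrable lborel (\<lambda>t. \<bar>indicator {0..l} t *\<^sub>R ((B + C * l) * deriv (f \<circ> \<gamma>) t)\<bar>)"
      using set_integrable_lipschitz_deriv[OF _ _ comp_curve_lipschitz[OF f], of "\<lambda>_. B + C * l" 0 l "\<bar>B + C * l\<bar>"]
      by (intro integrable_abs) (simp add: set_integrable_def)
    show "AE t in lborel. norm (indicat_real {0..l} t *\<^sub>R (q j (\<gamma> t) * deriv (f \<circ> \<gamma>) t))
        \<le> \<bar>indicator {0..l} t *\<^sub>R ((B + C * l) * deriv (f \<circ> \<gamma>) t)\<bar>" for j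
    proof (rule AE_I2)
      fix t
      have "\<bar>q j (\<gamma> t)\<bar> * \<bar>deriv (f \<circ> \<gamma>) t\<bar> \<le> \<bar>B + C * l\<bar> * \<bar>deriv (f \<circ> \<gamma>) t\<bar>" if "t \<in> {0..l}"
        using bd[OF that, of j] by (intro mult_right_mono) auto
      then show "norm (indicat_real {0..l} t *\<^sub>R (q j (\<gamma> t) * deriv (f \<circ> \<gamma>) t))
        \<le> \<bar>indicator {0..l} t *\<^sub>R ((B + C * l) * deriv (f \<circ> \<gamma>) t)\<bar>"
        by (simp add: indicator_def abs_mult)
    qed
    show "AE t in lborel. (\<lambda>j. indicat_real {0..l} t *\<^sub>R (q j (\<gamma> t) * deriv (f \<circ> \<gamma>) t))
        \<longlonglongrightarrow> indicat_real {0..l} t *\<^sub>R (p (\<gamma> t) * deriv (f \<circ> \<gamma>) t)"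
      by (intro AE_I2 tendsto_intros lim) simp
  qed measurable
  then show ?thesis
    unfolding eq[OF p] eq[OF q] by (intro tendsto_intros lim) auto
qed

lemma current_curve_current: "current 1 Z (curve_current \<gamma> l)"
  unfolding current_def
proof (intro conjI allI impI)
  fix f f' \<pi> \<pi>' assume "test_form 1 Z f \<pi>" "test_form 1 Z f' \<pi>'"
    and eq: "\<forall>x\<in>mspace Z. f x = f' x \<and> (\<forall>i<1. (\<pi> ! i) x = (\<pi>' ! i) x)"
  then have "(\<pi> ! 0) \<circ> \<gamma> = (\<pi>' ! 0) \<circ> \<gamma>" "\<And>t. f (\<gamma> t) = f' (\<gamma> t)"
    by auto
  then show "curve_current \<gamma> l f \<pi> = curve_current \<gamma> l f' \<pi>'"
    by (simp add: curve_current_def)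
next
  fix f g \<pi> a b assume "test_form 1 Z f \<pi>" "test_form 1 Z g \<pi>"
  then obtain p where f: "lipschitz_fun Z f" "lipschitz_fun Z g" and \<pi>: "\<pi> = [p]" and p: "lipschitz_fun Z p"
    by (auto simp: test_form_1_iff)
  show "curve_current \<gamma> l (\<lambda>x. a * f x + b * g x) \<pi> = a * curve_current \<gamma> l f \<pi> + b * curve_current \<gamma> l g \<pi>"
    using comp_curve_set_integrable[OF f(1) p] comp_curve_set_integrable[OF f(2) p]
    by (simp add: curve_current_def \<pi> distrib_right mult.assoc set_integral_add)
next
  fix f \<pi> and i :: nat and p q and a b :: real assume tf: "test_form 1 Z f \<pi>" and "i < 1"
    and p: "lipschitz_fun Z p" and q: "lipschitz_fun Z q"
  then obtain r where f: "lipschitz_fun Z f" and \<pi>: "\<pi> = [r]"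
    by (auto simp: test_form_1_iff)
  let ?r = "\<lambda>x. a * p x + b * q x"
  note pL = comp_curve_lipschitz[OF p] and qL = comp_curve_lipschitz[OF q]
    and rL = comp_curve_lipschitz[OF lipschitz_fun_lincomb[OF p q, of a b]]
  note [measurable] = borel_measurable_lipschitz[OF comp_curve_lipschitz[OF f], unfolded comp_def]
    borel_measurable_deriv[OF lipschitz_on_continuous_on[OF pL]]
    borel_measurable_deriv[OF lipschitz_on_continuous_on[OF qL]]
    borel_measurable_deriv[OF lipschitz_on_continuous_on[OF rL]]
  have "curve_current \<gamma> l f [?r] =
      (LBINT t:{0..l}. a * (f (\<gamma> t) * deriv (p \<circ> \<gamma>) t) + b * (f (\<gamma> t) * deriv (q \<circ> \<gamma>) t))"
    unfolding curve_current_def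
  proof (rule set_lebesgue_integral_cong_AE)
    show "AE t\<in>{0..l} in lborel. f (\<gamma> t) * deriv (([?r] ! 0) \<circ> \<gamma>) t =
        a * (f (\<gamma> t) * deriv (p \<circ> \<gamma>) t) + b * (f (\<gamma> t) * deriv (q \<circ> \<gamma>) t)"
      using lipschitz_real_has_derivative_AE[OF pL] lipschitz_real_has_derivative_AE[OF qL]
    proof eventually_elim
      case (elim t)
      have "((?r \<circ> \<gamma>) has_field_derivative a * deriv (p \<circ> \<gamma>) t + b * deriv (q \<circ> \<gamma>) t) (at t)"
        unfolding comp_def
        using DERIV_add[OF DERIV_cmult[OF elim(1), of a] DERIV_cmult[OF elim(2), of b]]
        by (simp add: comp_def)
      then show ?case
        by (simp add: DERIV_imp_deriv algebra_simps)
    qed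
  qed (simp_all, measurable)
  also have "\<dots> = a * curve_current \<gamma> l f [p] + b * curve_current \<gamma> l f [q]"
    using comp_curve_set_integrable[OF f p] comp_curve_set_integrable[OF f q]
    by (simp add: curve_current_def set_integral_add)
  finally show "curve_current \<gamma> l f (\<pi>[i := ?r]) =
      a * curve_current \<gamma> l f (\<pi>[i := p]) + b * curve_current \<gamma> l f (\<pi>[i := q])"
    using \<open>i < 1\<close> by (simp add: \<pi>)
next
  fix f \<pi> and \<rho> :: "nat \<Rightarrow> ('a \<Rightarrow> real) list" and C
  assume tf: "test_form 1 Z f \<pi>" and tr: "\<forall>j. test_form 1 Z f (\<rho> j)"
    and C: "\<forall>j. \<forall>i<1. lip_const Z (\<rho> j ! i) \<le> C"
    and lim: "\<forall>i<1. \<forall>x\<in>mspace Z. (\<lambda>j. (\<rho> j ! i) x) \<longlonglongrightarrow> (\<pi> ! i) x"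
  obtain p where f: "lipschitz_fun Z f" and \<pi>: "\<pi> = [p]" and p: "lipschitz_fun Z p"
    using tf by (auto simp: test_form_1_iff)
  have "\<forall>j. \<exists>q. \<rho> j = [q] \<and> lipschitz_fun Z q"
    using tr by (simp add: test_form_1_iff)
  then obtain q where q: "\<And>j. \<rho> j = [q j]" "\<And>j. lipschitz_fun Z (q j)"
    by metis
  show "(\<lambda>j. curve_current \<gamma> l f (\<rho> j)) \<longlonglongrightarrow> curve_current \<gamma> l f \<pi>"
    unfolding \<pi> q(1) using C lim
    by (intro curve_current_continuous[OF f p q(2)]) (auto simp: q(1) \<pi>)
next
  fix f \<pi> assume tf: "test_form 1 Z f \<pi>"
    and "\<exists>i<1. \<exists>U c. openin (mtopology_of Z) U \<and> {x \<in> mspace Z. f x \<noteq> 0} \<subseteq> U \<and> (\<forall>x\<in>U. (\<pi> ! i) x = c)"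
  then obtain U c where U: "openin (mtopology_of Z) U" "{x \<in> mspace Z. f x \<noteq> 0} \<subseteq> U"
      "\<And>x. x \<in> U \<Longrightarrow> (\<pi> ! 0) x = c"
    by auto
  \<comment> \<open>Where \<open>f (\<gamma> t)\<close> does not vanish, the curve stays in the open
    set \<open>U\<close> for times near \<open>t\<close>, so the composition is locally constant
    there.\<close>
  have "f (\<gamma> t) * deriv ((\<pi> ! 0) \<circ> \<gamma>) t = 0" for t
  proof (cases "f (\<gamma> t) = 0")
    case False
    then have t: "t \<in> \<gamma> -` U" using U(2) by auto
    have "(((\<pi> ! 0) \<circ> \<gamma>) has_field_derivative 0) (at t)"
    proof (rule has_field_derivative_transform_within_open[where S="\<gamma> -` U"])
      show "((\<lambda>_. c) has_field_derivative 0) (at t)" by simp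
    qed (use open_curve_vimage[OF U(1)] t U(3) in auto)
    then show ?thesis by (simp add: DERIV_imp_deriv)
  qed simp
  then have "(\<lambda>t. f (\<gamma> t) * deriv ((\<pi> ! 0) \<circ> \<gamma>) t) = (\<lambda>_. 0)"
    by blast
  then show "curve_current \<gamma> l f \<pi> = 0"
    unfolding curve_current_def by (simp only: set_lebesgue_integral_def scaleR_zero_right integral_zero)
next
  show "\<exists>\<mu>. mass_bound 1 Z (curve_current \<gamma> l) \<mu>"
    using mass_bound_curve by blast
qed

lemma curve_current_boundary:
  assumes "lipschitz_fun Z f"
  shows "current_boundary (curve_current \<gamma> l) f [] = f (\<gamma> l) - f (\<gamma> 0)"
  using set_integral_deriv_lipschitz[OF comp_curve_lipschitz[OF assms] l_nonneg]
  by (simp add: current_boundary_def curve_current_def)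

end

section \<open>The mass measure\<close>

text \<open>Truncated multiples of the distance to the complement of \<open>U\<close>. An empty
  complement is treated apart, since that distance would be an infimum over the empty set.\<close>

lemma lipschitz_bump_sequence:
  assumes U: "openin (mtopology_of Z) U"
  obtains u :: "nat \<Rightarrow> 'a \<Rightarrow> real" where
    "\<And>j. lipschitz_fun Z (u j)" "\<And>j x. 0 \<le> u j x" "\<And>j x. u j x \<le> 1"
    "\<And>j x. x \<in> mspace Z \<Longrightarrow> x \<notin> U \<Longrightarrow> u j x = 0" "\<And>x. x \<in> U \<Longrightarrow> (\<lambda>j. u j x) \<longlonglongrightarrow> 1"
proof (cases "U = mspace Z")
  case True
  show ?thesis
    by (rule that[of "\<lambda>_ _. 1"]) (use True in auto)
next
  case False
  define D where "D = mspace Z - U"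
  have D: "D \<noteq> {}" "D \<subseteq> mspace Z"
    using False openin_subset[OF U] by (auto simp: D_def)
  define g where "g x = (INF y\<in>D. mdist Z x y)" for x
  have bdd: "bdd_below (mdist Z x ` D)" for x
    by (intro bdd_belowI[of _ 0]) auto
  have g_nonneg: "0 \<le> g x" for x
    unfolding g_def using D by (intro cINF_greatest) auto
  have g_zero: "g x = 0" if "x \<in> D" for x
  proof -
    have "mdist Z x x = 0" using that D by auto
    then show ?thesis
      using cINF_lower[OF bdd[of x] that] g_nonneg[of x] by (simp add: g_def)
  qed
  have g_lip: "g x \<le> g z + mdist Z x z" if "x \<in> mspace Z" "z \<in> mspace Z" for x z
  proof -
    have "g x - mdist Z x z \<le> mdist Z z y" if "y \<in> D" for y
      using cINF_lower[OF bdd[of x] that] mdist_triangle[of x Z z y] \<open>x \<in> mspace Z\<close> \<open>z \<in> mspace Z\<close> that D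
      by (fastforce simp: g_def)
    then have "g x - mdist Z x z \<le> g z"
      using D unfolding g_def[of z] by (intro cINF_greatest) auto
    then show ?thesis by simp
  qed
  have g_pos: "0 < g x" if "x \<in> U" for x
  proof -
    obtain r where r: "r > 0" "mball_of Z x r \<subseteq> U"
    proof -
      have "\<forall>x. x \<in> U \<longrightarrow> (\<exists>r>0. mball_of Z x r \<subseteq> U)"
        using U by (simp add: mtopology_of_def mball_of_def Metric_space.openin_mtopology[OF Metric_space_mspace_mdist])
      with \<open>x \<in> U\<close> that show ?thesis by blast
    qed
    have "r \<le> mdist Z x y" if "y \<in> D" for y
    proof (rule ccontr)
      assume "\<not> r \<le> mdist Z x y"
      then have "y \<in> mball_of Z x r"
        using that D \<open>x \<in> U\<close> openin_subset[OF U] by auto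
      then show False using r(2) that by (auto simp: D_def)
    qed
    then have "r \<le> g x"
      unfolding g_def using D by (intro cINF_greatest) auto
    with r(1) show ?thesis by simp
  qed
  show ?thesis
  proof (rule that[of "\<lambda>j x. min 1 (real j * g x)"])
    fix j
    show "lipschitz_fun Z (\<lambda>x. min 1 (real j * g x))"
      unfolding lipschitz_fun_iff
    proof (intro exI[of _ "real j"] conjI ballI)
      fix x z assume xz: "x \<in> mspace Z" "z \<in> mspace Z"
      have "\<bar>g x - g z\<bar> \<le> mdist Z x z"
        using g_lip[of x z] g_lip[of z x] xz mdist_commute[of Z x z] by auto
      then have "real j * \<bar>g x - g z\<bar> \<le> real j * mdist Z x z"
        by (intro mult_left_mono) auto
      then have "\<bar>real j * g x - real j * g z\<bar> \<le> real j * mdist Z x z"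
        by (simp add: abs_mult flip: right_diff_distrib)
      then show "\<bar>min 1 (real j * g x) - min 1 (real j * g z)\<bar> \<le> real j * mdist Z x z"
        by linarith
    qed simp
  next
    fix x assume "x \<in> U"
    obtain N where N: "1 / g x < real N"
      using reals_Archimedean2 by blast
    have "min 1 (real j * g x) = 1" if "j \<ge> N" for j
    proof -
      have "1 / g x < real j" using N that by simp
      then show ?thesis using g_pos[OF \<open>x \<in> U\<close>] by (simp add: divide_less_eq)
    qed
    then show "(\<lambda>j. min 1 (real j * g x)) \<longlonglongrightarrow> 1"
      by (intro tendsto_eventually) (auto simp: eventually_sequentially)
  qed (use g_nonneg g_zero in \<open>auto simp: D_def\<close>)
qed

text \<open>Sublevel sets of the bump functions of \<open>U\<close> shrink to its complement. This
  starts the induction for outer regularity.\<close>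

lemma closed_eq_decseq_openin:
  assumes U: "openin (mtopology_of Z) U"
  obtains V where "\<And>n::nat. openin (mtopology_of Z) (V n)" "decseq V" "(\<Inter>n. V n) = mspace Z - U"
proof -
  obtain u :: "nat \<Rightarrow> 'a \<Rightarrow> real" where u: "\<And>j. lipschitz_fun Z (u j)" "\<And>j x. 0 \<le> u j x" "\<And>j x. u j x \<le> 1"
    "\<And>j x. x \<in> mspace Z \<Longrightarrow> x \<notin> U \<Longrightarrow> u j x = 0" "\<And>x. x \<in> U \<Longrightarrow> (\<lambda>j. u j x) \<longlonglongrightarrow> 1"
    using lipschitz_bump_sequence[OF U] by blast
  have op: "openin (mtopology_of Z) {x \<in> mspace Z. u j x < 1 / 2}" for j
    using openin_continuous_map_preimage[OF Lipschitz_continuous_imp_continuous_map[OF u(1)], of "{..<1/2}" j]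
    by simp
  show ?thesis
  proof (rule that[of "\<lambda>n. \<Inter>j\<le>n. {x \<in> mspace Z. u j x < 1 / 2}"])
    show "openin (mtopology_of Z) (\<Inter>j\<le>n. {x \<in> mspace Z. u j x < 1 / 2})" for n
      using op by (intro openin_INT2) auto
    show "decseq (\<lambda>n. \<Inter>j\<le>n. {x \<in> mspace Z. u j x < 1 / 2})"
      unfolding decseq_def by (intro allI impI INF_superset_mono) auto
    show "(\<Inter>n. \<Inter>j\<le>n. {x \<in> mspace Z. u j x < 1 / 2}) = mspace Z - U"
    proof (intro equalityI subsetI)
      fix x assume x: "x \<in> (\<Inter>n. \<Inter>j\<le>n. {x \<in> mspace Z. u j x < 1 / 2})"
      then have x': "x \<in> mspace Z" "u j x < 1 / 2" for j by auto
      have "x \<notin> U"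
      proof
        assume "x \<in> U"
        then have "1 \<le> (1::real) / 2"
          using LIMSEQ_le_const2[OF u(5)] x'(2) by (meson less_imp_le)
        then show False by simp
      qed
      with x'(1) show "x \<in> mspace Z - U" by simp
    qed (use u(4) in auto)
  qed
qed

text \<open>Outer approximation alone is not stable under complements, so the induction runs over
  the two-sided property \<open>P\<close>: sets enclosed between a closed and an open set of small
  difference. For a countable union, finitely many of the closed sets already exhaust the measure up
  to \<open>e / 2\<close>, which keeps their union closed.\<close>

lemma metric_outer_regular:
  assumes fin: "finite_measure \<nu>" and sets: "sets \<nu> = sets (metric_borel Z)"
    and B: "B \<in> sets (metric_borel Z)" and e: "0 < e"
  shows "\<exists>U. openin (mtopology_of Z) U \<and> B \<subseteq> U \<and> measure \<nu> U < measure \<nu> B + e"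
proof -
  interpret finite_measure \<nu> by fact
  let ?op = "openin (mtopology_of Z)"
  have sp: "space \<nu> = mspace Z" using sets_eq_imp_space_eq[OF sets] by simp
  have meas: "U \<in> sets \<nu>" if "?op U" for U
    using openin_in_metric_borel[OF that] by (simp add: sets)
  define P where "P B \<longleftrightarrow> B \<in> sets \<nu> \<and> (\<forall>e>0. \<exists>F U. ?op (mspace Z - F) \<and> F \<subseteq> mspace Z \<and> ?op U \<and>
      F \<subseteq> B \<and> B \<subseteq> U \<and> measure \<nu> (U - F) < e)" for B
  have "B \<in> sigma_sets (mspace Z) {U. ?op U}"
    using B by (simp add: sets_metric_borel)
  then have "P B"
  proof induction
    case (Basic U)
    then have U: "?op U" by simp
    obtain V where V: "\<And>n::nat. ?op (V n)" "decseq V" "(\<Inter>n. V n) = mspace Z - U"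
      using closed_eq_decseq_openin[OF U] by blast
    show ?case
      unfolding P_def
    proof (intro conjI allI impI)
      fix e :: real assume "e > 0"
      have "(\<lambda>n. measure \<nu> (V n)) \<longlonglongrightarrow> measure \<nu> (\<Inter>n. V n)"
        using V meas by (intro finite_Lim_measure_decseq) auto
      then have "\<forall>\<^sub>F n in sequentially. measure \<nu> (V n) < measure \<nu> (\<Inter>n. V n) + e"
        using \<open>e > 0\<close> by (intro order_tendstoD) auto
      then obtain n where n: "measure \<nu> (V n) < measure \<nu> (mspace Z - U) + e"
        unfolding V(3) by (meson eventually_happens sequentially_bot)
      have VZ: "V n \<subseteq> mspace Z" "U \<subseteq> mspace Z" "mspace Z - U \<subseteq> V n"
        using openin_subset[OF V(1)] openin_subset[OF U] V(3) by (simp, simp, blast)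
      have eq: "U - (mspace Z - V n) = V n - (mspace Z - U)" using VZ by auto
      have "measure \<nu> (U - (mspace Z - V n)) = measure \<nu> (V n) - measure \<nu> (mspace Z - U)"
        unfolding eq using VZ meas[OF V(1)] meas[OF U] sets.compl_sets[OF meas[OF U]]
        by (intro finite_measure_Diff) (auto simp: sp)
      with n VZ U V(1) show "\<exists>F W. ?op (mspace Z - F) \<and> F \<subseteq> mspace Z \<and> ?op W \<and> F \<subseteq> U \<and> U \<subseteq> W \<and> measure \<nu> (W - F) < e"
        by (intro exI[of _ "mspace Z - V n"] exI[of _ U]) (auto simp: double_diff)
    qed (use meas U in auto)
  next
    case Empty
    show ?case
      unfolding P_def using openin_topspace[of "mtopology_of Z"] by (auto intro!: exI[of _ "{}"])
  next
    case (Compl B)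
    show ?case
      unfolding P_def
    proof (intro conjI allI impI)
      show "mspace Z - B \<in> sets \<nu>"
        using Compl.IH sets.compl_sets[of B \<nu>] by (auto simp: P_def sp)
      fix e :: real assume "e > 0"
      then obtain F U where FU: "?op (mspace Z - F)" "F \<subseteq> mspace Z" "?op U" "F \<subseteq> B" "B \<subseteq> U" "measure \<nu> (U - F) < e"
        using Compl.IH unfolding P_def by meson
      have "(mspace Z - F) - (mspace Z - U) = U - F"
        using openin_subset[OF FU(3)] by auto
      with FU openin_subset[OF FU(3)]
      show "\<exists>F U. ?op (mspace Z - F) \<and> F \<subseteq> mspace Z \<and> ?op U \<and> F \<subseteq> mspace Z - B \<and> mspace Z - B \<subseteq> U \<and> measure \<nu> (U - F) < e"
        by (intro exI[of _ "mspace Z - U"] exI[of _ "mspace Z - F"]) (auto simp: double_diff)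
    qed
  next
    case (Union A)
    have Am: "A n \<in> sets \<nu>" for n using Union.IH by (auto simp: P_def)
    show ?case
      unfolding P_def
    proof (intro conjI allI impI)
      show UA: "(\<Union>n. A n) \<in> sets \<nu>" using Am by auto
      fix e :: real assume "e > 0"
      have "\<forall>n. \<exists>F U. ?op (mspace Z - F) \<and> F \<subseteq> mspace Z \<and> ?op U \<and> F \<subseteq> A n \<and> A n \<subseteq> U \<and>
          measure \<nu> (U - F) < e / 2 * (1/2)^Suc n"
      proof
        fix n
        have "e / 2 * (1/2)^Suc n > 0" using \<open>e > 0\<close> by simp
        with Union.IH[of n] show "\<exists>F U. ?op (mspace Z - F) \<and> F \<subseteq> mspace Z \<and> ?op U \<and> F \<subseteq> A n \<and> A n \<subseteq> U \<and>
            measure \<nu> (U - F) < e / 2 * (1/2)^Suc n"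
          unfolding P_def by blast
      qed
      then obtain F U where F: "\<And>n. ?op (mspace Z - F n)" "\<And>n. F n \<subseteq> mspace Z" "\<And>n. ?op (U n)"
        "\<And>n. F n \<subseteq> A n" "\<And>n. A n \<subseteq> U n" "\<And>n. measure \<nu> (U n - F n) < e / 2 * (1/2)^Suc n"
        by metis
      have Fm: "F n \<in> sets \<nu>" for n
        using sets.compl_sets[OF meas[OF F(1)[of n]]] F(2)[of n] by (simp add: sp double_diff)
      define G where "G n = (\<Union>k\<le>n. F k)" for n
      have Gm: "G n \<in> sets \<nu>" for n
        unfolding G_def using Fm by auto
      have "(\<lambda>n. measure \<nu> (G n)) \<longlonglongrightarrow> measure \<nu> (\<Union>n. G n)"
      proof (rule finite_Lim_measure_incseq)
        show "incseq G"
          unfolding incseq_def G_def by (intro allI impI UN_mono) auto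
      qed (use Gm in auto)
      moreover have "(\<Union>n. G n) = (\<Union>n. F n)" by (auto simp: G_def)
      ultimately have "\<forall>\<^sub>F n in sequentially. measure \<nu> (\<Union>n. F n) - e / 2 < measure \<nu> (G n)"
        using \<open>e > 0\<close> by (intro order_tendstoD) auto
      then obtain n where n: "measure \<nu> (\<Union>n. F n) - e / 2 < measure \<nu> (G n)"
        by (meson eventually_happens sequentially_bot)
      have sums: "(\<lambda>n. e / 2 * (1/2)^Suc n) sums (e / 2)"
        using sums_mult[OF power_half_series, of "e / 2"] by simp
      have smm: "summable (\<lambda>n. measure \<nu> (U n - F n))"
        using sums_summable[OF sums] F(6)
        by (intro summable_comparison_test'[OF sums_summable[OF sums]]) (auto intro: less_imp_le)
      have "measure \<nu> (\<Union>n. U n - F n) \<le> (\<Sum>n. measure \<nu> (U n - F n))"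
        using meas[OF F(3)] Fm smm by (intro finite_measure_subadditive_countably) auto
      also have "\<dots> \<le> (\<Sum>n. e / 2 * (1/2)^Suc n)"
        using F(6) by (intro suminf_le smm sums_summable[OF sums]) (rule less_imp_le)
      also have "\<dots> = e / 2"
        using sums_unique[OF sums] by (rule sym)
      finally have 1: "measure \<nu> (\<Union>n. U n - F n) \<le> e / 2" .
      have "measure \<nu> ((\<Union>n. F n) - G n) = measure \<nu> (\<Union>n. F n) - measure \<nu> (G n)"
        using Fm Gm by (intro finite_measure_Diff) (auto simp: G_def)
      with n have 2: "measure \<nu> ((\<Union>n. F n) - G n) < e / 2" by simp
      have "measure \<nu> ((\<Union>n. U n) - G n) \<le> measure \<nu> ((\<Union>n. U n - F n) \<union> ((\<Union>n. F n) - G n))"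
        using meas[OF F(3)] Fm Gm by (intro finite_measure_mono) auto
      also have "\<dots> \<le> measure \<nu> (\<Union>n. U n - F n) + measure \<nu> ((\<Union>n. F n) - G n)"
        using meas[OF F(3)] Fm Gm by (intro measure_Un_le) auto
      finally have 3: "measure \<nu> ((\<Union>n. U n) - G n) < e" using 1 2 by simp
      have "?op (mspace Z - G n)"
      proof -
        have "mspace Z - G n = (\<Inter>k\<le>n. mspace Z - F k)" by (auto simp: G_def)
        also have "?op \<dots>" using F(1) by (intro openin_INT2) auto
        finally show ?thesis .
      qed
      moreover have "G n \<subseteq> mspace Z" "G n \<subseteq> (\<Union>n. A n)"
        using F(2,4) by (fastforce simp: G_def)+
      moreover have "?op (\<Union>n. U n)" "(\<Union>n. A n) \<subseteq> (\<Union>n. U n)"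
        using F(3,5) by (auto intro!: openin_Union)
      ultimately show "\<exists>F U. ?op (mspace Z - F) \<and> F \<subseteq> mspace Z \<and> ?op U \<and> F \<subseteq> (\<Union>n. A n) \<and> (\<Union>n. A n) \<subseteq> U \<and> measure \<nu> (U - F) < e"
        using 3 by blast
    qed
  qed
  then obtain F U where FU: "?op (mspace Z - F)" "F \<subseteq> mspace Z" "?op U" "F \<subseteq> B" "B \<subseteq> U" "measure \<nu> (U - F) < e"
    using e unfolding P_def by meson
  have Fm: "F \<in> sets \<nu>"
    using sets.compl_sets[OF meas[OF FU(1)]] FU(2) by (simp add: sp double_diff)
  have "measure \<nu> (U - F) = measure \<nu> U - measure \<nu> F"
    using FU meas[OF FU(3)] Fm by (intro finite_measure_Diff) auto
  moreover have "measure \<nu> F \<le> measure \<nu> B"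
    using FU B by (intro finite_measure_mono) (auto simp: sets)
  ultimately show ?thesis using FU by (intro exI[of _ U]) auto
qed

text \<open>Every competitor is outer regular, so a comparison on open sets extends to all Borel
  sets. Two least measures bound each other, which gives the uniqueness that \<open>THE\<close>
  demands.\<close>

lemma mass_measure_eqI:
  assumes \<mu>: "mass_bound k Z T \<mu>"
    and le: "\<And>\<nu> U. mass_bound k Z T \<nu> \<Longrightarrow> openin (mtopology_of Z) U \<Longrightarrow> emeasure \<mu> U \<le> emeasure \<nu> U"
  shows "mass_measure k Z T = \<mu>"
proof -
  have min: "emeasure \<mu> B \<le> emeasure \<nu> B" if \<nu>: "mass_bound k Z T \<nu>" and B: "B \<in> sets \<mu>" for \<nu> B
  proof -
    have sets: "sets \<nu> = sets (metric_borel Z)" "sets \<mu> = sets (metric_borel Z)"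
      and "finite_measure \<nu>" "finite_measure \<mu>"
      using \<nu> \<mu> by (auto simp: mass_bound_def)
    interpret N: finite_measure \<nu> by fact
    interpret M: finite_measure \<mu> by fact
    have "measure \<mu> B \<le> measure \<nu> B"
    proof (rule field_le_epsilon)
      fix e :: real assume "e > 0"
      then obtain U where U: "openin (mtopology_of Z) U" "B \<subseteq> U" "measure \<nu> U < measure \<nu> B + e"
        using metric_outer_regular[OF \<open>finite_measure \<nu>\<close> sets(1) _ \<open>e > 0\<close>, of B] B sets by auto
      have "measure \<mu> B \<le> measure \<mu> U"
        using U B openin_in_metric_borel[OF U(1)] by (intro M.finite_measure_mono) (auto simp: sets)
      also have "\<dots> \<le> measure \<nu> U"
        using le[OF \<nu> U(1)] by (simp add: M.emeasure_eq_measure N.emeasure_eq_measure)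
      finally show "measure \<mu> B \<le> measure \<nu> B + e" using U(3) by simp
    qed
    then show ?thesis
      by (simp add: M.emeasure_eq_measure N.emeasure_eq_measure)
  qed
  show ?thesis
    unfolding mass_measure_def
  proof (rule the_equality)
    show "mass_bound k Z T \<mu> \<and> (\<forall>\<nu>. mass_bound k Z T \<nu> \<longrightarrow> (\<forall>B\<in>sets \<mu>. emeasure \<mu> B \<le> emeasure \<nu> B))"
      using \<mu> min by blast
    fix \<nu> assume \<nu>: "mass_bound k Z T \<nu> \<and> (\<forall>\<nu>'. mass_bound k Z T \<nu>' \<longrightarrow> (\<forall>B\<in>sets \<nu>. emeasure \<nu> B \<le> emeasure \<nu>' B))"
    show "\<nu> = \<mu>"
    proof (rule measure_eqI)
      show sets: "sets \<nu> = sets \<mu>" using \<mu> \<nu> by (simp add: mass_bound_def)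
      show "emeasure \<nu> B = emeasure \<mu> B" if "B \<in> sets \<nu>" for B
        using \<mu> \<nu> min that sets by (intro antisym) auto
    qed
  qed
qed

context lipschitz_curve
begin

text \<open>Testing with \<open>(u, p)\<close>, where \<open>u\<close> approximates the indicator function of \<open>V\<close>: there
  \<open>p\<close> is a coordinate along the curve, so no mass is lost.\<close>

lemma curve_measure_le_mass_bound:
  assumes V: "openin (mtopology_of Z) V" and \<nu>: "mass_bound 1 Z (curve_current \<gamma> l) \<nu>"
    and p: "lipschitz_fun Z p" "lip_const Z p \<le> 1" and \<sigma>: "\<bar>\<sigma>\<bar> = 1"
    and D: "AE t in lborel. t \<in> {0..l} \<longrightarrow> \<gamma> t \<in> V \<longrightarrow> deriv (p \<circ> \<gamma>) t = \<sigma>"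
  shows "emeasure (curve_measure Z \<gamma> l) V \<le> emeasure \<nu> V"
proof -
  let ?\<mu> = "curve_measure Z \<gamma> l"
  have sets: "sets \<nu> = sets (metric_borel Z)" and "finite_measure \<nu>" and sp: "space \<nu> = mspace Z"
    using \<nu> by (auto simp: mass_bound_def)
  interpret N: finite_measure \<nu> by fact
  interpret M: finite_measure ?\<mu> by (rule finite_measure_curve_measure)
  have Vm: "V \<in> sets (metric_borel Z)" using V by (rule openin_in_metric_borel)
  obtain u :: "nat \<Rightarrow> 'a \<Rightarrow> real" where u: "\<And>j. lipschitz_fun Z (u j)" "\<And>j x. 0 \<le> u j x" "\<And>j x. u j x \<le> 1"
    "\<And>j x. x \<in> mspace Z \<Longrightarrow> x \<notin> V \<Longrightarrow> u j x = 0" "\<And>x. x \<in> V \<Longrightarrow> (\<lambda>j. u j x) \<longlonglongrightarrow> 1"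
    using lipschitz_bump_sequence[OF V] by blast
  have um[measurable]: "u j \<in> borel_measurable (metric_borel Z)" for j
    using u(1) by (rule borel_measurable_lipschitz_fun)
  note [measurable] = borel_measurable_deriv[OF lipschitz_on_continuous_on[OF comp_curve_lipschitz[OF p(1)]]]
  have tf: "test_form 1 Z (u j) [p]" for j
    using u(1-3) p(1) by (auto simp: test_form_1_iff bounded_iff intro!: exI[of _ 1])
  have int_le: "(\<integral>x. u j x \<partial>?\<mu>) \<le> measure \<nu> V" for j
  proof -
    \<comment> \<open>While the curve is in \<open>V\<close> the derivative is almost everywhere the
      constant \<open>\<sigma>\<close>; outside of \<open>V\<close> the bump function
      vanishes.\<close>
    have "curve_current \<gamma> l (u j) [p] = (LBINT t:{0..l}. \<sigma> * u j (\<gamma> t))"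
      unfolding curve_current_def
    proof (rule set_lebesgue_integral_cong_AE)
      show "AE t\<in>{0..l} in lborel. u j (\<gamma> t) * deriv (([p] ! 0) \<circ> \<gamma>) t = \<sigma> * u j (\<gamma> t)"
        using D by eventually_elim (use u(4) in auto)
    qed (simp_all, measurable)
    also have "\<dots> = \<sigma> * (\<integral>x. u j x \<partial>?\<mu>)"
      by (simp add: integral_curve_measure)
    finally have "\<bar>\<integral>x. u j x \<partial>?\<mu>\<bar> = \<bar>curve_current \<gamma> l (u j) [p]\<bar>"
      using \<sigma> by (simp add: abs_mult)
    also have "\<dots> \<le> lip_const Z p * (\<integral>x. \<bar>u j x\<bar> \<partial>\<nu>)"
      using \<nu> tf[of j] unfolding mass_bound_def by fastforce
    also have "\<dots> \<le> 1 * (\<integral>x. \<bar>u j x\<bar> \<partial>\<nu>)"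
      using p(2) by (intro mult_right_mono) auto
    also have "\<dots> \<le> (\<integral>x. indicator V x \<partial>\<nu>)"
      unfolding mult_1
    proof (rule integral_mono)
      show "integrable \<nu> (indicat_real V)"
        using Vm sets by (intro integrable_real_indicator) (auto simp: N.emeasure_eq_measure)
      show "integrable \<nu> (\<lambda>x. \<bar>u j x\<bar>)"
        using um[of j] u(2,3) by (intro N.integrable_const_bound[of _ 1]) (auto simp: measurable_cong_sets[OF sets refl])
      show "\<bar>u j x\<bar> \<le> indicat_real V x" if "x \<in> space \<nu>" for x
        using u(2-4) that by (auto simp: indicator_def sp)
    qed
    also have "\<dots> = measure \<nu> V" using Vm sets by simp
    finally show ?thesis by simp
  qed
  have "(\<lambda>j. \<integral>x. u j x \<partial>?\<mu>) \<longlonglongrightarrow> (\<integral>x. indicator V x \<partial>?\<mu>)"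
  proof (rule integral_dominated_convergence[where w="\<lambda>_. 1"])
    show "AE x in ?\<mu>. (\<lambda>j. u j x) \<longlonglongrightarrow> indicator V x"
      by (intro AE_I2) (use u(4,5) in \<open>auto simp: indicator_def\<close>)
    show "AE x in ?\<mu>. norm (u j x) \<le> 1" for j
      using u(2,3) by (intro AE_I2) auto
  qed (use Vm in \<open>auto simp: measurable_cong_sets[OF sets_curve_measure refl]\<close>)
  also have "(\<integral>x. indicator V x \<partial>?\<mu>) = measure ?\<mu> V"
    using Vm openin_subset[OF V] by (simp add: Int_absorb2)
  finally have "measure ?\<mu> V \<le> measure \<nu> V"
    by (rule LIMSEQ_le_const2) (use int_le in auto)
  then show ?thesis by (simp add: M.emeasure_eq_measure N.emeasure_eq_measure)
qed

end

section \<open>Euclidean 1-space\<close>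

text \<open>Points of Euclidean 1-space are extensional functions on a one-element index set; this
  identifies them with real numbers, with evaluation at \<open>0\<close> as the inverse.\<close>

definition euclid_pt :: "real \<Rightarrow> nat \<Rightarrow> real" where
  "euclid_pt x = (\<lambda>i\<in>{..<1}. x)"

lemma lessThan_1: "{..<1::nat} = {0}"
  by auto

lemma euclid_pt_0 [simp]: "euclid_pt x 0 = x"
  by (simp add: euclid_pt_def)

lemma euclid_pt_in [simp]: "euclid_pt x \<in> {..<Suc 0} \<rightarrow>\<^sub>E UNIV"
  by (auto simp: euclid_pt_def)

lemma euclid_pt_collapse: "x \<in> {..<Suc 0} \<rightarrow>\<^sub>E UNIV \<Longrightarrow> euclid_pt (x 0) = x"
  by (auto simp: euclid_pt_def PiE_def extensional_def fun_eq_iff)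

lemma mdist_euclid_1: "mdist (euclid (Suc 0)) x y = \<bar>x 0 - y 0\<bar>"
  by (simp add: lessThan_1[simplified])

lemma fun_upd_euclid_1: "x \<in> {..<Suc 0} \<rightarrow>\<^sub>E UNIV \<Longrightarrow> x(0 := t) = euclid_pt t"
  by (auto simp: euclid_pt_def PiE_def extensional_def fun_eq_iff)

lemma space_leb_1: "space (leb (Suc 0)) = {..<Suc 0} \<rightarrow>\<^sub>E UNIV"
  by (simp add: leb_def space_PiM)

lemma leb_1_distr: "distr (leb (Suc 0)) lborel (\<lambda>x. x 0) = lborel"
proof -
  interpret product_sigma_finite "\<lambda>_::nat. lborel :: real measure" by standard
  show ?thesis
    using distr_singleton[of 0] by (simp add: leb_def lessThan_1[simplified])
qed

lemma measurable_leb_1_component: "(\<lambda>x. x 0) \<in> leb (Suc 0) \<rightarrow>\<^sub>M lborel"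
  unfolding leb_def by (intro measurable_component_singleton) auto

lemma integral_leb_1:
  fixes f :: "real \<Rightarrow> real"
  assumes "f \<in> borel_measurable borel"
  shows "(\<integral>x. f (x 0) \<partial>leb (Suc 0)) = (\<integral>x. f x \<partial>lborel)"
  using integral_distr[OF measurable_leb_1_component, of f] assms by (simp add: leb_1_distr)

lemma integrable_leb_1:
  fixes f :: "real \<Rightarrow> real"
  assumes "f \<in> borel_measurable borel"
  shows "integrable (leb (Suc 0)) (\<lambda>x. f (x 0)) \<longleftrightarrow> integrable lborel f"
  using integrable_distr_eq[OF measurable_leb_1_component, of f] assms by (simp add: leb_1_distr)

lemma measurable_euclid_pt: "euclid_pt \<in> borel \<rightarrow>\<^sub>M leb (Suc 0)"
  unfolding leb_def euclid_pt_def One_nat_def by (intro measurable_restrict) auto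

lemma jacobian_det_1:
  assumes "x \<in> {..<Suc 0} \<rightarrow>\<^sub>E UNIV"
  shows "jacobian_det (Suc 0) [p] x = deriv (\<lambda>t. p (euclid_pt t)) (x 0)"
proof -
  have "{q. q permutes {..<Suc 0}} = {id}"
    by (simp add: lessThan_Suc permutes_sing)
  then show ?thesis
    using assms by (simp add: jacobian_det_def partial_deriv_def fun_upd_euclid_1 lessThan_Suc)
qed

lemma lipschitz_euclid_1:
  assumes "lipschitz_fun (euclid (Suc 0)) p"
  shows "\<exists>L. L-lipschitz_on UNIV (\<lambda>t. p (euclid_pt t))"
proof -
  obtain L where L: "L \<ge> 0" "\<And>x y. x \<in> mspace (euclid (Suc 0)) \<Longrightarrow> y \<in> mspace (euclid (Suc 0)) \<Longrightarrow>
      \<bar>p x - p y\<bar> \<le> L * mdist (euclid (Suc 0)) x y"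
    using assms unfolding lipschitz_fun_iff by blast
  have "L-lipschitz_on UNIV (\<lambda>t. p (euclid_pt t))"
    using L(2)[of "euclid_pt _" "euclid_pt _"] L(1)
    by (intro lipschitz_onI) (simp_all add: mdist_euclid_1 dist_real_def del: mdist_euclid)
  then show ?thesis by blast
qed

section \<open>Integral currents carried by closed curves\<close>

lemma lipschitz_fun_mult:
  assumes f: "lipschitz_fun Z f" "bounded (f ` mspace Z)" and g: "lipschitz_fun Z g" "bounded (g ` mspace Z)"
  shows "lipschitz_fun Z (\<lambda>x. f x * g x)"
proof -
  obtain L where L: "L \<ge> 0" "\<And>x y. x \<in> mspace Z \<Longrightarrow> y \<in> mspace Z \<Longrightarrow> \<bar>f x - f y\<bar> \<le> L * mdist Z x y"
    using f(1) unfolding lipschitz_fun_iff by blast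
  obtain M where M: "M \<ge> 0" "\<And>x y. x \<in> mspace Z \<Longrightarrow> y \<in> mspace Z \<Longrightarrow> \<bar>g x - g y\<bar> \<le> M * mdist Z x y"
    using g(1) unfolding lipschitz_fun_iff by blast
  obtain A where A: "\<And>x. x \<in> mspace Z \<Longrightarrow> \<bar>f x\<bar> \<le> A" using f(2) by (auto simp: bounded_iff)
  obtain B where B: "\<And>x. x \<in> mspace Z \<Longrightarrow> \<bar>g x\<bar> \<le> B" using g(2) by (auto simp: bounded_iff)
  have "\<bar>f x * g x - f y * g y\<bar> \<le> (\<bar>A\<bar> * M + \<bar>B\<bar> * L) * mdist Z x y"
    if "x \<in> mspace Z" "y \<in> mspace Z" for x y
  proof -
    have "\<bar>f x * g x - f y * g y\<bar> = \<bar>f x * (g x - g y) + g y * (f x - f y)\<bar>"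
      by (simp add: algebra_simps)
    also have "\<dots> \<le> \<bar>f x\<bar> * \<bar>g x - g y\<bar> + \<bar>g y\<bar> * \<bar>f x - f y\<bar>"
      by (metis abs_mult abs_triangle_ineq)
    also have "\<dots> \<le> \<bar>A\<bar> * (M * mdist Z x y) + \<bar>B\<bar> * (L * mdist Z x y)"
      using A[of x] B[of y] L(2) M(2) that by (intro add_mono mult_mono) auto
    finally show ?thesis by (simp add: algebra_simps)
  qed
  then show ?thesis
    unfolding lipschitz_fun_iff using L(1) M(1) by (intro exI[of _ "\<bar>A\<bar> * M + \<bar>B\<bar> * L"]) auto
qed

lemma integer_rectifiable_0_zero:
  assumes "\<And>f. test_form 0 Z f [] \<Longrightarrow> T f [] = 0"
  shows "integer_rectifiable 0 Z T"
proof -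
  have T0: "T f \<pi> = 0" if "test_form 0 Z f \<pi>" for f \<pi>
    using that assms[of f] by (cases "\<pi> = []") (auto simp: test_form_def)
  have tf: "test_form 0 Z (\<lambda>x. a * f x + b * g x) \<pi>" if fg: "test_form 0 Z f \<pi>" "test_form 0 Z g \<pi>" for f g a b \<pi>
  proof -
    obtain A where A: "\<And>x. x \<in> mspace Z \<Longrightarrow> \<bar>f x\<bar> \<le> A"
      using fg(1) by (auto simp: bounded_iff test_form_def)
    obtain B where B: "\<And>x. x \<in> mspace Z \<Longrightarrow> \<bar>g x\<bar> \<le> B"
      using fg(2) by (auto simp: bounded_iff test_form_def)
    have "\<bar>a * f x + b * g x\<bar> \<le> \<bar>a\<bar> * A + \<bar>b\<bar> * B" if "x \<in> mspace Z" for x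
    proof -
      have "\<bar>a * f x + b * g x\<bar> \<le> \<bar>a\<bar> * \<bar>f x\<bar> + \<bar>b\<bar> * \<bar>g x\<bar>"
        by (metis abs_mult abs_triangle_ineq)
      also have "\<dots> \<le> \<bar>a\<bar> * A + \<bar>b\<bar> * B"
        using A B that by (intro add_mono mult_left_mono) auto
      finally show ?thesis .
    qed
    then show ?thesis
      using fg lipschitz_fun_lincomb[of Z f g] by (auto simp: test_form_def bounded_iff)
  qed
  have "current 0 Z T"
    unfolding current_def
  proof (intro conjI allI impI)
    fix f \<pi> and \<rho> :: "nat \<Rightarrow> ('a \<Rightarrow> real) list" assume "test_form 0 Z f \<pi>" "\<forall>j. test_form 0 Z f (\<rho> j)"
    then show "(\<lambda>j. T f (\<rho> j)) \<longlonglongrightarrow> T f \<pi>" by (simp add: T0)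
  next
    have "finite_measure (null_measure (metric_borel Z))"
      by (intro finite_measureI) simp
    then have "mass_bound 0 Z T (null_measure (metric_borel Z))"
      using T0 by (auto simp: mass_bound_def test_form_def)
    then show "\<exists>\<mu>. mass_bound 0 Z T \<mu>" by blast
  qed (use T0 tf in auto)
  then show ?thesis
    unfolding integer_rectifiable_def using assms by (auto intro!: exI[of _ "{}"])
qed

lemma hausdorff_empty: "hausdorff k Z {} = 0"
proof -
  have "hausdorff_pre k Z \<delta> {} = 0" for \<delta>
  proof -
    have "hausdorff_pre k Z \<delta> {} \<le> (\<Sum>i::nat. hausdorff_gauge k Z {})"
      unfolding hausdorff_pre_def
      by (rule INF_lower2[of "\<lambda>_. {}"]) (auto simp: metric_diam_def)
    then show ?thesis by (simp add: hausdorff_gauge_def)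
  qed
  then show ?thesis by (simp add: hausdorff_def)
qed

text \<open>The condition \<open>mass\<close> excludes cancellation and loss of speed,
  \<open>null\<close> is absolute continuity with respect to Hausdorff measure, \<open>surj\<close>
  makes the curve a chart of the whole space, and \<open>closed\<close> makes the boundary
  vanish.\<close>

locale filling_curve = lipschitz_curve +
  assumes mass: "mass_measure 1 Z (curve_current \<gamma> l) = curve_measure Z \<gamma> l"
    and null: "\<And>N. N \<in> sets (metric_borel Z) \<Longrightarrow> hausdorff 1 Z N = 0 \<Longrightarrow> emeasure (curve_measure Z \<gamma> l) N = 0"
    and surj: "mspace Z \<subseteq> range \<gamma>"
    and closed: "\<gamma> l = \<gamma> 0"
begin

text \<open>The extension to Borel functions is described by all \<open>L1\<close>-approximating
  sequences at once. The mass bound shows that each of them leads to the integral; the products of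
  \<open>f\<close> with bump functions of \<open>A\<close> show that at least one exists, without
  which the value would not be unique.\<close>

lemma curve_current_restrict:
  assumes f: "lipschitz_fun Z f" "bounded (f ` mspace Z)" and p: "lipschitz_fun Z p"
    and A: "openin (mtopology_of Z) A"
  shows "current_restrict 1 Z (curve_current \<gamma> l) A f [p] =
    (LBINT t:{0..l}. indicator A (\<gamma> t) * f (\<gamma> t) * deriv (p \<circ> \<gamma>) t)"
proof -
  let ?\<mu> = "curve_measure Z \<gamma> l"
  let ?g = "\<lambda>x. indicator A x * f x"
  let ?c = "LBINT t:{0..l}. indicator A (\<gamma> t) * f (\<gamma> t) * deriv (p \<circ> \<gamma>) t"
  interpret M: finite_measure ?\<mu> by (rule finite_measure_curve_measure)
  note pL = comp_curve_lipschitz[OF p]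
  have [measurable]: "A \<in> sets (metric_borel Z)" "f \<in> borel_measurable (metric_borel Z)"
    using openin_in_metric_borel[OF A] borel_measurable_lipschitz_fun[OF f(1)] by auto
  note [measurable] = borel_measurable_deriv[OF lipschitz_on_continuous_on[OF pL]]
  obtain B where B: "\<And>x. x \<in> mspace Z \<Longrightarrow> \<bar>f x\<bar> \<le> B"
    using f(2) by (auto simp: bounded_iff)
  then have B': "\<bar>?g x\<bar> \<le> \<bar>B\<bar>" if "x \<in> mspace Z" for x
    using B[OF that] by (auto simp: indicator_def)
  have gm[measurable]: "?g \<in> borel_measurable (metric_borel Z)"
    by measurable
  have si: "set_integrable lborel {0..l} (\<lambda>t. ?g (\<gamma> t) * deriv (p \<circ> \<gamma>) t)"
    using measurable_compose[OF measurable_curve gm] B'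
    by (intro set_integrable_lipschitz_deriv[OF _ _ pL, of _ _ _ "\<bar>B\<bar>"]) auto
  have conv: "(\<lambda>j. curve_current \<gamma> l (h j) [p]) \<longlonglongrightarrow> ?c"
    if h: "\<And>j::nat. test_form 1 Z (h j) [p]" and lim: "(\<lambda>j. \<integral>x. \<bar>h j x - ?g x\<bar> \<partial>?\<mu>) \<longlonglongrightarrow> 0" for h
  proof -
    have hL: "lipschitz_fun Z (h j)" and hb: "bounded (h j ` mspace Z)" for j
      using h[of j] by (auto simp: test_form_1_iff)
    have [measurable]: "h j \<in> borel_measurable (metric_borel Z)" for j
      using borel_measurable_lipschitz_fun[OF hL] .
    have hgm: "(\<lambda>x. h j x - ?g x) \<in> borel_measurable (metric_borel Z)" for j
      by measurable
    have est: "\<bar>curve_current \<gamma> l (h j) [p] - ?c\<bar> \<le> lip_const Z p * (\<integral>x. \<bar>h j x - ?g x\<bar> \<partial>?\<mu>)" for j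
    proof -
      obtain H where H: "\<And>x. x \<in> mspace Z \<Longrightarrow> \<bar>h j x\<bar> \<le> H"
        using hb[of j] by (auto simp: bounded_iff)
      have Hd: "\<bar>h j x - ?g x\<bar> \<le> H + \<bar>B\<bar>" if "x \<in> mspace Z" for x
        using H[OF that] B'[OF that] by linarith
      have si2: "set_integrable lborel {0..l} (\<lambda>t. (h j (\<gamma> t) - ?g (\<gamma> t)) * deriv (p \<circ> \<gamma>) t)"
        using measurable_compose[OF measurable_curve hgm[of j]] Hd
        by (intro set_integrable_lipschitz_deriv[OF _ _ pL, of _ _ _ "H + \<bar>B\<bar>"]) auto
      have eq: "curve_current \<gamma> l (h j) [p] - ?c = (LBINT t:{0..l}. (h j (\<gamma> t) - ?g (\<gamma> t)) * deriv (p \<circ> \<gamma>) t)"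
        unfolding curve_current_def using set_integral_diff(2)[OF comp_curve_set_integrable[OF hL p] si]
        by (simp add: left_diff_distrib)
      have "\<bar>curve_current \<gamma> l (h j) [p] - ?c\<bar> \<le>
          (LBINT t. \<bar>indicator {0..l} t *\<^sub>R ((h j (\<gamma> t) - ?g (\<gamma> t)) * deriv (p \<circ> \<gamma>) t)\<bar>)"
        unfolding eq unfolding set_lebesgue_integral_def by (rule integral_abs_bound)
      also have "\<dots> \<le> (LBINT t:{0..l}. lip_const Z p * \<bar>h j (\<gamma> t) - ?g (\<gamma> t)\<bar>)"
        unfolding set_lebesgue_integral_def
      proof (intro integral_mono_AE integrable_abs)
        show "integrable lborel (\<lambda>t. indicat_real {0..l} t *\<^sub>R ((h j (\<gamma> t) - ?g (\<gamma> t)) * deriv (p \<circ> \<gamma>) t))"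
          using si2 unfolding set_integrable_def .
        show "integrable lborel (\<lambda>t. indicat_real {0..l} t *\<^sub>R (lip_const Z p * \<bar>h j (\<gamma> t) - ?g (\<gamma> t)\<bar>))"
        proof (rule Bochner_Integration.integrable_bound)
          show "integrable lborel (\<lambda>t. indicator {0..l} t * (lip_const Z p * (H + \<bar>B\<bar>)))"
            by (intro integrable_mult_left integrable_real_indicator) (auto simp: emeasure_lborel_Icc_eq)
          show "AE t in lborel. norm (indicat_real {0..l} t *\<^sub>R (lip_const Z p * \<bar>h j (\<gamma> t) - ?g (\<gamma> t)\<bar>))
              \<le> norm (indicator {0..l} t * (lip_const Z p * (H + \<bar>B\<bar>)))"
          proof (rule AE_I2)
            fix t
            have "lip_const Z p * \<bar>h j (\<gamma> t) - ?g (\<gamma> t)\<bar> \<le> lip_const Z p * (H + \<bar>B\<bar>)"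
              using Hd[of "\<gamma> t"] lip_const_nonneg[OF p] by (intro mult_left_mono) auto
            moreover have "0 \<le> lip_const Z p * \<bar>h j (\<gamma> t) - ?g (\<gamma> t)\<bar>"
              using lip_const_nonneg[OF p] by auto
            ultimately show "norm (indicat_real {0..l} t *\<^sub>R (lip_const Z p * \<bar>h j (\<gamma> t) - ?g (\<gamma> t)\<bar>))
              \<le> norm (indicator {0..l} t * (lip_const Z p * (H + \<bar>B\<bar>)))"
              by (cases "t \<in> {0..l}") (auto simp del: mult_minus_left)
          qed
        qed measurable
        show "AE t in lborel. \<bar>indicat_real {0..l} t *\<^sub>R ((h j (\<gamma> t) - ?g (\<gamma> t)) * deriv (p \<circ> \<gamma>) t)\<bar>
            \<le> indicat_real {0..l} t *\<^sub>R (lip_const Z p * \<bar>h j (\<gamma> t) - ?g (\<gamma> t)\<bar>)"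
          using lipschitz_real_has_derivative_AE[OF pL]
        proof eventually_elim
          case (elim t)
          then have "\<bar>deriv (p \<circ> \<gamma>) t\<bar> \<le> lip_const Z p"
            by (rule lipschitz_real_deriv_le[OF pL])
          then have "\<bar>h j (\<gamma> t) - ?g (\<gamma> t)\<bar> * \<bar>deriv (p \<circ> \<gamma>) t\<bar> \<le> \<bar>h j (\<gamma> t) - ?g (\<gamma> t)\<bar> * lip_const Z p"
            by (rule mult_left_mono) simp
          then show ?case
            by (cases "t \<in> {0..l}") (auto simp: abs_mult mult.commute)
        qed
      qed
      also have "\<dots> = lip_const Z p * (\<integral>x. \<bar>h j x - ?g x\<bar> \<partial>?\<mu>)"
        by (subst integral_curve_measure) auto
      finally show ?thesis .
    qed
    have lim': "(\<lambda>j. lip_const Z p * (\<integral>x. \<bar>h j x - ?g x\<bar> \<partial>?\<mu>)) \<longlonglongrightarrow> 0"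
      using lim by (rule tendsto_mult_right_zero)
    have "(\<lambda>j. curve_current \<gamma> l (h j) [p] - ?c) \<longlonglongrightarrow> 0"
    proof (rule Lim_null_comparison[OF _ lim'])
      show "\<forall>\<^sub>F j in sequentially. norm (curve_current \<gamma> l (h j) [p] - ?c) \<le>
          lip_const Z p * (\<integral>x. \<bar>h j x - ?g x\<bar> \<partial>?\<mu>)"
        unfolding real_norm_def by (rule always_eventually[OF allI]) (rule est)
    qed
    then show ?thesis by (rule LIM_zero_cancel)
  qed
  obtain u :: "nat \<Rightarrow> 'a \<Rightarrow> real" where u: "\<And>j. lipschitz_fun Z (u j)" "\<And>j x. 0 \<le> u j x" "\<And>j x. u j x \<le> 1"
    "\<And>j x. x \<in> mspace Z \<Longrightarrow> x \<notin> A \<Longrightarrow> u j x = 0" "\<And>x. x \<in> A \<Longrightarrow> (\<lambda>j. u j x) \<longlonglongrightarrow> 1"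
    using lipschitz_bump_sequence[OF A] by blast
  have [measurable]: "u j \<in> borel_measurable (metric_borel Z)" for j
    using borel_measurable_lipschitz_fun[OF u(1)] .
  have ub: "bounded (u j ` mspace Z)" for j
    using u(2,3) by (auto simp: bounded_iff intro!: exI[of _ 1])
  have uf_le: "\<bar>u j x * f x\<bar> \<le> \<bar>B\<bar>" if "x \<in> mspace Z" for j x
    using mult_mono[of "\<bar>u j x\<bar>" 1 "\<bar>f x\<bar>" "\<bar>B\<bar>"] u(2,3)[of j x] B[OF that] by (auto simp: abs_mult)
  have tf: "test_form 1 Z (\<lambda>x. u j x * f x) [p]" for j
    using lipschitz_fun_mult[OF u(1) ub f] p uf_le by (auto simp: test_form_1_iff bounded_iff)
  have "(\<lambda>j. \<integral>x. \<bar>u j x * f x - ?g x\<bar> \<partial>?\<mu>) \<longlonglongrightarrow> (\<integral>x. 0 \<partial>?\<mu>)"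
  proof (rule integral_dominated_convergence[where w="\<lambda>_. 2 * \<bar>B\<bar>"])
    show "AE x in ?\<mu>. (\<lambda>j. \<bar>u j x * f x - ?g x\<bar>) \<longlonglongrightarrow> 0"
    proof (rule AE_I2)
      fix x assume x: "x \<in> space ?\<mu>"
      have "(\<lambda>j. u j x) \<longlonglongrightarrow> indicator A x"
        using u(4,5) x by (cases "x \<in> A") auto
      then have "(\<lambda>j. \<bar>u j x * f x - indicator A x * f x\<bar>) \<longlonglongrightarrow> \<bar>indicator A x * f x - indicator A x * f x\<bar>"
        by (intro tendsto_intros)
      then show "(\<lambda>j. \<bar>u j x * f x - ?g x\<bar>) \<longlonglongrightarrow> 0" by simp
    qed
    show "AE x in ?\<mu>. norm \<bar>u j x * f x - ?g x\<bar> \<le> 2 * \<bar>B\<bar>" for j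
    proof (rule AE_I2)
      fix x assume x: "x \<in> space ?\<mu>"
      then show "norm \<bar>u j x * f x - ?g x\<bar> \<le> 2 * \<bar>B\<bar>"
        using uf_le[of x j] B'[of x] unfolding space_curve_measure real_norm_def by linarith
    qed
  qed (simp_all add: measurable_cong_sets[OF sets_curve_measure refl], measurable)
  then have lim_u: "(\<lambda>j. \<integral>x. \<bar>u j x * f x - ?g x\<bar> \<partial>?\<mu>) \<longlonglongrightarrow> 0" by simp
  show ?thesis
    unfolding current_restrict_def current_extension_def mass
  proof (rule the_equality)
    show "\<forall>h. (\<forall>j. test_form 1 Z (h j) [p]) \<longrightarrow> (\<lambda>j. \<integral>x. \<bar>h j x - ?g x\<bar> \<partial>?\<mu>) \<longlonglongrightarrow> 0 \<longrightarrow>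
        (\<lambda>j. curve_current \<gamma> l (h j) [p]) \<longlonglongrightarrow> ?c"
      using conv by blast
    fix c assume c: "\<forall>h. (\<forall>j. test_form 1 Z (h j) [p]) \<longrightarrow> (\<lambda>j. \<integral>x. \<bar>h j x - ?g x\<bar> \<partial>?\<mu>) \<longlonglongrightarrow> 0 \<longrightarrow>
        (\<lambda>j. curve_current \<gamma> l (h j) [p]) \<longlonglongrightarrow> c"
    have "(\<lambda>j. curve_current \<gamma> l (\<lambda>x. u j x * f x) [p]) \<longlonglongrightarrow> c"
      using c[rule_format, of "\<lambda>j x. u j x * f x"] tf lim_u by simp
    then show "c = ?c"
      using conv[OF tf lim_u] LIMSEQ_unique by blast
  qed
qed

end

text \<open>Borel-Cantelli: the function that counts the sets containing \<open>x\<close> has finite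
  integral, hence is finite almost everywhere.\<close>

lemma summable_sets_finite_AE:
  fixes I :: "nat \<Rightarrow> 'a set"
  assumes I: "\<And>n. I n \<in> sets M" and fin: "(\<Sum>n. emeasure M (I n)) < \<infinity>"
  shows "AE x in M. finite {n. x \<in> I n}"
proof -
  have "(\<integral>\<^sup>+x. (\<Sum>n. indicator (I n) x) \<partial>M) = (\<Sum>n. emeasure M (I n))"
    using I by (subst nn_integral_suminf) auto
  then have "AE x in M. (\<Sum>n. indicator (I n) x :: ennreal) \<noteq> \<infinity>"
    using fin I by (intro nn_integral_PInf_AE) auto
  then show ?thesis
  proof eventually_elim
    case (elim x)
    have eq: "(indicator (I n) x :: ennreal) = ennreal (indicat_real (I n) x)" for n
      by (simp add: indicator_def)
    have "summable (\<lambda>n. indicat_real (I n) x)"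
      using elim unfolding eq by (intro summable_suminf_not_top) auto
    then have "(\<lambda>n. indicat_real (I n) x) \<longlonglongrightarrow> 0"
      by (rule summable_LIMSEQ_zero)
    then have "\<forall>\<^sub>F n in sequentially. indicat_real (I n) x < 1"
      by (rule order_tendstoD) simp
    then obtain N where "\<And>n. n \<ge> N \<Longrightarrow> x \<notin> I n"
      by (auto simp: eventually_sequentially indicator_def split: if_splits)
    then have "{n. x \<in> I n} \<subseteq> {..<N}" by (auto simp: not_le[symmetric])
    then show ?case by (rule finite_subset) simp
  qed
qed

text \<open>\<open>\<theta> s\<close> counts, with orientation, the intervals that contain \<open>s\<close>.\<close>

lemma integral_sum_oriented_intervals:
  fixes x y :: "nat \<Rightarrow> real"
  assumes sm: "summable (\<lambda>n. \<bar>y n - x n\<bar>)"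
  obtains \<theta> :: "real \<Rightarrow> int" where "integrable lborel (\<lambda>s. of_int (\<theta> s) :: real)"
    "\<And>F B. F \<in> borel_measurable borel \<Longrightarrow> (AE s in lborel. \<bar>F s\<bar> \<le> B) \<Longrightarrow>
      (\<lambda>n. sgn (y n - x n) * (LBINT s:{min (x n) (y n)..max (x n) (y n)}. F s)) sums
        (LBINT s. of_int (\<theta> s) * F s)"
proof -
  define I where "I n = {min (x n) (y n)..max (x n) (y n)}" for n
  define c where "c n = (if x n < y n then 1 else if y n < x n then - 1 else 0 :: int)" for n
  have c: "of_int (c n) = sgn (y n - x n)" "\<bar>of_int (c n)\<bar> \<le> (1::real)" for n
    by (auto simp: c_def)
  have Im[measurable]: "I n \<in> sets borel" for n by (simp add: I_def)
  have I_len: "emeasure lborel (I n) = ennreal \<bar>y n - x n\<bar>" for n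
    by (auto simp: I_def min_def max_def)
  have "(\<Sum>n. emeasure lborel (I n)) < \<infinity>"
    unfolding I_len using sm by (simp add: suminf_ennreal2)
  then have fin: "AE s in lborel. finite {n. s \<in> I n}"
    by (intro summable_sets_finite_AE) auto
  \<comment> \<open>The case distinction mirrors the Borel formula below, where finiteness is
    expressed by quantifiers over \<open>nat\<close>; points in infinitely many intervals form a
    null set.\<close>
  define \<theta> where "\<theta> s = (if finite {n. s \<in> I n} then \<Sum>n\<in>{n. s \<in> I n}. c n else 0)" for s
  have fin_iff: "finite {n. s \<in> I n} \<longleftrightarrow> (\<exists>N. \<forall>n. N \<le> n \<longrightarrow> s \<notin> I n)" for s
    unfolding finite_nat_set_iff_bounded by (auto simp: not_le[symmetric])
  have "of_int (\<theta> s) = (if \<exists>N. \<forall>n. N \<le> n \<longrightarrow> s \<notin> I n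
      then \<Sum>n. of_int (c n) * indicat_real (I n) s else 0)" for s
  proof (cases "finite {n. s \<in> I n}")
    case True
    then have "(\<Sum>n. of_int (c n) * indicat_real (I n) s) = (\<Sum>n\<in>{n. s \<in> I n}. of_int (c n) * indicat_real (I n) s)"
      by (intro suminf_finite) auto
    with True show ?thesis by (simp add: \<theta>_def flip: fin_iff)
  qed (simp add: \<theta>_def flip: fin_iff)
  moreover have "(\<lambda>s. if \<exists>N. \<forall>n. N \<le> n \<longrightarrow> s \<notin> I n
      then \<Sum>n. of_int (c n) * indicat_real (I n) s else 0) \<in> borel_measurable borel"
    by measurable
  ultimately have \<theta>m[measurable]: "(\<lambda>s. of_int (\<theta> s) :: real) \<in> borel_measurable borel"
    by presburger
  have conv: "(\<integral>s. (\<Sum>n. of_int (c n) * indicator (I n) s * F s) \<partial>lborel) = (LBINT s. of_int (\<theta> s) * F s)"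
    and conv': "(\<lambda>n. sgn (y n - x n) * (LBINT s:I n. F s)) sums
        (\<integral>s. (\<Sum>n. of_int (c n) * indicator (I n) s * F s) \<partial>lborel)"
    and int: "integrable lborel (\<lambda>s. of_int (\<theta> s) * F s)"
    if F[measurable]: "F \<in> borel_measurable borel" and B: "AE s in lborel. \<bar>F s\<bar> \<le> B" for F B
  proof -
    let ?h = "\<lambda>n s. of_int (c n) * indicator (I n) s * F s :: real"
    have th: "AE s in lborel. (\<lambda>n. ?h n s) sums (of_int (\<theta> s) * F s) \<and> summable (\<lambda>n. norm (?h n s))"
      using fin
    proof eventually_elim
      case (elim s)
      have "(\<lambda>n. ?h n s) sums (\<Sum>n\<in>{n. s \<in> I n}. ?h n s)"
        using elim by (intro sums_finite) auto
      moreover have "(\<Sum>n\<in>{n. s \<in> I n}. ?h n s) = of_int (\<theta> s) * F s"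
        using elim by (simp add: \<theta>_def sum_distrib_right)
      moreover have "summable (\<lambda>n. norm (?h n s))"
        using elim by (intro summable_finite[of "{n. s \<in> I n}"]) auto
      ultimately show ?case by simp
    qed
    have hb: "AE s in lborel. norm (?h n s) \<le> norm (B * indicator (I n) s)" for n
      using B
    proof eventually_elim
      case (elim s)
      have "\<bar>of_int (c n)\<bar> * \<bar>F s\<bar> \<le> 1 * \<bar>B\<bar>"
        using elim c(2) by (intro mult_mono) auto
      then show ?case by (auto simp: indicator_def abs_mult)
    qed
    have hb_int: "integrable lborel (\<lambda>s. B * indicator (I n) s)" for n
      by (intro integrable_mult_right integrable_real_indicator) (auto simp: I_len)
    have hi: "integrable lborel (?h n)" for n
      by (rule Bochner_Integration.integrable_bound[OF hb_int _ hb]) measurable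
    have h_norm: "(\<integral>s. norm (?h n s) \<partial>lborel) \<le> \<bar>B\<bar> * \<bar>y n - x n\<bar>" for n
    proof -
      have "(\<integral>s. norm (?h n s) \<partial>lborel) \<le> (\<integral>s. norm (B * indicator (I n) s) \<partial>lborel)"
        using hb by (intro integral_mono_AE integrable_norm hi hb_int)
      also have "\<dots> = (\<integral>s. \<bar>B\<bar> * indicator (I n) s \<partial>lborel)"
        by (simp add: abs_mult)
      also have "\<dots> = \<bar>B\<bar> * \<bar>y n - x n\<bar>"
        using I_len[of n] by (simp add: measure_def)
      finally show ?thesis .
    qed
    have h_sm: "summable (\<lambda>n. \<integral>s. norm (?h n s) \<partial>lborel)"
      using h_norm by (intro summable_comparison_test'[OF summable_mult[OF sm, of "\<bar>B\<bar>"]]) auto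
    have th': "AE s in lborel. summable (\<lambda>n. norm (?h n s))"
      using th by eventually_elim simp
    have th'': "AE s in lborel. (\<Sum>n. ?h n s) = of_int (\<theta> s) * F s"
      using th by eventually_elim (simp add: sums_iff)
    show "(\<integral>s. (\<Sum>n. ?h n s) \<partial>lborel) = (LBINT s. of_int (\<theta> s) * F s)"
      using th'' by (intro integral_cong_AE) measurable
    have "(\<lambda>n. \<integral>s. ?h n s \<partial>lborel) sums (\<integral>s. (\<Sum>n. ?h n s) \<partial>lborel)"
      by (rule sums_integral[OF hi th' h_sm])
    moreover have "(\<integral>s. ?h n s \<partial>lborel) = sgn (y n - x n) * (LBINT s:I n. F s)" for n
      by (simp add: set_lebesgue_integral_def c(1) mult.assoc)
    ultimately show "(\<lambda>n. sgn (y n - x n) * (LBINT s:I n. F s)) sums (\<integral>s. (\<Sum>n. ?h n s) \<partial>lborel)"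
      by simp
    have "integrable lborel (\<lambda>s. \<Sum>n. ?h n s)"
      by (rule integrable_suminf[OF hi th' h_sm])
    then show "integrable lborel (\<lambda>s. of_int (\<theta> s) * F s)"
      using th'' by (subst integrable_cong_AE[symmetric]) auto
  qed
  show ?thesis
  proof (rule that)
    show "integrable lborel (\<lambda>s. of_int (\<theta> s) :: real)"
      using int[of "\<lambda>_. 1" 1] by simp
    show "(\<lambda>n. sgn (y n - x n) * (LBINT s:{min (x n) (y n)..max (x n) (y n)}. F s)) sums
        (LBINT s. of_int (\<theta> s) * F s)"
      if "F \<in> borel_measurable borel" "AE s in lborel. \<bar>F s\<bar> \<le> B" for F B
      using conv[OF that] conv'[OF that] by (simp add: I_def)
  qed
qed

section \<open>Push-forwards to the line and integrality of the curve current\<close>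

context filling_curve
begin

text \<open>The times spent in the open set \<open>A\<close> form countably many open intervals. On
  each of them the substitution formula sees only the oriented segment between the images of the two
  ends, and the Lipschitz bound makes the lengths of these segments summable. Counting the segments
  with orientation gives the integer density.\<close>

lemma pushforward_curve_current:
  assumes \<phi>: "Lipschitz_continuous_map Z (euclid 1) \<phi>" and A: "openin (mtopology_of Z) A"
  shows "\<exists>\<theta>. integrable (leb 1) (\<lambda>x. of_int (\<theta> x) :: real) \<and>
    (\<forall>f \<pi>. test_form 1 (euclid 1) f \<pi> \<longrightarrow>
      pushforward \<phi> (current_restrict 1 Z (curve_current \<gamma> l) A) f \<pi> = euclid_current 1 \<theta> f \<pi>)"
proof -
  define \<psi> where "\<psi> t = \<phi> (\<gamma> t) 0" for t
  have \<phi>_pt: "\<phi> x = euclid_pt (\<phi> x 0)" if "x \<in> mspace Z" for x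
  proof -
    have "\<phi> x \<in> {..<Suc 0} \<rightarrow>\<^sub>E UNIV"
      using Lipschitz_continuous_map_image[OF \<phi>] that by auto
    then show ?thesis by (simp add: euclid_pt_collapse)
  qed
  have "lipschitz_fun Z (\<lambda>x. \<phi> x 0)"
    using \<phi> by (auto simp: Lipschitz_continuous_map_def mdist_euclid_1 dist_real_def simp del: mdist_euclid)
  from comp_curve_lipschitz[OF this] obtain L where \<psi>: "L-lipschitz_on UNIV \<psi>"
    unfolding comp_def \<psi>_def by blast
  \<comment> \<open>Leaving out the times \<open>0\<close> and \<open>l\<close> makes the set open
    and changes it by a null set only.\<close>
  define U where "U = \<gamma> -` A \<inter> {0<..<l}"
  have U: "open U" "bounded U" "U \<subseteq> {0<..<l}"
    using open_curve_vimage[OF A] unfolding U_def by (auto intro: bounded_subset[of "{0<..<l}"])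
  obtain a b where ab: "\<And>n. a n \<le> b n" "disjoint_family (\<lambda>n::nat. {a n<..<b n})" "U = (\<Union>n. {a n<..<b n})"
    using open_bounded_real_disjoint_intervals[OF U(1,2)] by blast
  have ab_meas: "(\<Sum>n. emeasure lborel {a n<..<b n}) = emeasure lborel U"
    unfolding ab(3) using ab(2) by (intro suminf_emeasure) auto
  have "emeasure lborel U \<le> emeasure lborel {0..l}"
    using U(3) by (intro emeasure_mono) (auto simp: subset_eq less_imp_le)
  then have "(\<Sum>n. ennreal (b n - a n)) < \<infinity>"
    using ab_meas ab(1) by (simp add: emeasure_lborel_Icc_eq order.strict_trans1)
  then have sm_ab: "summable (\<lambda>n. b n - a n)"
    using ab(1) by (intro summable_suminf_not_top) auto
  have "\<bar>\<psi> (b n) - \<psi> (a n)\<bar> \<le> L * (b n - a n)" for n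
    using lipschitz_onD[OF \<psi>, of "b n" "a n"] ab(1)[of n] by (simp add: dist_real_def)
  then have sm: "summable (\<lambda>n. \<bar>\<psi> (b n) - \<psi> (a n)\<bar>)"
    by (intro summable_comparison_test'[OF summable_mult[OF sm_ab, of L]]) auto
  obtain \<theta> :: "real \<Rightarrow> int" where \<theta>: "integrable lborel (\<lambda>s. of_int (\<theta> s) :: real)"
    "\<And>F B. F \<in> borel_measurable borel \<Longrightarrow> (AE s in lborel. \<bar>F s\<bar> \<le> B) \<Longrightarrow>
      (\<lambda>n. sgn (\<psi> (b n) - \<psi> (a n)) * (LBINT s:{min (\<psi> (a n)) (\<psi> (b n))..max (\<psi> (a n)) (\<psi> (b n))}. F s)) sums
        (LBINT s. of_int (\<theta> s) * F s)"
    using integral_sum_oriented_intervals[OF sm] by blast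
  note [measurable] = borel_measurable_integrable[OF \<theta>(1)]
  show ?thesis
  proof (intro exI[of _ "\<lambda>x. \<theta> (x 0)"] conjI allI impI)
    show "integrable (leb 1) (\<lambda>x. of_int (\<theta> (x 0)) :: real)"
      using integrable_leb_1[of "\<lambda>s. of_int (\<theta> s)"] \<theta>(1) by simp
    fix f \<pi> assume "test_form 1 (euclid 1) f \<pi>"
    then obtain p where f: "lipschitz_fun (euclid (Suc 0)) f" "bounded (f ` mspace (euclid (Suc 0)))"
      and \<pi>: "\<pi> = [p]" and p: "lipschitz_fun (euclid (Suc 0)) p"
      by (auto simp: test_form_1_iff)
    let ?f = "\<lambda>s. f (euclid_pt s)" and ?p = "\<lambda>s. p (euclid_pt s)"
    obtain K where K: "K-lipschitz_on UNIV ?f" using lipschitz_euclid_1[OF f(1)] by blast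
    obtain M where M: "M-lipschitz_on UNIV ?p" using lipschitz_euclid_1[OF p] by blast
    have p\<psi>: "(M * L)-lipschitz_on UNIV (?p \<circ> \<psi>)"
      using lipschitz_on_compose[OF \<psi>] M lipschitz_on_subset by blast
    note fm[measurable] = borel_measurable_lipschitz[OF K] and \<psi>m[measurable] = borel_measurable_lipschitz[OF \<psi>]
      and pm[measurable] = borel_measurable_deriv[OF lipschitz_on_continuous_on[OF M]]
      and p\<psi>m[measurable] = borel_measurable_deriv[OF lipschitz_on_continuous_on[OF p\<psi>]]
    note f\<psi>m[measurable] = measurable_compose[OF \<psi>m fm]
    have Um[measurable]: "U \<in> sets borel" using U(1) by simp
    obtain B where B: "\<And>x. x \<in> {..<Suc 0} \<rightarrow>\<^sub>E UNIV \<Longrightarrow> \<bar>f x\<bar> \<le> B"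
      using f(2) by (auto simp: bounded_iff)
    then have B': "\<bar>?f s\<bar> \<le> B" for s by simp
    then have B0: "B \<ge> 0" by (meson abs_ge_zero order_trans)
    have eq_f: "(f \<circ> \<phi>) (\<gamma> t) = ?f (\<psi> t)" for t
      using \<phi>_pt[of "\<gamma> t"] by (simp add: \<psi>_def)
    have eq_p: "(p \<circ> \<phi>) \<circ> \<gamma> = ?p \<circ> \<psi>"
    proof
      fix t show "((p \<circ> \<phi>) \<circ> \<gamma>) t = (?p \<circ> \<psi>) t"
        using \<phi>_pt[of "\<gamma> t"] by (simp add: \<psi>_def)
    qed
    have f\<phi>: "lipschitz_fun Z (f \<circ> \<phi>)" "lipschitz_fun Z (p \<circ> \<phi>)"
      using Lipschitz_continuous_map_compose[OF \<phi>] f(1) p by auto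
    have "bounded ((f \<circ> \<phi>) ` mspace Z)"
      using B Lipschitz_continuous_map_image[OF \<phi>] by (auto simp: bounded_iff Pi_iff intro!: exI[of _ B])
    then have "pushforward \<phi> (current_restrict 1 Z (curve_current \<gamma> l) A) f \<pi> =
        (LBINT t:{0..l}. indicator A (\<gamma> t) * ?f (\<psi> t) * deriv (?p \<circ> \<psi>) t)"
      unfolding pushforward_def \<pi> list.map
      by (subst curve_current_restrict[OF f\<phi>(1) _ f\<phi>(2) A]) (simp_all only: eq_f eq_p)
    also have "\<dots> = (LBINT t:U. ?f (\<psi> t) * deriv (?p \<circ> \<psi>) t)"
      unfolding set_lebesgue_integral_def
    proof (rule integral_cong_AE)
      have [measurable]: "\<gamma> -` A \<in> sets borel" using open_curve_vimage[OF A] by simp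
      have ind: "indicator A (\<gamma> t) = indicat_real (\<gamma> -` A) t" for t by (simp add: indicator_def)
      show "(\<lambda>t. indicat_real {0..l} t *\<^sub>R (indicator A (\<gamma> t) * ?f (\<psi> t) * deriv (?p \<circ> \<psi>) t)) \<in> borel_measurable lborel"
        unfolding ind by measurable
      show "(\<lambda>t. indicat_real U t *\<^sub>R (?f (\<psi> t) * deriv (?p \<circ> \<psi>) t)) \<in> borel_measurable lborel"
        by measurable
      show "AE t in lborel. indicat_real {0..l} t *\<^sub>R (indicator A (\<gamma> t) * ?f (\<psi> t) * deriv (?p \<circ> \<psi>) t) =
          indicat_real U t *\<^sub>R (?f (\<psi> t) * deriv (?p \<circ> \<psi>) t)"
        using AE_lborel_singleton[of 0] AE_lborel_singleton[of l]
        by eventually_elim (auto simp: indicator_def U_def)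
    qed
    also have "\<dots> = (\<Sum>n. LBINT t:{a n<..<b n}. ?f (\<psi> t) * deriv (?p \<circ> \<psi>) t)"
      unfolding ab(3)
    proof (rule lebesgue_integral_countable_add)
      have "set_integrable lborel {0..l} (\<lambda>t. ?f (\<psi> t) * deriv (?p \<circ> \<psi>) t)"
        by (rule set_integrable_lipschitz_deriv[OF f\<psi>m B' p\<psi>])
      then show "set_integrable lborel (\<Union>n. {a n<..<b n}) (\<lambda>t. ?f (\<psi> t) * deriv (?p \<circ> \<psi>) t)"
        by (rule set_integrable_subset) (use U(3) ab(3) in \<open>auto simp: subset_eq less_imp_le\<close>)
    qed (use ab(2) in \<open>auto simp: disjoint_family_on_def\<close>)
    also have "\<dots> = (\<Sum>n. sgn (\<psi> (b n) - \<psi> (a n)) *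
        (LBINT s:{min (\<psi> (a n)) (\<psi> (b n))..max (\<psi> (a n)) (\<psi> (b n))}. ?f s * deriv ?p s))"
    proof (rule suminf_cong)
      fix n
      have "(LBINT t:{a n<..<b n}. ?f (\<psi> t) * deriv (?p \<circ> \<psi>) t) = (LBINT t:{a n..b n}. ?f (\<psi> t) * deriv (?p \<circ> \<psi>) t)"
        unfolding set_lebesgue_integral_def
      proof (rule integral_cong_AE)
        show "AE t in lborel. indicat_real {a n<..<b n} t *\<^sub>R (?f (\<psi> t) * deriv (?p \<circ> \<psi>) t) =
            indicat_real {a n..b n} t *\<^sub>R (?f (\<psi> t) * deriv (?p \<circ> \<psi>) t)"
          using AE_lborel_singleton[of "a n"] AE_lborel_singleton[of "b n"]
          by eventually_elim (auto simp: indicator_def)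
      qed measurable
      also have "\<dots> = sgn (\<psi> (b n) - \<psi> (a n)) *
        (LBINT s:{min (\<psi> (a n)) (\<psi> (b n))..max (\<psi> (a n)) (\<psi> (b n))}. ?f s * deriv ?p s)"
        using set_integral_lipschitz_substitution[OF K M \<psi> ab(1)] .
      finally show "(LBINT t:{a n<..<b n}. ?f (\<psi> t) * deriv (?p \<circ> \<psi>) t) = \<dots>" .
    qed
    also have "\<dots> = (LBINT s. of_int (\<theta> s) * (?f s * deriv ?p s))"
    proof (rule sums_unique[symmetric], rule \<theta>(2))
      show "AE s in lborel. \<bar>?f s * deriv ?p s\<bar> \<le> B * M"
        using lipschitz_real_has_derivative_AE[OF M]
      proof eventually_elim
        case (elim s)
        then have "\<bar>deriv ?p s\<bar> \<le> M" by (rule lipschitz_real_deriv_le[OF M])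
        then show ?case unfolding abs_mult using B' B0 by (intro mult_mono) auto
      qed
    qed measurable
    also have "\<dots> = (\<integral>x. of_int (\<theta> (x 0)) * (?f (x 0) * deriv ?p (x 0)) \<partial>leb (Suc 0))"
      by (rule integral_leb_1[symmetric]) measurable
    also have "\<dots> = euclid_current 1 (\<lambda>x. \<theta> (x 0)) f \<pi>"
      unfolding euclid_current_def One_nat_def \<pi>
      by (intro Bochner_Integration.integral_cong refl)
        (simp add: space_leb_1 jacobian_det_1 euclid_pt_collapse)
    finally show "pushforward \<phi> (current_restrict 1 Z (curve_current \<gamma> l) A) f \<pi> =
        euclid_current 1 (\<lambda>x. \<theta> (x 0)) f \<pi>" .
  qed
qed

lemma curve_current_boundary_zero: "test_form 0 Z f \<pi> \<Longrightarrow> current_boundary (curve_current \<gamma> l) f \<pi> = 0"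
  using curve_current_boundary[of f] closed by (simp add: test_form_def)

theorem curve_current_integral: "curve_current \<gamma> l \<in> integral_currents 1 Z"
proof -
  have "countably_rectifiable 1 Z (mspace Z)"
    unfolding countably_rectifiable_def
  proof (intro exI conjI allI)
    \<comment> \<open>Every chart is the curve itself on the whole line; by \<open>surj\<close>
      nothing remains uncovered.\<close>
    let ?A = "\<lambda>_::nat. mspace (euclid 1)" and ?g = "\<lambda>(_::nat) x. \<gamma> (x 0)"
    show "Lipschitz_continuous_map (submetric (euclid 1) (?A j)) Z (?g j)" for j
      unfolding Lipschitz_continuous_map_def
      using curve_lip by (auto simp: mdist_euclid_1 simp del: mdist_euclid intro!: exI[of _ 1])
    have "x \<in> ?g j ` ?A j" if "x \<in> mspace Z" for x j
    proof -
      obtain t where "x = \<gamma> t" using surj \<open>x \<in> mspace Z\<close> by blast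
      then show ?thesis by (intro image_eqI[of _ _ "euclid_pt t"]) auto
    qed
    then have "mspace Z - (\<Union>j. ?g j ` ?A j) = {}" by blast
    then show "hausdorff 1 Z (mspace Z - (\<Union>j. ?g j ` ?A j)) = 0"
      by (simp only: hausdorff_empty)
  qed simp
  moreover have "mspace Z \<in> sets (metric_borel Z)"
    using sets.top[of "metric_borel Z"] by simp
  ultimately have "integer_rectifiable 1 Z (curve_current \<gamma> l)"
    unfolding integer_rectifiable_def
    using current_curve_current pushforward_curve_current null by (auto simp: mass[simplified] intro!: bexI[of _ "mspace Z"])
  moreover have "integer_rectifiable 0 Z (current_boundary (curve_current \<gamma> l))"
    using curve_current_boundary_zero by (intro integer_rectifiable_0_zero)
  ultimately show ?thesis by (simp add: integral_currents_def)
qed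

end

section \<open>One-dimensional Hausdorff measure\<close>

lemma hausdorff_gauge_1: "hausdorff_gauge 1 Z C = metric_diam Z C"
  by (simp add: hausdorff_gauge_def metric_diam_def bot_ennreal unit_ball_vol_1[simplified])

lemma mdist_le_metric_diam: "x \<in> C \<Longrightarrow> y \<in> C \<Longrightarrow> ennreal (mdist Z x y) \<le> metric_diam Z C"
  unfolding metric_diam_def by (meson SUP_upper2 order_refl)

lemma metric_diam_least:
  "(\<And>x y. x \<in> C \<Longrightarrow> y \<in> C \<Longrightarrow> mdist Z x y \<le> d) \<Longrightarrow> metric_diam Z C \<le> ennreal d"
  unfolding metric_diam_def by (intro SUP_least ennreal_leI) blast

text \<open>Cutting \<open>{a..b}\<close> into \<open>n\<close> intervals of length
  \<open>h \<le> \<delta>\<close> gives \<open>m * n\<close> image sets of diameter at most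
  \<open>h\<close>, and \<open>m * n * h\<close> is the bound.\<close>

lemma hausdorff_lipschitz_images_le:
  fixes g :: "nat \<Rightarrow> real \<Rightarrow> 'a"
  assumes g_in: "\<And>j t. g j t \<in> mspace Z" and g_lip: "\<And>j s t. mdist Z (g j s) (g j t) \<le> \<bar>s - t\<bar>"
    and A: "A \<subseteq> (\<Union>j<m. g j ` {a..b})" and "a \<le> b"
  shows "hausdorff 1 Z A \<le> ennreal (real m * (b - a))"
  unfolding hausdorff_def
proof (rule SUP_least)
  fix \<delta> :: real assume "\<delta> \<in> {0<..}"
  then have "\<delta> > 0" by simp
  obtain n where n: "(b - a) / \<delta> < real n"
    using reals_Archimedean2 by blast
  have "n > 0" using n \<open>a \<le> b\<close> \<open>\<delta> > 0\<close> by (metis divide_nonneg_pos diff_ge_0_iff_ge not_less of_nat_0 gr0I)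
  define h where "h = (b - a) / real n"
  have h: "0 \<le> h" "h \<le> \<delta>" "real n * h = b - a"
    using n \<open>n > 0\<close> \<open>\<delta> > 0\<close> \<open>a \<le> b\<close> by (auto simp: h_def field_simps)
  \<comment> \<open>The index encodes the map as \<open>i mod m\<close> and the interval as
    \<open>i div m\<close>; from \<open>m * n\<close> on the sets are empty and have gauge
    \<open>0\<close>.\<close>
  define C where "C i = (if i < m * n then g (i mod m) ` {a + real (i div m) * h..a + (real (i div m) + 1) * h} else {})" for i
  have diam: "metric_diam Z (C i) \<le> (if i < m * n then ennreal h else 0)" for i
  proof (cases "i < m * n")
    case True
    have "mdist Z x y \<le> h" if "x \<in> C i" "y \<in> C i" for x y
    proof -
      obtain s t where st: "x = g (i mod m) s" "y = g (i mod m) t"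
        "s \<in> {a + real (i div m) * h..a + (real (i div m) + 1) * h}"
        "t \<in> {a + real (i div m) * h..a + (real (i div m) + 1) * h}"
        using \<open>x \<in> C i\<close> \<open>y \<in> C i\<close> True by (auto simp: C_def)
      then have "\<bar>s - t\<bar> \<le> h" by (auto simp: algebra_simps abs_le_iff)
      then show ?thesis using g_lip[of "i mod m" s t] st by simp
    qed
    then show ?thesis using True metric_diam_least[of "C i" Z h] by simp
  qed (simp add: C_def metric_diam_def bot_ennreal)
  have "(\<Sum>i. hausdorff_gauge 1 Z (C i)) \<le> (\<Sum>i. if i < m * n then ennreal h else 0)"
    unfolding hausdorff_gauge_1 using diam by (intro suminf_le) auto
  also have "\<dots> = (\<Sum>i<m * n. ennreal h)"
    by (subst suminf_finite[of "{..<m * n}"]) auto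
  also have "\<dots> = ennreal (real m * (b - a))"
    using h by (simp add: ennreal_of_nat_eq_real_of_nat ennreal_mult[symmetric] mult.assoc)
  finally have sum: "(\<Sum>i. hausdorff_gauge 1 Z (C i)) \<le> ennreal (real m * (b - a))" .
  have cover: "A \<subseteq> (\<Union>i. C i)"
  proof
    fix x assume "x \<in> A"
    then obtain j t where jt: "j < m" "x = g j t" "a \<le> t" "t \<le> b" using A by auto
    obtain k where k: "k < n" "a + real k * h \<le> t" "t \<le> a + (real k + 1) * h"
    \<comment> \<open>Rounding down would assign the index \<open>n\<close> to the right end
      \<open>b\<close>, and \<open>h = 0\<close> forbids the division; in both cases the last
      interval is taken.\<close>
    proof (cases "h = 0 \<or> t = b")
      case True
      have "a + (real (n - 1) + 1) * h = b" using h(3) \<open>n > 0\<close> by (simp add: of_nat_diff)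
      moreover have "h = 0 \<Longrightarrow> a = b" using h(3) by simp
      moreover have "a + real (n - 1) * h \<le> b"
        using h(1) calculation(1) by (auto simp: algebra_simps)
      ultimately show ?thesis using that[of "n - 1"] True jt \<open>n > 0\<close> by auto
    next
      case False
      then have "h > 0" "t < b" using h jt by auto
      define k where "k = nat \<lfloor>(t - a) / h\<rfloor>"
      have k: "real k = of_int \<lfloor>(t - a) / h\<rfloor>"
        unfolding k_def using jt \<open>h > 0\<close> by simp
      have "real k \<le> (t - a) / h" "(t - a) / h < real k + 1"
        unfolding k by linarith+
      then have k': "real k * h \<le> t - a" "t - a < (real k + 1) * h"
        using \<open>h > 0\<close> by (auto simp: field_simps)
      have "real k * h < real n * h" using k'(1) h(3) \<open>t < b\<close> by linarith
      then have "k < n" using \<open>h > 0\<close> by simp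
      with k' show ?thesis using that[of k] by auto
    qed
    have "k * m + j < m * n"
    proof -
      have "k * m + j < Suc k * m" using jt(1) by simp
      also have "\<dots> \<le> n * m" using k(1) by (intro mult_le_mono1) simp
      finally show ?thesis by (simp add: mult.commute)
    qed
    moreover have "(k * m + j) mod m = j" "(k * m + j) div m = k" using jt(1) by auto
    ultimately have "x \<in> C (k * m + j)"
      using jt k by (auto simp: C_def)
    then show "x \<in> (\<Union>i. C i)" by blast
  qed
  have "hausdorff_pre 1 Z \<delta> A \<le> (\<Sum>i. hausdorff_gauge 1 Z (C i))"
    unfolding hausdorff_pre_def
  proof (rule INF_lower, intro CollectI conjI allI cover)
    fix i
    show "C i \<subseteq> mspace Z" using g_in by (auto simp: C_def)
    show "metric_diam Z (C i) \<le> ennreal \<delta>"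
      using diam[of i] h(2) by (auto split: if_splits intro: order_trans ennreal_leI)
  qed
  with sum show "hausdorff_pre 1 Z \<delta> A \<le> ennreal (real m * (b - a))" by simp
qed

text \<open>The part of \<open>E\<close> that \<open>g\<close> sends into \<open>C i\<close> has
  diameter at most \<open>L\<close> times that of \<open>C i\<close>, so an interval of this length
  contains it. Lower bounds for Hausdorff measure and the pull-back of null sets both rest on
  this.\<close>

lemma expanding_preimage_cover:
  fixes g :: "real \<Rightarrow> 'a"
  assumes L: "0 \<le> L" and g: "\<And>s t. s \<in> E \<Longrightarrow> t \<in> E \<Longrightarrow> \<bar>s - t\<bar> \<le> L * mdist Z (g s) (g t)"
    and C: "\<And>i::nat. metric_diam Z (C i) \<le> ennreal 1" and cover: "g ` E \<subseteq> (\<Union>i. C i)"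
  obtains V where "V \<in> sets borel" "E \<subseteq> V" "emeasure lborel V \<le> ennreal L * (\<Sum>i. hausdorff_gauge 1 Z (C i))"
proof -
  define E' where "E' i = {s \<in> E. g s \<in> C i}" for i
  define d where "d i = enn2real (metric_diam Z (C i))" for i
  have d: "metric_diam Z (C i) = ennreal (d i)" "0 \<le> d i" for i
    using C[of i] by (auto simp: d_def ennreal_enn2real_if top_unique)
  have E'd: "\<bar>s - t\<bar> \<le> L * d i" if "s \<in> E' i" "t \<in> E' i" for s t i
  proof -
    have "mdist Z (g s) (g t) \<le> d i"
      using mdist_le_metric_diam[of "g s" "C i" "g t" Z] that d(2)[of i] unfolding d(1) E'_def by auto
    then have "L * mdist Z (g s) (g t) \<le> L * d i" using L by (rule mult_left_mono)
    then show ?thesis using g[of s t] that by (auto simp: E'_def)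
  qed
  define J where "J i = (if E' i = {} then {} else {Sup (E' i) - L * d i..Sup (E' i)})" for i
  have EJ: "E' i \<subseteq> J i" for i
  proof
    fix s assume s: "s \<in> E' i"
    have "bdd_above (E' i)"
      using E'd[OF _ s] by (intro bdd_aboveI[of _ "s + L * d i"]) (fastforce simp: abs_le_iff)
    then have "s \<le> Sup (E' i)" using s by (intro cSup_upper)
    moreover have "Sup (E' i) \<le> s + L * d i"
      using s E'd[OF _ s] by (intro cSup_least) (fastforce simp: abs_le_iff)+
    ultimately show "s \<in> J i" using s by (auto simp: J_def)
  qed
  have J_len: "emeasure lborel (J i) \<le> ennreal L * metric_diam Z (C i)" for i
    using L d(2)[of i] by (simp add: J_def d(1) ennreal_mult[symmetric])
  show ?thesis
  proof (rule that[of "\<Union>i. J i"])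
    show "(\<Union>i. J i) \<in> sets borel" by (auto simp: J_def)
    show "E \<subseteq> (\<Union>i. J i)"
    proof
      fix s assume "s \<in> E"
      then obtain i where "s \<in> E' i" using cover by (auto simp: E'_def)
      then show "s \<in> (\<Union>i. J i)" using EJ by blast
    qed
    have "emeasure lborel (\<Union>i. J i) \<le> (\<Sum>i. emeasure lborel (J i))"
      by (intro emeasure_subadditive_countably) (auto simp: J_def)
    also have "\<dots> \<le> (\<Sum>i. ennreal L * metric_diam Z (C i))"
      using J_len by (intro suminf_le) auto
    also have "\<dots> = ennreal L * (\<Sum>i. hausdorff_gauge 1 Z (C i))"
      by (simp add: hausdorff_gauge_1[simplified])
    finally show "emeasure lborel (\<Union>i. J i) \<le> \<dots>" .
  qed
qed

lemma emeasure_le_hausdorff: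
  fixes g :: "real \<Rightarrow> 'a"
  assumes E: "E \<in> sets borel" and g: "\<And>s t. s \<in> E \<Longrightarrow> t \<in> E \<Longrightarrow> \<bar>s - t\<bar> \<le> mdist Z (g s) (g t)"
    and A: "g ` E \<subseteq> A"
  shows "emeasure lborel E \<le> hausdorff 1 Z A"
proof -
  have "emeasure lborel E \<le> hausdorff_pre 1 Z 1 A"
    unfolding hausdorff_pre_def
  proof (rule INF_greatest)
    fix C :: "nat \<Rightarrow> 'a set"
    assume C: "C \<in> {C. (\<forall>i. C i \<subseteq> mspace Z \<and> metric_diam Z (C i) \<le> ennreal 1) \<and> A \<subseteq> (\<Union>i. C i)}"
    obtain V where V: "V \<in> sets borel" "E \<subseteq> V" "emeasure lborel V \<le> ennreal 1 * (\<Sum>i. hausdorff_gauge 1 Z (C i))"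
      by (rule expanding_preimage_cover[of 1 E Z g C]) (use g C A in auto)
    then have "emeasure lborel E \<le> emeasure lborel V" by (intro emeasure_mono) auto
    with V(3) show "emeasure lborel E \<le> (\<Sum>i. hausdorff_gauge 1 Z (C i))" by simp
  qed
  also have "\<dots> \<le> hausdorff 1 Z A"
    unfolding hausdorff_def by (rule SUP_upper) simp
  finally show ?thesis .
qed

text \<open>The set \<open>E\<close> may fail to be measurable, so it is enclosed in Borel sets of
  length at most \<open>1 / (n + 1)\<close>, whose intersection is null. Since \<open>L\<close> is
  arbitrary, this applies to bi-Lipschitz charts.\<close>

lemma hausdorff_null_negligible_preimage:
  fixes g :: "real \<Rightarrow> 'a"
  assumes L: "0 \<le> L" and g: "\<And>s t. s \<in> E \<Longrightarrow> t \<in> E \<Longrightarrow> \<bar>s - t\<bar> \<le> L * mdist Z (g s) (g t)"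
    and A: "g ` E \<subseteq> A" and null: "hausdorff 1 Z A = 0"
  shows "negligible E"
proof -
  have "hausdorff_pre 1 Z 1 A \<le> hausdorff 1 Z A"
    unfolding hausdorff_def by (rule SUP_upper) simp
  then have pre: "hausdorff_pre 1 Z 1 A = 0" using null by simp
  have "\<exists>V. V \<in> sets borel \<and> E \<subseteq> V \<and> emeasure lborel V \<le> ennreal e" if "e > 0" for e
  proof -
    have "hausdorff_pre 1 Z 1 A < ennreal (e / (L + 1))"
      using pre that L by simp
    then obtain C :: "nat \<Rightarrow> 'a set" where C: "\<And>i. metric_diam Z (C i) \<le> ennreal 1" "A \<subseteq> (\<Union>i. C i)"
      "(\<Sum>i. hausdorff_gauge 1 Z (C i)) < ennreal (e / (L + 1))"
      unfolding hausdorff_pre_def INF_less_iff by auto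
    obtain V where V: "V \<in> sets borel" "E \<subseteq> V" "emeasure lborel V \<le> ennreal L * (\<Sum>i. hausdorff_gauge 1 Z (C i))"
      by (rule expanding_preimage_cover[OF L g C(1)]) (use A C(2) in auto)
    note V(3)
    also have "ennreal L * (\<Sum>i. hausdorff_gauge 1 Z (C i)) \<le> ennreal L * ennreal (e / (L + 1))"
      using C(3) by (intro mult_left_mono) auto
    also have "\<dots> \<le> ennreal e"
      using L that by (subst ennreal_mult[symmetric]) (auto intro!: ennreal_leI simp: field_simps)
    finally show ?thesis using V by blast
  qed
  then have "\<forall>n. \<exists>V. V \<in> sets borel \<and> E \<subseteq> V \<and> emeasure lborel V \<le> ennreal (inverse (real (Suc n)))"
    by simp
  then obtain V where V: "\<And>n. V n \<in> sets borel" "\<And>n. E \<subseteq> V n"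
    "\<And>n. emeasure lborel (V n) \<le> ennreal (inverse (real (Suc n)))"
    by metis
  have Vm: "(\<Inter>n. V n) \<in> sets borel" using V(1) by auto
  have "emeasure lborel (\<Inter>n. V n) \<le> ennreal (inverse (real (Suc n)))" for n
    using emeasure_mono[of "\<Inter>n. V n" "V n" lborel] V(1,3)[of n] by (auto intro: order_trans)
  moreover have "(\<lambda>n. ennreal (inverse (real (Suc n)))) \<longlonglongrightarrow> ennreal 0"
    by (intro tendsto_ennrealI LIMSEQ_inverse_real_of_nat)
  ultimately have "emeasure lborel (\<Inter>n. V n) \<le> ennreal 0"
    by (intro LIMSEQ_le_const) auto
  then have "(\<Inter>n. V n) \<in> null_sets lborel"
    using Vm by (auto simp: null_sets_def)
  then have "negligible (\<Inter>n. V n)"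
    using negligible_iff_null_sets null_sets_completionI by blast
  then show ?thesis
    by (rule negligible_subset) (use V(2) in blast)
qed

section \<open>The double of a circle\<close>

text \<open>The length metric of the circle of circumference 1, as the distance of
  \<open>s - t\<close> from the nearest integer.\<close>

definition circ :: "real \<Rightarrow> real \<Rightarrow> real" where
  "circ s t = \<bar>s - t - of_int (round (s - t))\<bar>"

lemma circ_nonneg [simp]: "0 \<le> circ s t"
  by (simp add: circ_def)

lemma circ_le_int: "circ s t \<le> \<bar>s - t - of_int n\<bar>"
  unfolding circ_def using round_diff_minimal[of "s - t" n] by simp

lemma circ_le_abs: "circ s t \<le> \<bar>s - t\<bar>"
  using circ_le_int[of s t 0] by simp

lemma circ_eq_int: "\<exists>n. circ s t = \<bar>s - t - of_int n\<bar>"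
  unfolding circ_def by blast

lemma circ_refl [simp]: "circ s s = 0"
  using circ_le_abs[of s s] circ_nonneg[of s s] by simp

lemma circ_commute: "circ s t = circ t s"
proof -
  have "circ s t \<le> circ t s" for s t
  proof -
    obtain n where "circ t s = \<bar>t - s - of_int n\<bar>" using circ_eq_int by blast
    then show ?thesis using circ_le_int[of s t "- n"] by simp
  qed
  then show ?thesis by (meson antisym)
qed

lemma circ_triangle: "circ s u \<le> circ s t + circ t u"
proof -
  obtain n m where "circ s t = \<bar>s - t - of_int n\<bar>" "circ t u = \<bar>t - u - of_int m\<bar>"
    using circ_eq_int by metis
  then show ?thesis using circ_le_int[of s u "n + m"] by simp
qed

lemma circ_add_int [simp]: "circ (s + of_int n) t = circ s t" "circ s (t + of_int n) = circ s t"
proof -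
  have *: "circ (s + of_int n) t \<le> circ s t" for s t n
  proof -
    obtain m where "circ s t = \<bar>s - t - of_int m\<bar>" using circ_eq_int by blast
    then show ?thesis using circ_le_int[of "s + of_int n" t "m + n"] by simp
  qed
  have **: "circ (s + of_int n) t = circ s t" for s t n
    using *[of s n t] *[of "s + of_int n" "- n" t] by simp
  then show "circ (s + of_int n) t = circ s t" by blast
  show "circ s (t + of_int n) = circ s t"
    using **[of t n s] by (simp add: circ_commute)
qed

lemma circ_le_half: "circ s t \<le> 1 / 2"
  unfolding circ_def using of_int_round_abs_le[of "s - t"] by (simp add: abs_minus_commute)

lemma circ_eq_abs: "\<bar>s - t\<bar> \<le> 1 / 2 \<Longrightarrow> circ s t = \<bar>s - t\<bar>"
proof -
  assume st: "\<bar>s - t\<bar> \<le> 1 / 2"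
  obtain n where n: "circ s t = \<bar>s - t - of_int n\<bar>" using circ_eq_int by blast
  have "\<bar>s - t\<bar> \<le> \<bar>s - t - of_int n\<bar>"
  proof (cases "n = 0")
    case False
    then have "1 \<le> \<bar>of_int n :: real\<bar>" by linarith
    with st show ?thesis by linarith
  qed simp
  with n circ_le_abs[of s t] show ?thesis by simp
qed

lemma circ_eq_0_iff: "circ s t = 0 \<longleftrightarrow> (\<exists>n. s = t + of_int n)"
proof
  assume "circ s t = 0"
  then show "\<exists>n. s = t + of_int n"
    using circ_eq_int[of s t] by (metis abs_eq_0_iff add.commute diff_add_cancel eq_iff_diff_eq_0 diff_diff_eq)
qed auto

lemma circ_lift: "\<exists>n. \<bar>s - (t + of_int n)\<bar> = circ s t"
  using circ_eq_int[of s t] by (metis diff_diff_eq)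

lemma circ_lipschitz: "\<bar>circ s c - circ t c\<bar> \<le> circ s t"
  using circ_triangle[of s c t] circ_triangle[of t c s] circ_commute[of s t] by auto

lemma continuous_circ: "continuous_on UNIV (\<lambda>s. circ s c)"
proof -
  have "1-lipschitz_on UNIV (\<lambda>s. circ s c)"
    by (intro lipschitz_onI) (auto simp: dist_real_def intro: order_trans[OF circ_lipschitz circ_le_abs])
  then show ?thesis by (rule lipschitz_on_continuous_on)
qed

text \<open>The two layers of the double are glued along \<open>junction\<close>. Modulo 1, its complement consists
  of the gaps \<open>(4\<^sup>-\<^sup>k/4, 4\<^sup>-\<^sup>k/2)\<close>, whose ends are the branch points.\<close>

definition junction :: "real set" where
  "junction = - (\<Union>n::int. \<Union>k::nat. {of_int n + (1/4)^Suc k<..<of_int n + 2 * (1/4)^Suc k})"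

lemma closed_junction: "closed junction"
  unfolding junction_def by (intro closed_Compl open_UN ballI open_greaterThanLessThan)

lemma gap_width: "(1/4::real)^Suc k \<le> 1/4" "0 < (1/4::real)^Suc k"
  using power_decreasing[of 1 "Suc k" "1/4 :: real"] by auto

lemma junction_add_int [simp]: "t + of_int n \<in> junction \<longleftrightarrow> t \<in> junction"
proof -
  have *: "t + of_int n \<in> junction" if "t \<in> junction" for t n
  proof (rule ccontr)
    assume "t + of_int n \<notin> junction"
    then obtain m :: int and k where "t + of_int n \<in> {of_int m + (1/4)^Suc k<..<of_int m + 2 * (1/4)^Suc k}"
      by (auto simp: junction_def)
    then have "t \<in> {of_int (m - n) + (1/4)^Suc k<..<of_int (m - n) + 2 * (1/4)^Suc k}" by auto
    then show False using that unfolding junction_def by blast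
  qed
  from *[of t n] *[of "t + of_int n" "- n"] show ?thesis by auto
qed

lemma junctionI:
  assumes t: "0 \<le> t" "t < 1" and k: "\<And>k. t \<le> (1/4)^Suc k \<or> 2 * (1/4)^Suc k \<le> t"
  shows "t \<in> junction"
proof (rule ccontr)
  assume "t \<notin> junction"
  then obtain m :: int and k where mk: "of_int m + (1/4)^Suc k < t" "t < of_int m + 2 * (1/4)^Suc k"
    by (auto simp: junction_def)
  have "of_int m < t" "t < of_int m + 1"
    using mk gap_width[of k] by linarith+
  then have "m = 0" using t by linarith
  with mk k[of k] show False by simp
qed

lemma junction_upper: "1/2 \<le> t \<Longrightarrow> t < 1 \<Longrightarrow> t \<in> junction"
  using gap_width by (intro junctionI) (auto intro: order_trans)

lemma junction_0 [simp]: "0 \<in> junction"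
  by (intro junctionI) auto

lemma junction_int [simp]: "of_int n \<in> junction"
  using junction_add_int[of 0 n] by simp

lemma junction_1 [simp]: "1 \<in> junction" and junction_2 [simp]: "2 \<in> junction"
  using junction_int[of 1] junction_int[of 2] by simp_all

text \<open>The next smaller gap ends at \<open>2 * (1/4)^Suc (Suc k)\<close>, which is the lower
  bound here. The ratio \<open>1/4\<close> thus leaves a glued interval on the left of every
  gap.\<close>

lemma junction_left: "(1/4)^Suc k / 2 < t \<Longrightarrow> t < (1/4)^Suc k \<Longrightarrow> t \<in> junction"
proof (intro junctionI)
  assume t: "(1/4)^Suc k / 2 < t" "t < (1/4)^Suc k"
  show "0 \<le> t" "t < 1" using t gap_width[of k] by linarith+
  fix j
  show "t \<le> (1/4)^Suc j \<or> 2 * (1/4)^Suc j \<le> t"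
  proof (cases "j \<le> k")
    case True
    then have "(1/4::real)^Suc k \<le> (1/4)^Suc j" by (intro power_decreasing) auto
    with t show ?thesis by linarith
  next
    case False
    then have "(1/4::real)^Suc j \<le> (1/4)^Suc (Suc k)" by (intro power_decreasing) auto
    also have "\<dots> = (1/4)^Suc k / 4" by simp
    finally show ?thesis using t by linarith
  qed
qed

lemma not_junction_right: "(1/4)^Suc k < t \<Longrightarrow> t < 2 * (1/4)^Suc k \<Longrightarrow> t \<notin> junction"
  unfolding junction_def by (auto intro!: exI[of _ "0::int"] exI[of _ k])

text \<open>The length of a shortest connection between different layers: it has to pass through
  some glued point \<open>c\<close>.\<close>

definition bridge :: "real \<Rightarrow> real \<Rightarrow> real" where
  "bridge s t = (INF c\<in>junction. circ s c + circ c t)"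

lemma bridge_bdd: "bdd_below ((\<lambda>c. circ s c + circ c t) ` junction)"
  by (intro bdd_belowI[of _ 0]) auto

lemma bridge_le: "c \<in> junction \<Longrightarrow> bridge s t \<le> circ s c + circ c t"
  unfolding bridge_def using bridge_bdd by (rule cINF_lower)

text \<open>By periodicity the glued points in \<open>[0, 1]\<close> suffice, and they form a
  compact set. A minimiser is where a geodesic changes the layer.\<close>

lemma bridge_attained: "\<exists>c\<in>junction. bridge s t = circ s c + circ c t"
proof -
  let ?f = "\<lambda>c. circ s c + circ c t"
  have "compact (junction \<inter> {0..1})"
    using closed_junction by (intro closed_Int_compact) auto
  moreover have "junction \<inter> {0..1} \<noteq> {}" using junction_0 by force
  moreover have "continuous_on (junction \<inter> {0..1}) ?f"
    unfolding circ_commute[of s]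
    by (intro continuous_intros continuous_on_subset[OF continuous_circ]) auto
  ultimately obtain c where c: "c \<in> junction" "\<And>y. y \<in> junction \<inter> {0..1} \<Longrightarrow> ?f c \<le> ?f y"
    using continuous_attains_inf[of "junction \<inter> {0..1}" ?f] by blast
  have "?f c \<le> ?f y" if "y \<in> junction" for y
  proof -
    have eq: "y = frac y + of_int \<lfloor>y\<rfloor>" by (simp add: frac_def)
    have "frac y \<in> junction \<inter> {0..1}"
      using that junction_add_int[of "frac y" "\<lfloor>y\<rfloor>"] frac_lt_1[of y] eq by (auto simp: less_imp_le)
    then have "?f c \<le> ?f (frac y)" by (rule c(2))
    also have "\<dots> = ?f y" by (subst (3 4) eq) (simp only: circ_add_int)
    finally show ?thesis .
  qed
  then have "?f c \<le> bridge s t"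
    unfolding bridge_def using c(1) by (intro cINF_greatest) auto
  with bridge_le[OF c(1)] c(1) show ?thesis by (meson antisym)
qed

lemma circ_le_bridge: "circ s t \<le> bridge s t"
  using bridge_attained[of s t] circ_triangle[of s t] by auto

lemma bridge_commute: "bridge s t = bridge t s"
  unfolding bridge_def by (simp add: circ_commute add.commute)

lemma bridge_junction: "s \<in> junction \<or> t \<in> junction \<Longrightarrow> bridge s t = circ s t"
  using circ_le_bridge[of s t] bridge_le[of s s t] bridge_le[of t s t] by (auto intro: antisym)

lemma bridge_add_int [simp]: "bridge (s + of_int n) t = bridge s t" "bridge s (t + of_int n) = bridge s t"
  unfolding bridge_def by simp_all

text \<open>The distance of the points over \<open>s\<close> and \<open>t\<close> in the layers \<open>i\<close> and \<open>j\<close>.\<close>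

definition ddist :: "bool \<Rightarrow> real \<Rightarrow> bool \<Rightarrow> real \<Rightarrow> real" where
  "ddist i s j t = (if i = j then circ s t else bridge s t)"

lemma ddist_commute: "ddist i s j t = ddist j t i s"
  by (auto simp: ddist_def circ_commute bridge_commute)

lemma circ_le_ddist: "circ s t \<le> ddist i s j t"
  by (simp add: ddist_def circ_le_bridge)

lemma ddist_nonneg [simp]: "0 \<le> ddist i s j t"
  using circ_le_ddist[of s t i j] circ_nonneg[of s t] by linarith

lemma ddist_le_1: "ddist i s j t \<le> 1"
  using bridge_le[OF junction_0, of s t] circ_le_half[of s 0] circ_le_half[of 0 t] circ_le_half[of s t]
  by (auto simp: ddist_def)

lemma ddist_add_int [simp]: "ddist i (s + of_int n) j t = ddist i s j t" "ddist i s j (t + of_int n) = ddist i s j t"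
  by (simp_all add: ddist_def)

lemma ddist_junction: "s \<in> junction \<or> t \<in> junction \<Longrightarrow> ddist i s j t = circ s t"
  by (simp add: ddist_def bridge_junction)

lemma ddist_triangle: "ddist i s k u \<le> ddist i s j t + ddist j t k u"
proof -
  have 1: "bridge s u \<le> circ s t + bridge t u" for s t u
  proof -
    obtain c where "c \<in> junction" "bridge t u = circ t c + circ c u" using bridge_attained by blast
    then show ?thesis using bridge_le[of c s u] circ_triangle[of s c t] by linarith
  qed
  have 2: "bridge s u \<le> bridge s t + circ t u" for s t u
    using 1[of u s t] by (simp add: bridge_commute circ_commute add.commute)
  have 3: "circ s u \<le> bridge s t + bridge t u" for s t u
    using circ_triangle[of s u t] circ_le_bridge[of s t] circ_le_bridge[of t u] by linarith
  show ?thesis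
    using circ_triangle[of s u t] 1[of s u t] 2[of s u t] 3[of s u t]
    by (cases i; cases j; cases k) (simp_all add: ddist_def)
qed

text \<open>A point over \<open>t \<in> [0, 1)\<close> is encoded as \<open>t\<close> in the first layer and as \<open>1 + t\<close> in the second
  one; over \<open>junction\<close> only the first code is used.\<close>

definition double_carrier :: "real set" where
  "double_carrier = {0..<1} \<union> ({1..<2} - junction)"

text \<open>The layer of a code is read off from \<open>1 \<le> x\<close>. The code
  \<open>1 + t\<close> is not shifted back to \<open>t\<close>, because \<open>ddist\<close> is
  1-periodic in both positions.\<close>

definition double_circle :: "real metric" where
  "double_circle = metric (double_carrier, \<lambda>x y. ddist (1 \<le> x) x (1 \<le> y) y)"

lemma ddist_eq_0_iff:
  assumes x: "x \<in> double_carrier" and y: "y \<in> double_carrier"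
  shows "ddist (1 \<le> x) x (1 \<le> y) y = 0 \<longleftrightarrow> x = y"
proof
  assume 0: "ddist (1 \<le> x) x (1 \<le> y) y = 0"
  then have "circ x y = 0"
    using circ_le_ddist[of x y] circ_nonneg[of x y] by (metis antisym)
  then obtain n where n: "x = y + of_int n" by (auto simp: circ_eq_0_iff)
  show "x = y"
  proof (cases "(1 \<le> x) = (1 \<le> y)")
    case True
    then have "\<bar>x - y\<bar> < 1" using x y by (auto simp: double_carrier_def)
    then have "\<bar>of_int n :: real\<bar> < 1" using n by simp
    then have "n = 0" by linarith
    with n show ?thesis by simp
  next
    case False
    \<comment> \<open>Distance zero across layers places both points over \<open>junction\<close>,
      where the second layer has no codes.\<close>
    then have "bridge x y = 0" using 0 by (simp add: ddist_def)
    then obtain c where "c \<in> junction" "circ x c + circ c y = 0" using bridge_attained by metis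
    then have c: "c \<in> junction" "circ x c = 0" "circ c y = 0"
      by (simp_all add: add_nonneg_eq_0_iff)
    then obtain m k where "x = c + of_int m" "c = y + of_int k"
      unfolding circ_eq_0_iff by blast
    then have "x \<in> junction" "y \<in> junction"
      using c(1) by simp_all
    then show ?thesis using False x y by (auto simp: double_carrier_def)
  qed
qed (simp add: ddist_def)

lemma Metric_space_double_circle: "Metric_space double_carrier (\<lambda>x y. ddist (1 \<le> x) x (1 \<le> y) y)"
  by unfold_locales (auto simp: ddist_eq_0_iff intro: ddist_triangle ddist_commute)

lemma mspace_double_circle [simp]: "mspace double_circle = double_carrier"
  and mdist_double_circle: "mdist double_circle x y = ddist (1 \<le> x) x (1 \<le> y) y"
  unfolding double_circle_def
  by (simp_all add: Metric_space.mspace_metric[OF Metric_space_double_circle]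
      Metric_space.mdist_metric[OF Metric_space_double_circle])

text \<open>The code of the point over \<open>t\<close> modulo 1 in layer \<open>i\<close>.
  Admitting every real \<open>t\<close> allows motion along the circle without wrapping around, and
  over \<open>junction\<close> both layers yield the same code.\<close>

definition dpt :: "bool \<Rightarrow> real \<Rightarrow> real" where
  "dpt i t = (if i \<and> t \<notin> junction then 1 + frac t else frac t)"

lemma frac_junction [simp]: "frac t \<in> junction \<longleftrightarrow> t \<in> junction"
  using junction_add_int[of "frac t" "\<lfloor>t\<rfloor>"] by (simp add: frac_def)

lemma dpt_in [simp]: "dpt i t \<in> double_carrier"
  using frac_lt_1[of t] frac_junction[of t] junction_add_int[of "frac t" 1]
  by (auto simp: dpt_def double_carrier_def add.commute)

lemma mdist_dpt: "mdist double_circle (dpt i s) (dpt j t) = ddist i s j t"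
proof -
  have fr: "\<exists>n. dpt i s = s + of_int n" for i s
  proof -
    have "dpt i s = s + of_int (if i \<and> s \<notin> junction then 1 - \<lfloor>s\<rfloor> else - \<lfloor>s\<rfloor>)"
      by (simp add: dpt_def frac_def)
    then show ?thesis by blast
  qed
  have lay: "(1 \<le> dpt i s) = (i \<and> s \<notin> junction)" for i s
    using frac_lt_1[of s] by (auto simp: dpt_def not_le)
  have "ddist a (dpt i s) b (dpt j t) = ddist a s b t" for a b
    using fr[of i s] fr[of j t] by auto
  then have "mdist double_circle (dpt i s) (dpt j t) = ddist (i \<and> s \<notin> junction) s (j \<and> t \<notin> junction) t"
    by (simp add: mdist_double_circle lay)
  also have "\<dots> = ddist i s j t"
    by (cases "s \<in> junction \<or> t \<in> junction") (auto simp: ddist_junction)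
  finally show ?thesis .
qed

lemma dpt_collapse: "x \<in> double_carrier \<Longrightarrow> dpt (1 \<le> x) x = x"
proof -
  assume x: "x \<in> double_carrier"
  have "frac x = (if 1 \<le> x then x - 1 else x)"
    using x by (intro frac_unique_iff[THEN iffD2]) (auto simp: double_carrier_def)
  then show ?thesis using x by (auto simp: dpt_def double_carrier_def)
qed

lemma dpt_add_int [simp]: "dpt i (t + of_int n) = dpt i t"
  by (simp add: dpt_def frac_def)

lemma dpt_junction: "t \<in> junction \<Longrightarrow> dpt i t = dpt j t"
  by (simp add: dpt_def)

lemma mdist_dpt_le: "mdist double_circle (dpt i s) (dpt i t) \<le> \<bar>s - t\<bar>"
  using circ_le_abs by (simp add: mdist_dpt ddist_def)

lemma double_circle_cases:
  assumes "x \<in> double_carrier"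
  obtains i t where "x = dpt i t"
  using dpt_collapse[OF assms] by metis

section \<open>Geodesics, doubling and Ahlfors regularity of the double\<close>

lemma dpt_geodesic_step:
  "\<exists>t'. dpt i t' = dpt i t \<and> \<bar>s - t'\<bar> = circ s t"
  using circ_lift[of s t] dpt_add_int by blast

text \<open>1-Lipschitz paths of duration \<open>L\<close> are easier to concatenate than geodesics,
  and such a path is a geodesic as soon as its duration equals the distance of its ends.\<close>

definition lpath :: "real \<Rightarrow> real \<Rightarrow> real \<Rightarrow> bool" where
  "lpath L x y \<longleftrightarrow> 0 \<le> L \<and> (\<exists>\<sigma>. \<sigma> ` {0..L} \<subseteq> double_carrier \<and> \<sigma> 0 = x \<and> \<sigma> L = y \<and>
     (\<forall>s\<in>{0..L}. \<forall>t\<in>{0..L}. mdist double_circle (\<sigma> s) (\<sigma> t) \<le> \<bar>s - t\<bar>))"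

lemma lpath_layer: "lpath (circ s t) (dpt i s) (dpt i t)"
proof -
  obtain t' where t': "dpt i t' = dpt i t" "\<bar>s - t'\<bar> = circ s t"
    using dpt_geodesic_step by blast
  define e where "e = (if s \<le> t' then 1 else - 1 :: real)"
  have "mdist double_circle (dpt i (s + e * u)) (dpt i (s + e * v)) \<le> \<bar>u - v\<bar>" for u v
    using mdist_dpt_le[of i "s + e * u" "s + e * v"] by (simp add: e_def split: if_splits)
  moreover have "s + e * circ s t = t'"
    unfolding t'(2)[symmetric] by (simp add: e_def)
  ultimately show ?thesis
    unfolding lpath_def using t'(1) by (intro conjI exI[of _ "\<lambda>u. dpt i (s + e * u)"]) auto
qed

lemma lpath_trans:
  assumes "lpath L x y" "lpath M y z"
  shows "lpath (L + M) x z"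
proof -
  let ?d = "mdist double_circle"
  obtain \<sigma> where L: "0 \<le> L" and \<sigma>: "\<sigma> ` {0..L} \<subseteq> double_carrier" "\<sigma> 0 = x" "\<sigma> L = y"
    "\<And>s t. s \<in> {0..L} \<Longrightarrow> t \<in> {0..L} \<Longrightarrow> ?d (\<sigma> s) (\<sigma> t) \<le> \<bar>s - t\<bar>"
    using assms(1) unfolding lpath_def by blast
  obtain \<tau> where M: "0 \<le> M" and \<tau>: "\<tau> ` {0..M} \<subseteq> double_carrier" "\<tau> 0 = y" "\<tau> M = z"
    "\<And>s t. s \<in> {0..M} \<Longrightarrow> t \<in> {0..M} \<Longrightarrow> ?d (\<tau> s) (\<tau> t) \<le> \<bar>s - t\<bar>"
    using assms(2) unfolding lpath_def by blast
  define \<rho> where "\<rho> u = (if u \<le> L then \<sigma> u else \<tau> (u - L))" for u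
  have in_c: "\<rho> u \<in> double_carrier" if "u \<in> {0..L+M}" for u
    using \<sigma>(1) \<tau>(1) that by (auto simp: \<rho>_def image_subset_iff)
  have across: "?d (\<rho> u) (\<rho> v) \<le> v - u" if "u \<in> {0..L+M}" "v \<in> {0..L+M}" "u \<le> v" for u v
  proof -
    consider "v \<le> L" | "L < u" | "u \<le> L" "L < v" using that by linarith
    then show ?thesis
    proof cases
      case 1
      then show ?thesis using \<sigma>(4)[of u v] that by (simp add: \<rho>_def)
    next
      case 2
      then show ?thesis using \<tau>(4)[of "u - L" "v - L"] that by (simp add: \<rho>_def)
    next
      case 3
      have "?d (\<sigma> u) (\<tau> (v - L)) \<le> ?d (\<sigma> u) y + ?d y (\<tau> (v - L))"
        using in_c[OF that(1)] in_c[OF that(2)] \<sigma>(1,3) L 3 by (intro mdist_triangle) (auto simp: \<rho>_def)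
      also have "?d (\<sigma> u) y \<le> L - u" using \<sigma>(4)[of u L] \<sigma>(3) 3 L that by simp
      also have "?d y (\<tau> (v - L)) \<le> v - L" using \<tau>(4)[of 0 "v - L"] \<tau>(2) 3 M that by simp
      finally show ?thesis using 3 by (simp add: \<rho>_def)
    qed
  qed
  have "?d (\<rho> u) (\<rho> v) \<le> \<bar>u - v\<bar>" if "u \<in> {0..L+M}" "v \<in> {0..L+M}" for u v
    using across[OF that] across[OF that(2,1)] mdist_commute[of double_circle "\<rho> u" "\<rho> v"] by (cases "u \<le> v") auto
  moreover have "\<rho> 0 = x" using \<sigma>(2) L by (simp add: \<rho>_def)
  moreover have "\<rho> (L + M) = z"
    using \<tau>(2,3) \<sigma>(3) M by (auto simp: \<rho>_def)
  ultimately show ?thesis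
    unfolding lpath_def using in_c L M by (intro conjI exI[of _ \<rho>]) auto
qed

lemma geodesic_double_circle: "geodesic_metric double_circle"
  unfolding geodesic_metric_def mspace_double_circle
proof (intro ballI)
  fix x y assume x: "x \<in> double_carrier" and y: "y \<in> double_carrier"
  let ?d = "mdist double_circle" and ?D = "mdist double_circle x y"
  obtain i s where xs: "x = dpt i s" using double_circle_cases[OF x] .
  obtain j t where yt: "y = dpt j t" using double_circle_cases[OF y] .
  have "lpath ?D x y"
  proof (cases "i = j")
    case True
    then show ?thesis using lpath_layer[of s t i] by (simp add: xs yt mdist_dpt ddist_def)
  next
    case False
    obtain c where c: "c \<in> junction" "bridge s t = circ s c + circ c t" using bridge_attained by blast
    have "lpath (circ s c + circ c t) (dpt i s) (dpt j t)"
      using lpath_trans[OF lpath_layer[of s c i]] lpath_layer[of c t j] dpt_junction[OF c(1), of i j] by simp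
    then show ?thesis using False c by (simp add: xs yt mdist_dpt ddist_def)
  qed
  then obtain \<sigma> where \<sigma>: "\<sigma> ` {0..?D} \<subseteq> double_carrier" "\<sigma> 0 = x" "\<sigma> ?D = y"
    "\<And>s t. s \<in> {0..?D} \<Longrightarrow> t \<in> {0..?D} \<Longrightarrow> ?d (\<sigma> s) (\<sigma> t) \<le> \<bar>s - t\<bar>"
    unfolding lpath_def by blast
  have D0: "0 \<le> ?D" by simp
  \<comment> \<open>A path that lost length between \<open>u\<close> and \<open>v\<close> would, by
    the triangle inequality, bring \<open>x\<close> and \<open>y\<close> closer together than
    \<open>?D\<close>.\<close>
  have ge: "v - u \<le> ?d (\<sigma> u) (\<sigma> v)" if uv: "u \<in> {0..?D}" "v \<in> {0..?D}" "u \<le> v" for u v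
  proof -
    have "\<sigma> u \<in> double_carrier" "\<sigma> v \<in> double_carrier" using \<sigma>(1) uv by auto
    then have "?D \<le> ?d x (\<sigma> u) + ?d (\<sigma> u) (\<sigma> v) + ?d (\<sigma> v) y"
      using mdist_triangle[of x double_circle "\<sigma> u" y] mdist_triangle[of "\<sigma> u" double_circle "\<sigma> v" y] x y by simp
    moreover have "?d x (\<sigma> u) \<le> u" using \<sigma>(4)[of 0 u] \<sigma>(2) uv by simp
    moreover have "?d (\<sigma> v) y \<le> ?D - v" using \<sigma>(4)[of v ?D] \<sigma>(3) uv D0 by simp
    ultimately show ?thesis by linarith
  qed
  have "?d (\<sigma> u) (\<sigma> v) = \<bar>u - v\<bar>" if uv: "u \<in> {0..?D}" "v \<in> {0..?D}" for u v
    using ge[OF uv] ge[OF uv(2,1)] \<sigma>(4)[OF uv] mdist_commute[of double_circle "\<sigma> u" "\<sigma> v"] by (cases "u \<le> v") auto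
  then show "\<exists>\<gamma>. \<gamma> ` {0..?D} \<subseteq> double_carrier \<and> \<gamma> 0 = x \<and> \<gamma> ?D = y \<and>
      (\<forall>s\<in>{0..?D}. \<forall>t\<in>{0..?D}. ?d (\<gamma> s) (\<gamma> t) = \<bar>s - t\<bar>)"
    using \<sigma>(1-3) by (intro exI[of _ \<sigma>]) simp
qed

text \<open>Projection to the circle does not increase distances, so a ball lies in the two lifts of
  an arc. Doubling and the upper Ahlfors bound follow from this.\<close>

lemma ball_double_circle:
  assumes "y \<in> mball_of double_circle (dpt i s) r"
  obtains j t where "y = dpt j t" "\<bar>s - t\<bar> < r"
proof -
  obtain j t where yt: "y = dpt j t" using double_circle_cases[of y] assms by auto
  obtain t' where t': "dpt j t' = dpt j t" "\<bar>s - t'\<bar> = circ s t"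
    using dpt_geodesic_step by blast
  have "circ s t < r"
    using assms circ_le_ddist[of s t i j] by (simp add: yt mdist_dpt)
  with t' yt that[of j t'] show ?thesis by simp
qed

lemma doubling_double_circle: "doubling_metric double_circle"
  unfolding doubling_metric_def mspace_double_circle
proof (intro exI[of _ 18] ballI allI impI)
  fix x r :: real assume x: "x \<in> double_carrier" and r: "r > 0"
  obtain i s where xs: "x = dpt i s" using double_circle_cases[OF x] .
  \<comment> \<open>Two layers times the nine multiples of \<open>r / 4\<close> from
    \<open>- 4\<close> to \<open>4\<close> account for the bound 18; rounding a position down to
    such a multiple moves it by less than \<open>r / 4\<close>.\<close>
  define F where "F = (\<lambda>(j, m). dpt j (s + of_int m * (r / 4))) ` (UNIV \<times> {-4..4::int})"
  have "finite F" by (simp add: F_def)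
  moreover have "card F \<le> 18"
  proof -
    have "card F \<le> card ((UNIV :: bool set) \<times> {-4..4::int})"
      unfolding F_def by (rule card_image_le) simp
    then show ?thesis by (simp add: card_cartesian_product)
  qed
  moreover have "F \<subseteq> double_carrier" by (auto simp: F_def)
  moreover have "mball_of double_circle x r \<subseteq> (\<Union>y\<in>F. mball_of double_circle y (r / 2))"
  proof
    fix y assume "y \<in> mball_of double_circle x r"
    then obtain j t where y: "y = dpt j t" "\<bar>s - t\<bar> < r" unfolding xs by (rule ball_double_circle)
    define m where "m = \<lfloor>(t - s) / (r / 4)\<rfloor>"
    have "of_int m \<le> (t - s) / (r / 4)" "(t - s) / (r / 4) < of_int m + 1"
      unfolding m_def by linarith+
    then have m: "of_int m * (r / 4) \<le> t - s" "t - s < of_int m * (r / 4) + r / 4"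
      using r by (auto simp: field_simps)
    have "-5 < (of_int m :: real)" "(of_int m :: real) \<le> 4"
    proof -
      have "of_int m * (r/4) < 4 * (r / 4)" "-5 * (r/4) < of_int m * (r/4)" using m y(2) by linarith+
      then show "-5 < (of_int m :: real)" "(of_int m :: real) \<le> 4"
        using mult_right_less_imp_less[of "-5" "r/4" "of_int m"] mult_right_less_imp_less[of "of_int m" "r/4" 4] r
        by linarith+
    qed
    then have "m \<in> {-4..4}" by auto
    then have "dpt j (s + of_int m * (r / 4)) \<in> F" unfolding F_def by (intro image_eqI[of _ _ "(j, m)"]) auto
    moreover have "mdist double_circle (dpt j (s + of_int m * (r / 4))) y < r / 2"
      using mdist_dpt_le[of j "s + of_int m * (r / 4)" t] m r y(1) by auto
    ultimately show "y \<in> (\<Union>y\<in>F. mball_of double_circle y (r / 2))"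
      using y(1) by (intro UN_I) auto
  qed
  ultimately show "\<exists>F. finite F \<and> card F \<le> 18 \<and> F \<subseteq> double_carrier \<and>
      mball_of double_circle x r \<subseteq> (\<Union>y\<in>F. mball_of double_circle y (r / 2))"
    by blast
qed

lemma ahlfors_double_circle: "ahlfors_regular 1 double_circle"
  unfolding ahlfors_regular_def mspace_double_circle
\<comment> \<open>The constant comes from the upper bound: two layers, each with an arc of length
  \<open>2 * r\<close>. Below, the ball contains an isometric copy of an interval of length
  \<open>r / 2\<close>; isometric because \<open>r / 2 \<le> 1 / 2\<close>.\<close>
proof (intro exI[of _ 4] conjI ballI allI impI)
  fix x r :: real assume x: "x \<in> double_carrier" and r: "r > 0"
    and diam: "ennreal r \<le> metric_diam double_circle double_carrier"
  obtain i s where xs: "x = dpt i s" using double_circle_cases[OF x] .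
  have "metric_diam double_circle double_carrier \<le> ennreal 1"
    by (rule metric_diam_least) (simp add: mdist_double_circle ddist_le_1)
  with diam have "ennreal r \<le> ennreal 1" by (rule order_trans)
  then have "r \<le> 1" by (simp del: ennreal_1)
  show "ennreal (r ^ 1 / 4) \<le> hausdorff 1 double_circle (mball_of double_circle x r)"
  proof -
    have "ennreal (r / 4) \<le> emeasure lborel {s..<s + r / 2}"
      using r by (simp add: ennreal_leI)
    also have "\<dots> \<le> hausdorff 1 double_circle (mball_of double_circle x r)"
    proof (rule emeasure_le_hausdorff)
      fix u v assume "u \<in> {s..<s + r / 2}" "v \<in> {s..<s + r / 2}"
      then have "\<bar>u - v\<bar> \<le> 1 / 2" using \<open>r \<le> 1\<close> unfolding atLeastLessThan_iff by linarith
      then show "\<bar>u - v\<bar> \<le> mdist double_circle (dpt i u) (dpt i v)"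
        by (simp add: mdist_dpt ddist_def circ_eq_abs)
    next
      show "dpt i ` {s..<s + r / 2} \<subseteq> mball_of double_circle x r"
      proof
        fix y assume "y \<in> dpt i ` {s..<s + r / 2}"
        then obtain u where u: "y = dpt i u" "u \<in> {s..<s + r / 2}" by blast
        then show "y \<in> mball_of double_circle x r"
          using mdist_dpt_le[of i s u] r by (auto simp: xs)
      qed
    qed simp
    finally show ?thesis by simp
  qed
  have "hausdorff 1 double_circle (mball_of double_circle x r) \<le> ennreal (real 2 * (s + r - (s - r)))"
  proof (rule hausdorff_lipschitz_images_le)
    let ?g = "\<lambda>j t. dpt (j = (1::nat)) t"
    show "mball_of double_circle x r \<subseteq> (\<Union>j<2. ?g j ` {s - r..s + r})"
    proof
      fix y assume "y \<in> mball_of double_circle x r"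
      then obtain j t where y: "y = dpt j t" "\<bar>s - t\<bar> < r" unfolding xs by (rule ball_double_circle)
      have "y = ?g (if j then 1 else 0) t" using y by simp
      moreover have "t \<in> {s - r..s + r}" using y(2) by auto
      ultimately have "y \<in> ?g (if j then 1 else 0) ` {s - r..s + r}" by blast
      then show "y \<in> (\<Union>j<2. ?g j ` {s - r..s + r})"
        by (rule UN_I[rotated]) simp
    qed
  qed (use r mdist_dpt_le in auto)
  then show "hausdorff 1 double_circle (mball_of double_circle x r) \<le> ennreal (4 * r ^ 1)" by simp
qed simp

section \<open>The cycle that runs once through each layer\<close>

text \<open>The first layer is traversed during \<open>[0, 1]\<close>, the second during
  \<open>[1, 2]\<close>, in the same direction. Over \<open>junction\<close> the two passages
  therefore add up instead of cancelling.\<close>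

definition double_curve :: "real \<Rightarrow> real" where
  "double_curve t = dpt (1 \<le> t) t"

interpretation double: lipschitz_curve double_circle double_curve 2
proof
  show "double_curve t \<in> mspace double_circle" for t by (simp add: double_curve_def)
  have *: "mdist double_circle (double_curve s) (double_curve t) \<le> t - s" if "s \<le> t" for s t
  proof (cases "(1 \<le> s) = (1 \<le> t)")
    case True
    then show ?thesis using mdist_dpt_le[of "1 \<le> t" s t] that by (simp add: double_curve_def)
  next
    case False
    then have st: "s < 1" "1 \<le> t" using that by auto
    have "mdist double_circle (double_curve s) (double_curve t) = bridge s t"
      using False by (simp add: double_curve_def mdist_dpt ddist_def)
    \<comment> \<open>The layer changes at time \<open>1\<close>, which lies over a glued
      point.\<close>
    also have "\<dots> \<le> circ s 1 + circ 1 t" by (rule bridge_le) simp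
    also have "\<dots> \<le> \<bar>s - 1\<bar> + \<bar>1 - t\<bar>" by (intro add_mono circ_le_abs)
    finally show ?thesis using st by simp
  qed
  show "mdist double_circle (double_curve s) (double_curve t) \<le> \<bar>s - t\<bar>" for s t
    using *[of s t] *[of t s] mdist_commute[of double_circle "double_curve s" "double_curve t"]
    by (cases "s \<le> t") auto
qed simp

text \<open>The code of a point is itself a time at which the curve visits the point, so
  surjectivity and density need no inverse parametrisation.\<close>

lemma double_curve_collapse: "x \<in> double_carrier \<Longrightarrow> double_curve x = x"
  unfolding double_curve_def by (rule dpt_collapse)

lemma double_carrier_eq_image: "double_carrier = double_curve ` {0..2}"
proof
  show "double_carrier \<subseteq> double_curve ` {0..2}"
  proof
    fix x assume x: "x \<in> double_carrier"
    then show "x \<in> double_curve ` {0..2}"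
      by (intro image_eqI[of _ _ x]) (auto simp: double_curve_collapse double_carrier_def)
  qed
qed (auto simp: double_curve_def)

lemma compact_double_circle: "compact_space (mtopology_of double_circle)"
proof -
  have "compactin (mtopology_of double_circle) (double_curve ` {0..2})"
    using double.continuous_curve by (intro image_compactin) (auto simp: compactin_euclidean_iff)
  then show ?thesis by (simp add: compact_space_def double_carrier_eq_image)
qed

abbreviation double_current :: "real functional" where
  "double_current \<equiv> curve_current double_curve 2"

lemma circ_curve_le: "circ s t \<le> mdist double_circle (double_curve s) (double_curve t)"
  by (simp add: double_curve_def mdist_dpt circ_le_ddist)

lemma circ_lipschitz_fun: "lipschitz_fun double_circle (\<lambda>x. circ x c)" "lip_const double_circle (\<lambda>x. circ x c) \<le> 1"
proof -
  have *: "\<bar>circ x c - circ y c\<bar> \<le> mdist double_circle x y" for x y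
    using circ_lipschitz[of x c y] circ_le_ddist[of x y "1 \<le> x" "1 \<le> y"] by (simp add: mdist_double_circle)
  show "lipschitz_fun double_circle (\<lambda>x. circ x c)"
    unfolding lipschitz_fun_iff using * by (intro exI[of _ 1]) auto
  show "lip_const double_circle (\<lambda>x. circ x c) \<le> 1"
    using * by (intro lip_const_least) auto
qed

lemma circ_double_curve: "circ (double_curve t) c = circ t c"
proof -
  have "double_curve t = t + of_int (if 1 \<le> t \<and> t \<notin> junction then 1 - \<lfloor>t\<rfloor> else - \<lfloor>t\<rfloor>)"
    by (simp add: double_curve_def dpt_def frac_def)
  then show ?thesis by (metis circ_add_int(1))
qed

text \<open>The quarter point is the middle of the half circle over \<open>(0, 1/2)\<close>.
  Distance from it separates, by a continuous function, the half on which the fold increases from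
  the half on which it decreases.\<close>

lemma circ_quarter_less_iff: "circ t (1/4) < 1/4 \<longleftrightarrow> (\<exists>n. of_int n < t \<and> t < of_int n + 1/2)"
proof
  assume "circ t (1/4) < 1/4"
  moreover obtain n where "circ t (1/4) = \<bar>t - 1/4 - of_int n\<bar>" using circ_eq_int by blast
  ultimately show "\<exists>n. of_int n < t \<and> t < of_int n + 1/2" by (intro exI[of _ n]) linarith
next
  assume "\<exists>n. of_int n < t \<and> t < of_int n + 1/2"
  then obtain n where "of_int n < t" "t < of_int n + 1/2" by blast
  then show "circ t (1/4) < 1/4" using circ_le_int[of t "1/4" n] by linarith
qed

lemma circ_quarter_greater_iff: "1/4 < circ t (1/4) \<longleftrightarrow> (\<exists>n. of_int n + 1/2 < t \<and> t < of_int n + 1)"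
proof
  assume a: "1/4 < circ t (1/4)"
  have "of_int \<lfloor>t\<rfloor> + 1/2 < t \<and> t < of_int \<lfloor>t\<rfloor> + 1"
    using a circ_le_int[of t "1/4" "\<lfloor>t\<rfloor>"] floor_correct[of t] by linarith
  then show "\<exists>n. of_int n + 1/2 < t \<and> t < of_int n + 1" by blast
next
  assume "\<exists>n. of_int n + 1/2 < t \<and> t < of_int n + 1"
  then obtain n where n: "of_int n + 1/2 < t" "t < of_int n + 1" by blast
  obtain m where m: "circ t (1/4) = \<bar>t - 1/4 - of_int m\<bar>" using circ_eq_int by blast
  have "m \<le> n \<or> n + 1 \<le> m" by linarith
  then have "(of_int m :: real) \<le> of_int n \<or> (of_int n :: real) + 1 \<le> of_int m"
    by (metis of_int_1 of_int_add of_int_le_iff)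
  with n m show "1/4 < circ t (1/4)" by linarith
qed

lemma circ_zero_eq: "of_int n \<le> t \<Longrightarrow> t \<le> of_int n + 1/2 \<Longrightarrow> circ t 0 = t - of_int n"
  "of_int n + 1/2 \<le> t \<Longrightarrow> t \<le> of_int n + 1 \<Longrightarrow> circ t 0 = of_int n + 1 - t"
proof -
  assume "of_int n \<le> t" "t \<le> of_int n + 1/2"
  then show "circ t 0 = t - of_int n"
    using circ_add_int(1)[of "t - of_int n" n 0] circ_eq_abs[of "t - of_int n" 0] by simp
next
  assume "of_int n + 1/2 \<le> t" "t \<le> of_int n + 1"
  then show "circ t 0 = of_int n + 1 - t"
    using circ_add_int(1)[of "t - of_int n - 1" "n + 1" 0] circ_eq_abs[of "t - of_int n - 1" 0] by simp
qed

lemma deriv_circ_zero: "circ t (1/4) < 1/4 \<Longrightarrow> deriv (\<lambda>t. circ t 0) t = 1"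
  "1/4 < circ t (1/4) \<Longrightarrow> deriv (\<lambda>t. circ t 0) t = - 1"
proof -
  assume "circ t (1/4) < 1/4"
  then obtain n where n: "of_int n < t" "t < of_int n + 1/2" unfolding circ_quarter_less_iff by blast
  have "((\<lambda>t. circ t 0) has_field_derivative 1) (at t)"
  proof (rule has_field_derivative_transform_within_open[where S="{of_int n<..<of_int n + 1/2}"])
    show "((\<lambda>t. t - of_int n) has_field_derivative 1) (at t)" by (auto intro!: derivative_eq_intros)
  qed (use n circ_zero_eq(1)[of n] in auto)
  then show "deriv (\<lambda>t. circ t 0) t = 1" by (rule DERIV_imp_deriv)
next
  assume "1/4 < circ t (1/4)"
  then obtain n where n: "of_int n + 1/2 < t" "t < of_int n + 1" unfolding circ_quarter_greater_iff by blast
  have "((\<lambda>t. circ t 0) has_field_derivative - 1) (at t)"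
  proof (rule has_field_derivative_transform_within_open[where S="{of_int n + 1/2<..<of_int n + 1}"])
    show "((\<lambda>t. of_int n + 1 - t) has_field_derivative - 1) (at t)" by (auto intro!: derivative_eq_intros)
  qed (use n circ_zero_eq(2)[of n] in auto)
  then show "deriv (\<lambda>t. circ t 0) t = - 1" by (rule DERIV_imp_deriv)
qed

lemma circ_quarter_eq_null: "AE t in lborel. circ t (1/4) \<noteq> 1/4"
proof -
  have "countable (range (\<lambda>n::int. of_int n / 2 :: real))" by simp
  then have "range (\<lambda>n::int. of_int n / 2 :: real) \<in> null_sets lborel"
    by (rule countable_imp_null_set_lborel)
  then have "AE t in lborel. t \<notin> range (\<lambda>n::int. of_int n / 2 :: real)" by (rule AE_not_in)
  then show ?thesis
  proof eventually_elim
    case (elim t)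
    show ?case
    proof
      assume "circ t (1/4) = 1/4"
      then obtain n where "\<bar>t - 1/4 - of_int n\<bar> = 1/4" using circ_eq_int by metis
      then have "t = of_int (2 * n) / 2 \<or> t = of_int (2 * n + 1) / 2" by (auto simp: abs_if split: if_splits)
      with elim show False by blast
    qed
  qed
qed

text \<open>Along both passages the fold \<open>circ x 0\<close> has derivative \<open>1\<close>
  over one open half circle and \<open>- 1\<close> over the other. The mass is bounded from below
  over each half separately; the points that remain are visited at a null set of times.\<close>

interpretation double: filling_curve double_circle double_curve 2
proof
  let ?\<mu> = "curve_measure double_circle double_curve 2"
  show "mass_measure 1 double_circle double_current = ?\<mu>"
  proof (rule mass_measure_eqI[OF double.mass_bound_curve])
    fix \<nu> V assume \<nu>: "mass_bound 1 double_circle double_current \<nu>" and V: "openin (mtopology_of double_circle) V"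
    have sets: "sets \<nu> = sets (metric_borel double_circle)" using \<nu> by (simp add: mass_bound_def)
    have cont: "continuous_map (mtopology_of double_circle) euclideanreal (\<lambda>x. circ x (1/4))"
      using Lipschitz_continuous_imp_continuous_map[OF circ_lipschitz_fun(1)] by simp
    define V1 where "V1 = V \<inter> {x \<in> double_carrier. circ x (1/4) < 1/4}"
    define V2 where "V2 = V \<inter> {x \<in> double_carrier. 1/4 < circ x (1/4)}"
    have V1: "openin (mtopology_of double_circle) V1"
      using openin_Int[OF V openin_continuous_map_preimage[OF cont, of "{..<1/4}"]] by (simp add: V1_def)
    have V2: "openin (mtopology_of double_circle) V2"
      using openin_Int[OF V openin_continuous_map_preimage[OF cont, of "{1/4<..}"]] by (simp add: V2_def)
    note meas = openin_in_metric_borel[OF V] openin_in_metric_borel[OF V1] openin_in_metric_borel[OF V2]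
    have comp: "(\<lambda>x. circ x 0) \<circ> double_curve = (\<lambda>t. circ t 0)"
      by (simp add: comp_def circ_double_curve)
    have le1: "emeasure ?\<mu> V1 \<le> emeasure \<nu> V1"
    proof (rule double.curve_measure_le_mass_bound[OF V1 \<nu> circ_lipschitz_fun, of 1 0])
      show "AE t in lborel. t \<in> {0..2} \<longrightarrow> double_curve t \<in> V1 \<longrightarrow> deriv ((\<lambda>x. circ x 0) \<circ> double_curve) t = 1"
        unfolding comp by (intro AE_I2) (auto simp: V1_def circ_double_curve deriv_circ_zero)
    qed simp
    have le2: "emeasure ?\<mu> V2 \<le> emeasure \<nu> V2"
    proof (rule double.curve_measure_le_mass_bound[OF V2 \<nu> circ_lipschitz_fun, of "- 1" 0])
      show "AE t in lborel. t \<in> {0..2} \<longrightarrow> double_curve t \<in> V2 \<longrightarrow> deriv ((\<lambda>x. circ x 0) \<circ> double_curve) t = - 1"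
        unfolding comp by (intro AE_I2) (auto simp: V2_def circ_double_curve deriv_circ_zero)
    qed simp
    have "emeasure ?\<mu> V = emeasure lborel (double_curve -` V \<inter> {0..2})"
      using meas(1) by (rule double.emeasure_curve_measure)
    also have "\<dots> = emeasure lborel (double_curve -` (V1 \<union> V2) \<inter> {0..2})"
    proof (rule emeasure_eq_AE)
      show "AE t in lborel. (t \<in> double_curve -` V \<inter> {0..2}) = (t \<in> double_curve -` (V1 \<union> V2) \<inter> {0..2})"
        using circ_quarter_eq_null
      proof eventually_elim
        case (elim t)
        then have "circ (double_curve t) (1/4) < 1/4 \<or> 1/4 < circ (double_curve t) (1/4)"
          by (simp add: circ_double_curve) linarith
        then show ?case by (auto simp: V1_def V2_def double_curve_def)
      qed
    qed (use double.open_curve_vimage[OF V] double.open_curve_vimage[OF openin_Un[OF V1 V2]] in auto)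
    also have "\<dots> = emeasure ?\<mu> (V1 \<union> V2)"
      using meas by (intro double.emeasure_curve_measure[symmetric]) auto
    also have "\<dots> = emeasure ?\<mu> V1 + emeasure ?\<mu> V2"
      using meas by (intro plus_emeasure[symmetric]) (auto simp: V1_def V2_def)
    also have "\<dots> \<le> emeasure \<nu> V1 + emeasure \<nu> V2" by (intro add_mono le1 le2)
    also have "\<dots> = emeasure \<nu> (V1 \<union> V2)"
      using meas sets by (intro plus_emeasure) (auto simp: V1_def V2_def)
    also have "\<dots> \<le> emeasure \<nu> V"
      using meas sets by (intro emeasure_mono) (auto simp: V1_def V2_def)
    finally show "emeasure ?\<mu> V \<le> emeasure \<nu> V" .
  qed
  show "emeasure ?\<mu> N = 0" if N: "N \<in> sets (metric_borel double_circle)" and N0: "hausdorff 1 double_circle N = 0" for N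
  proof -
    have vm: "double_curve -` N \<in> sets borel"
      using measurable_sets[OF double.measurable_curve N] by simp
    \<comment> \<open>During a time of length \<open>1/2\<close> the curve does not decrease
      distances, even across the change of layers at \<open>1\<close>, because the metric dominates
      the circle distance. Four such intervals make up \<open>{0..2}\<close>.\<close>
    define E where "E k = double_curve -` N \<inter> {real k / 2..real (Suc k) / 2}" for k
    have "E k \<in> null_sets lborel" if "k < 4" for k
    proof -
      have Em: "E k \<in> sets borel" using vm by (simp add: E_def)
      have "emeasure lborel (E k) \<le> hausdorff 1 double_circle N"
      proof (rule emeasure_le_hausdorff[OF Em])
        fix s t assume "s \<in> E k" "t \<in> E k"
        then have "real k / 2 \<le> s" "s \<le> real k / 2 + 1/2" "real k / 2 \<le> t" "t \<le> real k / 2 + 1/2"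
          by (auto simp: E_def add_divide_distrib)
        then have "\<bar>s - t\<bar> \<le> 1/2" by linarith
        then show "\<bar>s - t\<bar> \<le> mdist double_circle (double_curve s) (double_curve t)"
          using circ_curve_le[of s t] by (simp add: circ_eq_abs)
      qed (auto simp: E_def)
      then show ?thesis using N0 Em by (simp add: null_sets_def)
    qed
    then have U: "(\<Union>k\<in>{..<4}. E k) \<in> null_sets lborel" by (intro null_sets_UN') auto
    have "double_curve -` N \<inter> {0..2} \<subseteq> (\<Union>k\<in>{..<4}. E k)"
    proof
      fix t assume t: "t \<in> double_curve -` N \<inter> {0..2}"
      then consider "t \<le> 1/2" | "1/2 \<le> t" "t \<le> 1" | "1 \<le> t" "t \<le> 3/2" | "3/2 \<le> t" by linarith
      then have "t \<in> E 0 \<or> t \<in> E 1 \<or> t \<in> E 2 \<or> t \<in> E 3"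
        using t by cases (auto simp: E_def)
      then show "t \<in> (\<Union>k\<in>{..<4}. E k)" by auto
    qed
    then have "double_curve -` N \<inter> {0..2} \<in> null_sets lborel"
      using vm by (intro null_sets_subset[OF U]) auto
    then show ?thesis using N by (simp add: double.emeasure_curve_measure null_sets_def)
  qed
  show "mspace double_circle \<subseteq> range double_curve"
    unfolding mspace_double_circle double_carrier_eq_image by blast
  show "double_curve 2 = double_curve 0"
    by (simp add: double_curve_def dpt_def frac_def)
qed

lemma current_set_double_current: "current_set 1 double_circle double_current = mspace double_circle"
proof -
  have "0 < Liminf (at_right 0) (\<lambda>r. emeasure (mass_measure 1 double_circle double_current)
      (mball_of double_circle x r) / ennreal (unit_ball_vol (real 1) * r ^ 1))"
    if x: "x \<in> double_carrier" for x
  proof -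
    have x2: "0 \<le> x" "x < 2" using x by (auto simp: double_carrier_def)
    \<comment> \<open>From time \<open>x\<close> on the curve stays in the ball for a duration
      \<open>r\<close>, and it is still running if \<open>r < 2 - x\<close>. Division by the length
      \<open>2 * r\<close> of the Euclidean 1-ball gives \<open>1 / 2\<close>.\<close>
    have "ennreal (1 / 2) \<le> Liminf (at_right 0) (\<lambda>r. emeasure (mass_measure 1 double_circle double_current)
      (mball_of double_circle x r) / ennreal (unit_ball_vol (real 1) * r ^ 1))"
    proof (rule Liminf_bounded)
      have "\<forall>\<^sub>F r in at_right 0. 0 < r \<and> r < 2 - x"
        using x2 eventually_at_right_real[of 0 "2 - x"] by (auto elim: eventually_mono)
      then show "\<forall>\<^sub>F r in at_right 0. ennreal (1 / 2) \<le> emeasure (mass_measure 1 double_circle double_current)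
        (mball_of double_circle x r) / ennreal (unit_ball_vol (real 1) * r ^ 1)"
      proof eventually_elim
        case (elim r)
        have "openin (mtopology_of double_circle) (mball_of double_circle x r)"
          unfolding mball_of_def mtopology_of_def by (rule Metric_space.openin_mball[OF Metric_space_mspace_mdist])
        note ball = openin_in_metric_borel[OF this] double.open_curve_vimage[OF this]
        have "ennreal r = emeasure lborel {x..<x + r}" using elim by simp
        also have "\<dots> \<le> emeasure lborel (double_curve -` mball_of double_circle x r \<inter> {0..2})"
        proof (intro emeasure_mono subsetI)
          fix t assume t: "t \<in> {x..<x + r}"
          have "mdist double_circle (double_curve x) (double_curve t) \<le> \<bar>x - t\<bar>" by (rule double.curve_lip)
          then have "mdist double_circle x (double_curve t) < r"
            using t unfolding double_curve_collapse[OF x] by simp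
          then show "t \<in> double_curve -` mball_of double_circle x r \<inter> {0..2}"
            using double.curve_in[of t] t elim x x2 by simp
        qed (use ball in auto)
        also have "\<dots> = emeasure (mass_measure 1 double_circle double_current) (mball_of double_circle x r)"
          unfolding double.mass using ball(1) by (rule double.emeasure_curve_measure[symmetric])
        finally have "ennreal r / ennreal (2 * r) \<le>
            emeasure (mass_measure 1 double_circle double_current) (mball_of double_circle x r) / ennreal (2 * r)"
          by (rule divide_right_mono_ennreal)
        moreover have "ennreal r / ennreal (2 * r) = ennreal (1 / 2)"
          using elim by (subst divide_ennreal) auto
        ultimately show ?case by (simp add: unit_ball_vol_1[simplified])
      qed
    qed
    moreover have "0 < ennreal (1 / 2)"
      unfolding ennreal_less_zero_iff by simp
    ultimately show ?thesis by (rule less_le_trans[rotated])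
  qed
  then show ?thesis by (auto simp: current_set_def)
qed

section \<open>Area formula for charts\<close>

text \<open>Distinct isolated points are isolated by distinct members of a countable basis. Off this
  null set, functions that agree on \<open>A\<close> have the same derivative wherever both are
  differentiable.\<close>

lemma countable_isolated_points:
  fixes A :: "real set"
  shows "countable {t \<in> A. \<not> t islimpt A}"
proof -
  obtain B :: "real set set" where B: "countable B" "topological_basis B"
    using ex_countable_basis by blast
  have "\<exists>b\<in>B. t \<in> b \<and> b \<inter> A \<subseteq> {t}" if t: "\<not> t islimpt A" for t
  proof -
    obtain T where T: "t \<in> T" "open T" "\<And>y. y \<in> A \<Longrightarrow> y \<in> T \<Longrightarrow> y = t"
      using t unfolding islimpt_def by blast
    then obtain b where "b \<in> B" "t \<in> b" "b \<subseteq> T"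
      using B(2) topological_basisE by blast
    with T show ?thesis by blast
  qed
  then obtain f where f: "\<And>t. \<not> t islimpt A \<Longrightarrow> f t \<in> B \<and> t \<in> f t \<and> f t \<inter> A \<subseteq> {t}" by metis
  have "inj_on f {t \<in> A. \<not> t islimpt A}"
    using f by (intro inj_onI) blast
  moreover have "countable (f ` {t \<in> A. \<not> t islimpt A})"
    using f B(1) by (intro countable_subset[OF _ B(1)]) blast
  ultimately show ?thesis by (metis countable_image_inj_on)
qed

text \<open>The extension is an infimum of cones with slope \<open>L\<close>. It provides the
  witness for the choice in \<open>lipschitz_extension\<close>.\<close>

lemma mcshane_extension:
  fixes f :: "'a \<Rightarrow> real"
  assumes A: "A \<subseteq> mspace Z" and L: "0 \<le> L"
    and f: "\<And>x y. x \<in> A \<Longrightarrow> y \<in> A \<Longrightarrow> \<bar>f x - f y\<bar> \<le> L * mdist Z x y"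
  shows "\<exists>h. lipschitz_fun Z h \<and> (\<forall>x\<in>A. h x = f x)"
proof (cases "A = {}")
  case True
  then show ?thesis by (intro exI[of _ "\<lambda>_. 0"]) simp
next
  case False
  then obtain a where a: "a \<in> A" by blast
  define h where "h x = (INF y\<in>A. f y + L * mdist Z x y)" for x
  have lower: "f a - L * mdist Z a x \<le> f y + L * mdist Z x y" if "x \<in> mspace Z" "y \<in> A" for x y
  proof -
    have "f a - f y \<le> L * mdist Z a y" using f[OF a that(2)] by (simp add: abs_le_iff)
    also have "\<dots> \<le> L * (mdist Z a x + mdist Z x y)"
      using mdist_triangle[of a Z x y] a A that L by (intro mult_left_mono) auto
    finally show ?thesis by (simp add: algebra_simps)
  qed
  have bdd: "bdd_below ((\<lambda>y. f y + L * mdist Z x y) ` A)" if "x \<in> mspace Z" for x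
    using lower[OF that] by (intro bdd_belowI[of _ "f a - L * mdist Z a x"]) auto
  have h_eq: "h x = f x" if x: "x \<in> A" for x
  proof (rule antisym)
    have xm: "x \<in> mspace Z" using x A by blast
    show "h x \<le> f x"
    proof -
      have "mdist Z x x = 0" using xm by simp
      then show ?thesis using cINF_lower[OF bdd[OF xm] x] by (simp add: h_def)
    qed
    have "f x \<le> f y + L * mdist Z x y" if "y \<in> A" for y
      using f[OF x that] by (simp add: abs_le_iff)
    then show "f x \<le> h x" unfolding h_def using False by (intro cINF_greatest) auto
  qed
  have h_le: "h x \<le> h z + L * mdist Z x z" if xz: "x \<in> mspace Z" "z \<in> mspace Z" for x z
  proof -
    have "h x - L * mdist Z x z \<le> f y + L * mdist Z z y" if y: "y \<in> A" for y
    proof -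
      have "h x \<le> f y + L * mdist Z x y" unfolding h_def by (rule cINF_lower[OF bdd[OF xz(1)] y])
      also have "L * mdist Z x y \<le> L * (mdist Z x z + mdist Z z y)"
        using mdist_triangle[of x Z z y] xz y A L by (intro mult_left_mono) auto
      finally show ?thesis by (simp add: algebra_simps)
    qed
    then have "h x - L * mdist Z x z \<le> h z" unfolding h_def[of z] using False by (intro cINF_greatest) auto
    then show ?thesis by simp
  qed
  have "\<bar>h x - h z\<bar> \<le> L * mdist Z x z" if xz: "x \<in> mspace Z" "z \<in> mspace Z" for x z
    using h_le[OF xz] h_le[OF xz(2,1)] mdist_commute[of Z x z] by (simp add: abs_le_iff)
  then have "lipschitz_fun Z h" using L unfolding lipschitz_fun_iff by blast
  with h_eq show ?thesis by blast
qed

lemma compact_euclid_pt_vimage: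
  assumes K: "compactin (mtopology_of (euclid 1)) K"
  shows "compact {t. euclid_pt t \<in> K}"
proof -
  have KE: "K \<subseteq> {..<Suc 0} \<rightarrow>\<^sub>E UNIV"
    using compactin_subset_topspace[OF K] by simp
  have "compact ((\<lambda>x. x 0) ` K)"
  proof -
    have "lipschitz_fun (euclid 1) (\<lambda>x. x 0)"
      unfolding lipschitz_fun_iff by (intro exI[of _ 1]) (simp add: mdist_euclid_1 del: mdist_euclid)
    then have "continuous_map (mtopology_of (euclid 1)) euclideanreal (\<lambda>x. x 0)"
      using Lipschitz_continuous_imp_continuous_map by fastforce
    with K have "compactin euclideanreal ((\<lambda>x. x 0) ` K)" by (rule image_compactin)
    then show ?thesis by simp
  qed
  moreover have "(\<lambda>x. x 0) ` K = {t. euclid_pt t \<in> K}"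
  proof (intro equalityI subsetI)
    fix t assume "t \<in> (\<lambda>x. x 0) ` K"
    then obtain x where "x \<in> K" "t = x 0" by blast
    then show "t \<in> {t. euclid_pt t \<in> K}" using KE euclid_pt_collapse[of x] by auto
  next
    fix t assume "t \<in> {t. euclid_pt t \<in> K}"
    then show "t \<in> (\<lambda>x. x 0) ` K" by (intro image_eqI[of _ _ "euclid_pt t"]) auto
  qed
  ultimately show ?thesis by simp
qed

text \<open>Here \<open>h\<close> is the Lipschitz extension that happened to be chosen; all that is
  kept of it is its Lipschitz bound and its values on the chart domain.\<close>

lemma chart_current_1:
  assumes K: "compactin (mtopology_of (euclid 1)) K" and bl: "bilipschitz_on (euclid 1) Z K \<phi>"
    and \<theta>: "integrable (leb 1) (\<lambda>x. of_int (\<theta> x) :: real)" and p: "lipschitz_fun Z p"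
  obtains h L where "L-lipschitz_on UNIV h" "\<And>t. euclid_pt t \<in> K \<Longrightarrow> h t = p (\<phi> (euclid_pt t))"
    "chart_current 1 K \<phi> \<theta> (\<lambda>_. 1) [p] =
      (LBINT t. indicator {t. euclid_pt t \<in> K} t * of_int (\<theta> (euclid_pt t)) * deriv h t)"
proof -
  have KE: "K \<subseteq> {..<Suc 0} \<rightarrow>\<^sub>E UNIV"
    using compactin_subset_topspace[OF K] by simp
  obtain L where L: "L > 0" "\<And>x y. x \<in> K \<Longrightarrow> y \<in> K \<Longrightarrow> mdist Z (\<phi> x) (\<phi> y) \<le> L * mdist (euclid 1) x y"
    and \<phi>: "\<phi> ` K \<subseteq> mspace Z"
    using bl unfolding bilipschitz_on_def by blast
  have "\<bar>(p \<circ> \<phi>) x - (p \<circ> \<phi>) y\<bar> \<le> (lip_const Z p * L) * mdist (euclid 1) x y" if "x \<in> K" "y \<in> K" for x y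
  proof -
    have "\<bar>p (\<phi> x) - p (\<phi> y)\<bar> \<le> lip_const Z p * mdist Z (\<phi> x) (\<phi> y)"
      using \<phi> that by (intro abs_diff_le_lip_const[OF p]) auto
    also have "\<dots> \<le> lip_const Z p * (L * mdist (euclid 1) x y)"
      using L(2)[OF that] lip_const_nonneg[OF p] by (rule mult_left_mono)
    finally show ?thesis by (simp add: mult.assoc)
  qed
  then have "\<exists>h. lipschitz_fun (euclid 1) h \<and> (\<forall>x\<in>K. h x = (p \<circ> \<phi>) x)"
    using KE lip_const_nonneg[OF p] L(1) by (intro mcshane_extension[of _ _ "lip_const Z p * L"]) auto
  then have ext: "lipschitz_fun (euclid 1) (lipschitz_extension 1 K (p \<circ> \<phi>)) \<and>
      (\<forall>x\<in>K. lipschitz_extension 1 K (p \<circ> \<phi>) x = (p \<circ> \<phi>) x)"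
    unfolding lipschitz_extension_def by (rule someI_ex)
  define h where "h t = lipschitz_extension 1 K (p \<circ> \<phi>) (euclid_pt t)" for t
  obtain M where M: "M-lipschitz_on UNIV h"
    using lipschitz_euclid_1[of "lipschitz_extension 1 K (p \<circ> \<phi>)"] ext unfolding h_def by auto
  have [measurable]: "{t. euclid_pt t \<in> K} \<in> sets borel"
    using compact_euclid_pt_vimage[OF K] by (rule borel_compact)
  have "(\<lambda>x. of_int (\<theta> x) :: real) \<in> borel_measurable (leb (Suc 0))"
    using borel_measurable_integrable[OF \<theta>] by simp
  then have [measurable]: "(\<lambda>t. of_int (\<theta> (euclid_pt t)) :: real) \<in> borel_measurable borel"
    using measurable_compose[OF measurable_euclid_pt] by blast
  note [measurable] = borel_measurable_deriv[OF lipschitz_on_continuous_on[OF M]]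
  show ?thesis
  proof (rule that[OF M])
    show "h t = p (\<phi> (euclid_pt t))" if "euclid_pt t \<in> K" for t
      using ext that by (simp add: h_def)
    have "chart_current 1 K \<phi> \<theta> (\<lambda>_. 1) [p] =
        (\<integral>x. indicator {t. euclid_pt t \<in> K} (x 0) * of_int (\<theta> (euclid_pt (x 0))) * deriv h (x 0) \<partial>leb (Suc 0))"
      unfolding chart_current_def One_nat_def
      by (intro Bochner_Integration.integral_cong refl)
        (simp add: space_leb_1 jacobian_det_1 euclid_pt_collapse indicator_def h_def[abs_def])
    also have "\<dots> = (LBINT t. indicator {t. euclid_pt t \<in> K} t * of_int (\<theta> (euclid_pt t)) * deriv h t)"
      by (rule integral_leb_1) measurable
    finally show "chart_current 1 K \<phi> \<theta> (\<lambda>_. 1) [p] =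
        (LBINT t. indicator {t. euclid_pt t \<in> K} t * of_int (\<theta> (euclid_pt t)) * deriv h t)" .
  qed
qed

text \<open>Change of variables for an injective map with a derivative. The measure is
  \<open>lebesgue\<close> because the sets to which this is applied omit a negligible set of
  parameters that need not be Borel.\<close>

lemma lebesgue_area_formula:
  fixes e w :: "real \<Rightarrow> real"
  assumes A: "A \<in> sets lebesgue" and D: "\<And>t. t \<in> A \<Longrightarrow> (e has_field_derivative e' t) (at t)"
    and inj: "inj_on e A" and bnd: "e ` A \<subseteq> {a..b}"
    and w: "w \<in> borel_measurable borel" "\<And>x. \<bar>w x\<bar> \<le> B"
  shows "e ` A \<in> sets lebesgue"
    "integrable lebesgue (\<lambda>t. indicator A t * (\<bar>e' t\<bar> * w (e t)))"
    "(\<integral>t. indicator A t * (\<bar>e' t\<bar> * w (e t)) \<partial>lebesgue) = (\<integral>s. indicator (e ` A) s * w s \<partial>lebesgue)"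
proof -
  have D': "(e has_field_derivative e' t) (at t within A)" if "t \<in> A" for t
    using D[OF that] by (rule has_field_derivative_at_within)
  show im: "e ` A \<in> sets lebesgue"
  proof (rule differentiable_image_in_sets_lebesgue[OF A])
    show "e differentiable_on A"
      unfolding differentiable_on_def differentiable_def
      by (meson D' has_field_derivative_def)
  qed simp
  have w_int: "set_integrable lebesgue (e ` A) w"
    unfolding set_integrable_def
  proof (rule Bochner_Integration.integrable_bound)
    show "integrable lebesgue (\<lambda>x. B * indicator {a..b} x)"
      by (intro integrable_mult_right integrable_real_indicator) (auto simp: emeasure_lborel_Icc_eq)
    have "w \<in> borel_measurable lebesgue" using w(1) by (simp add: measurable_completion)
    then show "(\<lambda>x. indicat_real (e ` A) x *\<^sub>R w x) \<in> borel_measurable lebesgue"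
      using im by (intro borel_measurable_scaleR borel_measurable_indicator)
    show "AE x in lebesgue. norm (indicat_real (e ` A) x *\<^sub>R w x) \<le> norm (B * indicator {a..b} x)"
    proof (rule AE_I2)
      fix x
      have "\<bar>w x\<bar> \<le> \<bar>B\<bar>" using w(2)[of x] by linarith
      then show "norm (indicat_real (e ` A) x *\<^sub>R w x) \<le> norm (B * indicator {a..b} x)"
        using bnd by (auto simp: indicator_def)
    qed
  qed
  have cov: "(\<lambda>t. \<bar>e' t\<bar> * w (e t)) absolutely_integrable_on A \<and>
      integral A (\<lambda>t. \<bar>e' t\<bar> * w (e t)) = integral (e ` A) w"
    using has_absolute_integral_change_of_variables_1'[OF A D' inj, of w "integral (e ` A) w"] w_int by simp
  then show "integrable lebesgue (\<lambda>t. indicator A t * (\<bar>e' t\<bar> * w (e t)))"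
    by (simp add: set_integrable_def)
  have "(\<integral>t. indicator A t * (\<bar>e' t\<bar> * w (e t)) \<partial>lebesgue) = integral A (\<lambda>t. \<bar>e' t\<bar> * w (e t))"
    using set_lebesgue_integral_eq_integral(2)[OF conjunct1[OF cov]] by (simp add: set_lebesgue_integral_def)
  also have "\<dots> = (\<integral>s. indicator (e ` A) s * w s \<partial>lebesgue)"
    using set_lebesgue_integral_eq_integral(2)[OF w_int] cov by (simp add: set_lebesgue_integral_def)
  finally show "(\<integral>t. indicator A t * (\<bar>e' t\<bar> * w (e t)) \<partial>lebesgue) = (\<integral>s. indicator (e ` A) s * w s \<partial>lebesgue)" .
qed

section \<open>Fibres of the folding map\<close>

text \<open>The folding map \<open>x \<mapsto> circ x 0\<close> sends the space to \<open>[0, 1/2]\<close>. Its fibre over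
  \<open>s \<in> (0, 1/2)\<close> consists of \<open>s\<close>, \<open>1 - s\<close> and, if \<open>s\<close> lies in a gap, also \<open>1 + s\<close>.\<close>

definition piece :: "nat \<Rightarrow> real \<Rightarrow> real" where
  "piece j s = (if j = 0 then s else if j = 1 then 1 + s else 1 - s)"

lemma piece_in:
  assumes "0 < s" "s < 1/2"
  shows "piece j s \<in> double_carrier \<longleftrightarrow> j \<noteq> 1 \<or> s \<notin> junction"
  using assms junction_add_int[of s 1] by (auto simp: piece_def double_carrier_def add.commute)

lemma circ_piece: "0 < s \<Longrightarrow> s < 1/2 \<Longrightarrow> circ (piece j s) 0 = s"
  using circ_zero_eq(1)[of 0 s] circ_zero_eq(1)[of 1 "1 + s"] circ_zero_eq(2)[of 0 "1 - s"]
  by (auto simp: piece_def)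

lemma mdist_piece:
  assumes s: "0 < s" "s < 1/2" and t: "0 < t" "t < 1/2"
  shows "mdist double_circle (piece j s) (piece j t) = \<bar>s - t\<bar>"
proof -
  have "\<bar>piece j s - piece j t\<bar> = \<bar>s - t\<bar>" by (simp add: piece_def abs_minus_commute)
  moreover have "\<bar>s - t\<bar> \<le> 1/2" using s t by linarith
  ultimately have "circ (piece j s) (piece j t) = \<bar>s - t\<bar>"
    using circ_eq_abs[of "piece j s" "piece j t"] by simp
  moreover have "(1 \<le> piece j s) = (1 \<le> piece j t)"
    using s t by (auto simp: piece_def)
  ultimately show ?thesis by (simp add: mdist_double_circle ddist_def)
qed

lemma piece_cases:
  assumes x: "x \<in> double_carrier" and q: "circ x 0 \<noteq> 0" "circ x 0 \<noteq> 1/2"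
  obtains j where "j < 3" "0 < circ x 0" "circ x 0 < 1/2" "x = piece j (circ x 0)"
proof -
  have "circ (1/2) 0 = 1/2" using circ_zero_eq(1)[of 0 "1/2"] by simp
  then have "x \<noteq> 1/2" using q(2) by metis
  moreover have "x \<noteq> 0" "x \<noteq> 1"
    using q(1) x by (auto simp: double_carrier_def)
  \<comment> \<open>The circle is glued over \<open>[1/2, 1)\<close>, so codes from
    \<open>3/2\<close> on do not occur; this is why the fibre never has a fourth point.\<close>
  moreover have "x < 3/2"
  proof (rule ccontr)
    assume "\<not> x < 3/2"
    then have "x - 1 \<in> junction" using x by (intro junction_upper) (auto simp: double_carrier_def)
    then show False
      using junction_add_int[of "x - 1" 1] \<open>\<not> x < 3/2\<close> x by (auto simp: double_carrier_def)
  qed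
  ultimately consider "0 < x" "x < 1/2" | "1 < x" "x < 3/2" | "1/2 < x" "x < 1"
    using x by (fastforce simp: double_carrier_def)
  then show ?thesis
  proof cases
    case 1
    then show ?thesis using that[of 0] circ_zero_eq(1)[of 0 x] by (auto simp: piece_def)
  next
    case 2
    then show ?thesis using that[of 1] circ_zero_eq(1)[of 1 x] by (auto simp: piece_def)
  next
    case 3
    then show ?thesis using that[of 2] circ_zero_eq(2)[of 0 x] by (auto simp: piece_def)
  qed
qed

lemma piece_inject: "0 < s \<Longrightarrow> s < 1/2 \<Longrightarrow> j < 3 \<Longrightarrow> k < 3 \<Longrightarrow> piece j s = piece k s \<Longrightarrow> j = k"
  by (auto simp: piece_def split: if_splits)

lemma finite_circ_zero_boundary: "finite {x \<in> double_carrier. circ x 0 = 0 \<or> circ x 0 = 1/2}"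
proof (rule finite_subset)
  show "{x \<in> double_carrier. circ x 0 = 0 \<or> circ x 0 = 1/2} \<subseteq> {0, 1/2, 1, 3/2}"
  proof
    fix x assume "x \<in> {x \<in> double_carrier. circ x 0 = 0 \<or> circ x 0 = 1/2}"
    then have x: "0 \<le> x" "x < 2" and c: "circ x 0 = 0 \<or> circ x 0 = 1/2"
      by (auto simp: double_carrier_def)
    consider "x \<le> 1/2" | "1/2 \<le> x" "x \<le> 1" | "1 \<le> x" "x \<le> 3/2" | "3/2 \<le> x" by linarith
    then show "x \<in> {0, 1/2, 1, 3/2}"
      using circ_zero_eq(1)[of 0 x] circ_zero_eq(2)[of 0 x] circ_zero_eq(1)[of 1 x] circ_zero_eq(2)[of 1 x] x c
      by cases auto
  qed
qed simp

text \<open>From a point of the second layer over a gap, the first layer can be reached only through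
  a glued point, which is at least as far away as the rim of the gap. Openness is needed for
  measurability, since the position on the circle does not tell pieces 0 and 1 apart.\<close>

lemma openin_piece_1: "openin (mtopology_of double_circle) (piece 1 ` ({0<..<1/2} - junction))"
  (is "openin _ ?P")
proof -
  have sub: "?P \<subseteq> double_carrier"
    using piece_in[of _ 1] by auto
  have "\<exists>r>0. mball_of double_circle x r \<subseteq> ?P" if "x \<in> ?P" for x
  proof -
    obtain s where "x = piece 1 s" "s \<in> {0<..<1/2} - junction" using \<open>x \<in> ?P\<close> by blast
    then have s: "x = piece 1 s" "0 < s" "s < 1/2" "s \<notin> junction" by simp_all
    have "open ({0<..<1/2} - junction)" using closed_junction by (intro open_Diff) auto
    then obtain r where r: "r > 0" "ball s r \<subseteq> {0<..<1/2} - junction"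
      using s by (metis DiffI greaterThanLessThan_iff open_contains_ball)
    have xs: "x = dpt True s"
      using s by (simp add: piece_def dpt_def frac_unique_iff[THEN iffD2])
    have "mball_of double_circle x r \<subseteq> ?P"
    proof
      fix y assume y: "y \<in> mball_of double_circle x r"
      then obtain j t where jt: "y = dpt j t" "\<bar>s - t\<bar> < r" unfolding xs by (rule ball_double_circle)
      then have "t \<in> ball s r" by (simp add: dist_real_def)
      then have t: "0 < t" "t < 1/2" "t \<notin> junction" using r(2) by auto
      have j
      proof (rule ccontr)
        assume "\<not> j"
        then have "bridge s t < r" using y by (simp add: xs jt mdist_dpt ddist_def)
        then obtain c where c: "c \<in> junction" "circ s c + circ c t < r" using bridge_attained by metis
        then have "circ s c < r" using circ_nonneg[of c t] by linarith
        then obtain n where "\<bar>s - (c + of_int n)\<bar> < r" using circ_lift[of s c] by metis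
        then have "c + of_int n \<in> ball s r" by (simp add: dist_real_def)
        then show False using r(2) c(1) junction_add_int[of c n] by blast
      qed
      then have "y = piece 1 t"
        using t jt by (simp add: piece_def dpt_def frac_unique_iff[THEN iffD2])
      then show "y \<in> ?P" using t by auto
    qed
    with r(1) show ?thesis by blast
  qed
  with sub show ?thesis
    by (simp add: mtopology_of_def mball_of_def Metric_space.openin_mtopology[OF Metric_space_mspace_mdist[of double_circle], simplified])
qed

text \<open>\<open>W j \<sigma>\<close> is the part of the fold of the \<open>j\<close>-th piece that a chart covers with orientation
  \<open>\<sigma>\<close>, up to null sets.\<close>

definition chart_folds ::
    "(nat \<Rightarrow> real) set \<Rightarrow> ((nat \<Rightarrow> real) \<Rightarrow> real) \<Rightarrow> ((nat \<Rightarrow> real) \<Rightarrow> int) \<Rightarrow> (nat \<Rightarrow> bool \<Rightarrow> real set) \<Rightarrow> bool"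
  where "chart_folds K \<phi> \<theta> W \<longleftrightarrow>
    (\<forall>j \<sigma>. W j \<sigma> \<in> sets lebesgue) \<and>
    (\<forall>j \<sigma> s. s \<in> W j \<sigma> \<longrightarrow> 0 < s \<and> s < 1/2 \<and> piece j s \<in> \<phi> ` K) \<and>
    (\<forall>j. W j True \<inter> W j False = {}) \<and>
    (\<forall>j. negligible {s. 0 < s \<and> s < 1/2 \<and> piece j s \<in> \<phi> ` K \<and> s \<notin> W j True \<union> W j False}) \<and>
    (\<forall>F w D B L. L-lipschitz_on UNIV F \<longrightarrow> finite D \<longrightarrow>
       (\<forall>x. x \<notin> D \<longrightarrow> (F has_field_derivative w x) (at x)) \<longrightarrow>
       w \<in> borel_measurable borel \<longrightarrow> (\<forall>x. \<bar>w x\<bar> \<le> B) \<longrightarrow>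
       chart_current 1 K \<phi> \<theta> (\<lambda>_. 1) [\<lambda>x. F (circ x 0)] =
         (\<Sum>j<3. (\<integral>s. indicator (W j True) s * w s \<partial>lebesgue) - (\<integral>s. indicator (W j False) s * w s \<partial>lebesgue)))"

lemma AE_lebesgue_not_in: "negligible N \<Longrightarrow> AE t in lebesgue. t \<notin> N"
  unfolding negligible_iff_null_sets by (rule AE_not_in)

lemma lipschitz_comp_circ:
  assumes F: "L-lipschitz_on UNIV F"
  shows "lipschitz_fun double_circle (\<lambda>x. F (circ x c))"
  unfolding lipschitz_fun_iff
proof (intro exI[of _ L] conjI ballI)
  show L: "0 \<le> L" using F by (rule lipschitz_on_nonneg)
  fix x y
  have "\<bar>F (circ x c) - F (circ y c)\<bar> \<le> L * \<bar>circ x c - circ y c\<bar>"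
    using lipschitz_onD[OF F, of "circ x c" "circ y c"] by (simp add: dist_real_def)
  also have "\<dots> \<le> L * mdist double_circle x y"
    using circ_lipschitz[of x c y] circ_le_ddist[of x y "1 \<le> x" "1 \<le> y"] L
    by (intro mult_left_mono) (auto simp: mdist_double_circle)
  finally show "\<bar>F (circ x c) - F (circ y c)\<bar> \<le> L * mdist double_circle x y" .
qed

text \<open>Difference quotients within \<open>S\<close> coincide, and at a limit point the limit
  within \<open>S\<close> is unique. This replaces a chain rule for the arbitrary extensions in
  chart currents.\<close>

lemma derivative_eq_at_limit_point:
  fixes f g :: "real \<Rightarrow> real"
  assumes "(f has_field_derivative a) (at t)" "(g has_field_derivative b) (at t)"
    and eq: "\<And>s. s \<in> S \<Longrightarrow> f s = g s" and t: "t \<in> S" "t islimpt S"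
  shows "a = b"
proof -
  have f: "((\<lambda>y. (f y - f t) / (y - t)) \<longlongrightarrow> a) (at t within S)"
    using has_field_derivative_at_within[OF assms(1)] by (simp add: has_field_derivative_iff)
  have g: "((\<lambda>y. (g y - g t) / (y - t)) \<longlongrightarrow> b) (at t within S)"
    using has_field_derivative_at_within[OF assms(2)] by (simp add: has_field_derivative_iff)
  have "\<forall>\<^sub>F y in at t within S. (g y - g t) / (y - t) = (f y - f t) / (y - t)"
    unfolding eventually_at_filter using eq t(1) by (intro always_eventually) simp
  with g have "((\<lambda>y. (f y - f t) / (y - t)) \<longlongrightarrow> b) (at t within S)"
    by (rule Lim_transform_eventually)
  moreover have "at t within S \<noteq> bot" using t(2) by (simp add: trivial_limit_within)
  ultimately show ?thesis using f tendsto_unique by blast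
qed

text \<open>The chart domain is divided by the piece that a parameter lands in. On each part the
  fold of the chart is injective and, at limit points, has nonzero derivative by the lower
  bi-Lipschitz bound. Sorting by the sign of density times derivative and changing variables leaves
  only indicator functions, because the density has absolute value 1.\<close>

lemma chart_folds_exist:
  assumes K: "compactin (mtopology_of (euclid 1)) K" and bl: "bilipschitz_on (euclid 1) double_circle K \<phi>"
    and \<theta>: "integrable (leb 1) (\<lambda>x. of_int (\<theta> x) :: real)"
    and one: "negligible {t. euclid_pt t \<in> K \<and> \<bar>\<theta> (euclid_pt t)\<bar> \<noteq> 1}"
  shows "\<exists>W. chart_folds K \<phi> \<theta> W"
proof -
  define k where "k = {t. euclid_pt t \<in> K}"
  define c where "c t = \<phi> (euclid_pt t)" for t
  define \<theta>' where "\<theta>' t = \<theta> (euclid_pt t)" for t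
  have k_compact: "compact k" unfolding k_def by (rule compact_euclid_pt_vimage[OF K])
  then have km[measurable]: "k \<in> sets borel" by (rule borel_compact)
  obtain L where L: "L > 0" and \<phi>: "\<phi> ` K \<subseteq> double_carrier"
    and bl': "\<And>x y. x \<in> K \<Longrightarrow> y \<in> K \<Longrightarrow> mdist (euclid 1) x y / L \<le> mdist double_circle (\<phi> x) (\<phi> y) \<and>
      mdist double_circle (\<phi> x) (\<phi> y) \<le> L * mdist (euclid 1) x y"
    using bl unfolding bilipschitz_on_def by auto
  have c_lip: "\<bar>s - t\<bar> / L \<le> mdist double_circle (c s) (c t)" "mdist double_circle (c s) (c t) \<le> L * \<bar>s - t\<bar>"
    if "s \<in> k" "t \<in> k" for s t
    using bl'[of "euclid_pt s" "euclid_pt t"] that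
    by (simp_all add: k_def c_def mdist_euclid_1 del: mdist_euclid)
  have c_in: "c t \<in> double_carrier" if "t \<in> k" for t
    using \<phi> that by (auto simp: k_def c_def)
  have c_inj: "s = t" if "s \<in> k" "t \<in> k" "c s = c t" for s t
  proof -
    have "mdist double_circle (c s) (c t) = 0" using that(3) c_in[OF that(2)] by simp
    then have "\<bar>s - t\<bar> / L \<le> 0" using c_lip(1)[OF that(1,2)] by linarith
    then show ?thesis using L by (simp add: divide_le_0_iff)
  qed
  have \<phi>K: "x \<in> \<phi> ` K \<longleftrightarrow> (\<exists>t\<in>k. x = c t)" for x
  proof
    assume "x \<in> \<phi> ` K"
    then obtain y where y: "y \<in> K" "x = \<phi> y" by blast
    have "y \<in> {..<Suc 0} \<rightarrow>\<^sub>E UNIV" using compactin_subset_topspace[OF K] y(1) by auto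
    then have "euclid_pt (y 0) = y" by (rule euclid_pt_collapse)
    with y show "\<exists>t\<in>k. x = c t" by (intro bexI[of _ "y 0"]) (auto simp: k_def c_def)
  qed (auto simp: k_def c_def)
  have "(\<lambda>x. of_int (\<theta> x) :: real) \<in> borel_measurable (leb (Suc 0))"
    using borel_measurable_integrable[OF \<theta>] by simp
  then have \<theta>m[measurable]: "(\<lambda>t. of_int (\<theta>' t) :: real) \<in> borel_measurable borel"
    using measurable_compose[OF measurable_euclid_pt] unfolding \<theta>'_def by blast
  \<comment> \<open>This serves only to obtain a Lipschitz extension \<open>e\<close> of the fold
    along the chart.\<close>
  obtain e M where eL: "M-lipschitz_on UNIV e" and e: "\<And>t. t \<in> k \<Longrightarrow> e t = circ (c t) 0"
    by (rule chart_current_1[OF K bl \<theta> circ_lipschitz_fun(1)[of 0]]) (auto simp: k_def c_def)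
  note em[measurable] = borel_measurable_lipschitz[OF eL]
    and dem[measurable] = borel_measurable_deriv[OF lipschitz_on_continuous_on[OF eL]]
  define kk where "kk j = {t \<in> k. 0 < e t \<and> e t < 1/2 \<and> c t = piece j (e t)}" for j
  have kk_sub: "kk j \<subseteq> k" for j by (auto simp: kk_def)
  have kk_cases: "\<exists>j<3. t \<in> kk j" if t: "t \<in> k" "e t \<noteq> 0" "e t \<noteq> 1/2" for t
  proof -
    obtain j where "j < 3" "0 < e t" "e t < 1/2" "c t = piece j (e t)"
      using piece_cases[OF c_in[OF t(1)]] t e[OF t(1)] by metis
    then show ?thesis using t(1) by (auto simp: kk_def)
  qed
  have kk_dist: "mdist double_circle (c s) (c t) = \<bar>e s - e t\<bar>" if "s \<in> kk j" "t \<in> kk j" for s t j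
    using that mdist_piece[of "e s" "e t" j] by (simp add: kk_def)
  have kk_inj: "inj_on e (kk j)" for j
    using c_inj by (intro inj_onI) (auto simp: kk_def)
  have kk_disj: "j = j'" if "t \<in> kk j" "t \<in> kk j'" "j < 3" "j' < 3" for t j j'
    using that piece_inject[of "e t" j j'] by (auto simp: kk_def)
  have preim: "{t \<in> k. c t \<in> U} \<in> sets borel" if U: "openin (mtopology_of double_circle) U" for U
  proof -
    have "Lipschitz_continuous_map (submetric euclidean_metric k) double_circle c"
      unfolding Lipschitz_continuous_map_def using c_in c_lip(2) by (auto simp: dist_real_def)
    then have "continuous_map (top_of_set k) (mtopology_of double_circle) c"
      using Lipschitz_continuous_imp_continuous_map mtopology_of_submetric[of euclidean_metric k] by fastforce
    from openin_continuous_map_preimage[OF this U]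
    have "openin (top_of_set k) {t \<in> k. c t \<in> U}" by simp
    then obtain T where "open T" "{t \<in> k. c t \<in> U} = k \<inter> T" by (auto simp: openin_open)
    then show ?thesis using km by auto
  qed
  have cont: "continuous_map (mtopology_of double_circle) euclideanreal (\<lambda>x. circ x (1/4))"
    using Lipschitz_continuous_imp_continuous_map[OF circ_lipschitz_fun(1)] by simp
  have kk1: "kk 1 = {t \<in> k. c t \<in> piece 1 ` ({0<..<1/2} - junction)}"
  proof (intro equalityI subsetI)
    fix t assume t: "t \<in> kk 1"
    then have "e t \<notin> junction" using piece_in[of "e t" 1] c_in[of t] by (auto simp: kk_def)
    with t show "t \<in> {t \<in> k. c t \<in> piece 1 ` ({0<..<1/2} - junction)}" by (auto simp: kk_def)
  next
    fix t assume "t \<in> {t \<in> k. c t \<in> piece 1 ` ({0<..<1/2} - junction)}"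
    then obtain s where s: "t \<in> k" "c t = piece 1 s" "0 < s" "s < 1/2" by auto
    then have "e t = s" using e circ_piece by metis
    with s show "t \<in> kk 1" by (simp add: kk_def)
  qed
  have kk1m: "kk 1 \<in> sets borel" unfolding kk1 by (rule preim[OF openin_piece_1])
  let ?U = "{x \<in> double_carrier. circ x (1/4) < 1/4}" and ?V = "{x \<in> double_carrier. 1/4 < circ x (1/4)}"
  have Um: "{t \<in> k. c t \<in> ?U} \<in> sets borel"
    using openin_continuous_map_preimage[OF cont, of "{..<1/4}"] by (intro preim) simp
  have Vm: "{t \<in> k. c t \<in> ?V} \<in> sets borel"
    using openin_continuous_map_preimage[OF cont, of "{1/4<..}"] by (intro preim) simp
  have E[measurable]: "{t. 0 < e t \<and> e t < 1/2} \<in> sets borel" by measurable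
  have piece_U: "circ (piece j s) (1/4) < 1/4" if "0 < s" "s < 1/2" "j < 2" for j s
    unfolding circ_quarter_less_iff using that by (intro exI[of _ "int j"]) (auto simp: piece_def less_2_cases_iff)
  have piece_V: "1/4 < circ (piece j s) (1/4)" if "0 < s" "s < 1/2" "2 \<le> j" for j s
    unfolding circ_quarter_greater_iff using that by (intro exI[of _ 0]) (auto simp: piece_def)
  \<comment> \<open>The distance from the quarter point separates pieces 0 and 1 from the last
    piece, and piece 1 is open; piece 0 is what remains.\<close>
  have kk0: "kk 0 = ({t \<in> k. c t \<in> ?U} \<inter> {t. 0 < e t \<and> e t < 1/2}) - kk 1"
  proof (intro equalityI subsetI)
    fix t assume t: "t \<in> kk 0"
    then have "t \<notin> kk 1" using kk_disj[of t 0 1] by auto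
    with t show "t \<in> ({t \<in> k. c t \<in> ?U} \<inter> {t. 0 < e t \<and> e t < 1/2}) - kk 1"
      using piece_U[of "e t" 0] c_in[of t] by (auto simp: kk_def)
  next
    fix t assume t: "t \<in> ({t \<in> k. c t \<in> ?U} \<inter> {t. 0 < e t \<and> e t < 1/2}) - kk 1"
    then obtain j where j: "j < 3" "t \<in> kk j" using kk_cases[of t] by auto
    have "j \<noteq> 2" using piece_V[of "e t" j] j t by (auto simp: kk_def)
    moreover have "j \<noteq> 1" using j t by auto
    ultimately have "j = 0" using j(1) by linarith
    with j show "t \<in> kk 0" by simp
  qed
  \<comment> \<open>All indices \<open>j \<ge> 2\<close> denote the same piece; measurability is
    obtained for every \<open>j\<close>, while sums run over \<open>j < 3\<close>.\<close>
  have kk2: "kk j = {t \<in> k. c t \<in> ?V} \<inter> {t. 0 < e t \<and> e t < 1/2}" if j2: "2 \<le> j" for j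
  proof (intro equalityI subsetI)
    fix t assume t: "t \<in> kk j"
    then show "t \<in> {t \<in> k. c t \<in> ?V} \<inter> {t. 0 < e t \<and> e t < 1/2}"
      using piece_V[of "e t" j] c_in[of t] j2 by (auto simp: kk_def)
  next
    fix t assume t: "t \<in> {t \<in> k. c t \<in> ?V} \<inter> {t. 0 < e t \<and> e t < 1/2}"
    then obtain i where i: "i < 3" "t \<in> kk i" using kk_cases[of t] by auto
    have "\<not> i < 2" using piece_U[of "e t" i] i t by (auto simp: kk_def)
    then have "piece i (e t) = piece j (e t)" using j2 by (simp add: piece_def)
    with i show "t \<in> kk j" by (simp add: kk_def)
  qed
  have kkm[measurable]: "kk j \<in> sets borel" for j
  proof -
    consider "j = 0" | "j = 1" | "2 \<le> j" by linarith
    then show ?thesis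
    proof cases
      case 1
      show ?thesis unfolding 1 kk0 using Um kk1m E by (intro sets.Diff sets.Int)
    next
      case 3
      show ?thesis unfolding kk2[OF 3] using Vm E by (intro sets.Int)
    qed (use kk1m in simp)
  qed
  define N where "N = {t. \<not> (e has_field_derivative deriv e t) (at t)}"
  have N: "negligible N"
    unfolding N_def by (rule negligible_AE_lborel[OF lipschitz_real_has_derivative_AE[OF eL]])
  \<comment> \<open>Within one piece the fold is isometric, so the lower bi-Lipschitz bound of the
    chart passes to \<open>e\<close> on \<open>kk j\<close>; at a limit point it keeps the
    difference quotients away from \<open>0\<close>.\<close>
  have deriv_nz: "deriv e t \<noteq> 0" if t: "t \<in> kk j" "t islimpt kk j" "t \<notin> N" for t j
  proof
    assume 0: "deriv e t = 0"
    have "(\<lambda>y. (e y - e t) / (y - t)) \<midarrow>t\<rightarrow> 0"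
      using t(3) 0 by (simp add: N_def has_field_derivative_iff)
    then obtain d where d: "d > 0" "\<And>y. y \<noteq> t \<Longrightarrow> \<bar>y - t\<bar> < d \<Longrightarrow> \<bar>(e y - e t) / (y - t)\<bar> < 1 / L"
      using LIM_D[of "\<lambda>y. (e y - e t) / (y - t)" 0 t "1 / L"] L by auto
    obtain y where y: "y \<in> kk j" "y \<noteq> t" "\<bar>y - t\<bar> < d"
      using t(2) d(1) unfolding islimpt_approachable dist_real_def by blast
    have "\<bar>y - t\<bar> / L \<le> \<bar>e y - e t\<bar>"
      using c_lip(1)[of y t] kk_dist[OF y(1) t(1)] y(1) t(1) kk_sub by auto
    then have "1 / L \<le> \<bar>(e y - e t) / (y - t)\<bar>"
      using y(2) L by (simp add: field_simps)
    with d(2)[OF y(2,3)] show False by simp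
  qed
  \<comment> \<open>Orientation relative to the fold combines the sign of the density with the
    direction in which the chart runs.\<close>
  define pos where "pos \<sigma> t \<longleftrightarrow> (if \<sigma> then 0 < of_int (\<theta>' t) * deriv e t else of_int (\<theta>' t) * deriv e t < 0)" for \<sigma> t
  define A where "A j \<sigma> = {t \<in> kk j. \<bar>of_int (\<theta>' t)\<bar> = (1::real) \<and> pos \<sigma> t} - N" for j \<sigma>
  have posm[measurable]: "Measurable.pred borel (pos \<sigma>)" for \<sigma>
    unfolding pos_def by (cases \<sigma>) simp_all
  have Am: "A j \<sigma> \<in> sets lebesgue" for j \<sigma>
  proof -
    have "{t. t \<in> kk j \<and> \<bar>of_int (\<theta>' t)\<bar> = (1::real) \<and> pos \<sigma> t} \<in> sets borel"
      by measurable
    moreover have "N \<in> sets lebesgue" using N negligible_imp_sets by blast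
    ultimately show ?thesis unfolding A_def by (intro sets.Diff) auto
  qed
  have A_sub: "A j \<sigma> \<subseteq> kk j" for j \<sigma> by (auto simp: A_def)
  have A_D: "(e has_field_derivative deriv e t) (at t)" if "t \<in> A j \<sigma>" for t j \<sigma>
    using that by (auto simp: A_def N_def)
  have A_inj: "inj_on e (A j \<sigma>)" for j \<sigma>
    by (rule inj_on_subset[OF kk_inj A_sub])
  have A_bnd: "e ` A j \<sigma> \<subseteq> {0..1/2}" for j \<sigma>
    using A_sub by (fastforce simp: kk_def)
  define W where "W j \<sigma> = e ` A j \<sigma>" for j \<sigma>
  have W1: "W j \<sigma> \<in> sets lebesgue" for j \<sigma>
    unfolding W_def
    by (rule lebesgue_area_formula(1)[OF Am A_D A_inj A_bnd, where w="\<lambda>_. 0" and B=0]) auto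
  have W2: "0 < s \<and> s < 1/2 \<and> piece j s \<in> \<phi> ` K" if s: "s \<in> W j \<sigma>" for j \<sigma> s
  proof -
    obtain t where "t \<in> kk j" "s = e t" using s A_sub by (auto simp: W_def)
    then have "0 < s \<and> s < 1/2" "t \<in> k" "piece j s = c t" by (auto simp: kk_def)
    then show ?thesis unfolding \<phi>K by blast
  qed
  have W3: "W j True \<inter> W j False = {}" for j
  proof -
    have "A j True \<inter> A j False = {}" by (auto simp: A_def pos_def)
    then show ?thesis
      unfolding W_def using inj_on_image_Int[OF kk_inj A_sub A_sub] by (metis image_empty)
  qed
  have iso: "negligible {t \<in> kk j. \<not> t islimpt kk j}" for j
    unfolding negligible_iff_null_sets
    by (intro null_sets_completionI countable_imp_null_set_lborel countable_isolated_points)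
  have good: "t \<in> A j True \<or> t \<in> A j False"
    if "t \<in> kk j" "t islimpt kk j" "t \<notin> N" "\<bar>\<theta>' t\<bar> = 1" for t j
  proof -
    have th: "\<bar>of_int (\<theta>' t)\<bar> = (1::real)" using that(4) by (metis of_int_1 of_int_abs)
    then have "of_int (\<theta>' t) * deriv e t \<noteq> 0" using deriv_nz[OF that(1-3)] by auto
    then have "0 < of_int (\<theta>' t) * deriv e t \<or> of_int (\<theta>' t) * deriv e t < 0" by linarith
    with th show ?thesis using that by (auto simp: A_def pos_def)
  qed
  have one': "negligible {t \<in> k. \<bar>\<theta>' t\<bar> \<noteq> 1}"
    using one by (simp add: k_def \<theta>'_def)
  have W4: "negligible {s. 0 < s \<and> s < 1/2 \<and> piece j s \<in> \<phi> ` K \<and> s \<notin> W j True \<union> W j False}" for j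
  proof -
    \<comment> \<open>The parameters to which \<open>good\<close> may not apply. Their set is
      negligible, and so is its image under the Lipschitz map \<open>e\<close>.\<close>
    let ?B = "{t \<in> k. \<bar>\<theta>' t\<bar> \<noteq> 1} \<union> N \<union> {t \<in> kk j. \<not> t islimpt kk j}"
    have "negligible ?B" by (intro negligible_Un one' N iso)
    then have "negligible (e ` ?B)"
    proof (rule negligible_locally_Lipschitz_image[rotated])
      fix x assume "x \<in> ?B"
      show "\<exists>T B. open T \<and> x \<in> T \<and> (\<forall>y\<in>?B \<inter> T. norm (e y - e x) \<le> B * norm (y - x))"
        using lipschitz_onD[OF eL] by (intro exI[of _ UNIV] exI[of _ M]) (auto simp: dist_real_def)
    qed simp
    moreover have "{s. 0 < s \<and> s < 1/2 \<and> piece j s \<in> \<phi> ` K \<and> s \<notin> W j True \<union> W j False} \<subseteq> e ` ?B"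
    proof
      fix s assume s: "s \<in> {s. 0 < s \<and> s < 1/2 \<and> piece j s \<in> \<phi> ` K \<and> s \<notin> W j True \<union> W j False}"
      then obtain t where t: "t \<in> k" "piece j s = c t" unfolding \<phi>K by auto
      have "e t = s" using e[OF t(1)] t(2) circ_piece[of s j] s by simp
      with t s have tk: "t \<in> kk j" by (simp add: kk_def)
      have "t \<notin> A j True" "t \<notin> A j False" using s \<open>e t = s\<close> by (auto simp: W_def)
      then have "t \<in> ?B" using good[OF tk] tk t(1) by blast
      with \<open>e t = s\<close> show "s \<in> e ` ?B" by blast
    qed
    ultimately show ?thesis by (rule negligible_subset)
  qed
  have W5: "chart_current 1 K \<phi> \<theta> (\<lambda>_. 1) [\<lambda>x. F (circ x 0)] =
       (\<Sum>j<3. (\<integral>s. indicator (W j True) s * w s \<partial>lebesgue) - (\<integral>s. indicator (W j False) s * w s \<partial>lebesgue))"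
    if FL: "L'-lipschitz_on UNIV F" and D: "finite D"
      and Fw: "\<And>x. x \<notin> D \<Longrightarrow> (F has_field_derivative w x) (at x)"
      and w: "w \<in> borel_measurable borel" "\<And>x. \<bar>w x\<bar> \<le> B" for F w D B L'
  proof -
    obtain h M' where hL: "M'-lipschitz_on UNIV h" and h: "\<And>t. t \<in> k \<Longrightarrow> h t = F (circ (c t) 0)"
      and ch: "chart_current 1 K \<phi> \<theta> (\<lambda>_. 1) [\<lambda>x. F (circ x 0)] =
        (LBINT t. indicator k t * of_int (\<theta>' t) * deriv h t)"
      by (rule chart_current_1[OF K bl \<theta> lipschitz_comp_circ[OF FL, of 0]]) (auto simp: k_def c_def \<theta>'_def)
    note [measurable] = borel_measurable_deriv[OF lipschitz_on_continuous_on[OF hL]]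
    let ?g = "\<lambda>j \<sigma> t. indicator (A j \<sigma>) t * (\<bar>deriv e t\<bar> * w (e t)) :: real"
    note area = lebesgue_area_formula[OF Am A_D A_inj A_bnd w]
    have a3: "(\<integral>t. ?g j \<sigma> t \<partial>lebesgue) = (\<integral>s. indicator (W j \<sigma>) s * w s \<partial>lebesgue)" for j \<sigma>
      unfolding W_def by (rule area(3))
    \<comment> \<open>Parameters over the ends of the fold belong to no piece; injectivity of the
      chart makes them finitely many.\<close>
    have fin1: "finite {t \<in> k. c t \<in> {x \<in> double_carrier. circ x 0 = 0 \<or> circ x 0 = 1/2}}"
    proof (rule finite_imageD)
      show "finite (c ` {t \<in> k. c t \<in> {x \<in> double_carrier. circ x 0 = 0 \<or> circ x 0 = 1/2}})"
        by (rule finite_subset[OF _ finite_circ_zero_boundary]) auto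
      show "inj_on c {t \<in> k. c t \<in> {x \<in> double_carrier. circ x 0 = 0 \<or> circ x 0 = 1/2}}"
        using c_inj by (intro inj_onI) auto
    qed
    have fin2: "finite {t \<in> kk j. e t \<in> D}" for j
    proof (rule finite_imageD)
      show "finite (e ` {t \<in> kk j. e t \<in> D})" by (rule finite_subset[OF _ D]) auto
      show "inj_on e {t \<in> kk j. e t \<in> D}" using kk_inj by (rule inj_on_subset) auto
    qed
    have negh: "negligible {t. \<not> (h has_field_derivative deriv h t) (at t)}"
      by (rule negligible_AE_lborel[OF lipschitz_real_has_derivative_AE[OF hL]])
    have iso3: "negligible (\<Union>j<3. {t \<in> kk j. \<not> t islimpt kk j} \<union> {t \<in> kk j. e t \<in> D})"
    proof (rule negligible_Union)
      fix t assume "t \<in> (\<lambda>j. {t \<in> kk j. \<not> t islimpt kk j} \<union> {t \<in> kk j. e t \<in> D}) ` {..<3}"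
      then show "negligible t" using negligible_Un[OF iso negligible_finite[OF fin2]] by blast
    qed simp
    have meas1: "(\<lambda>t. indicator k t * of_int (\<theta>' t) * deriv h t) \<in> borel_measurable lborel"
      by measurable
    have "AE t in lebesgue. indicator k t * of_int (\<theta>' t) * deriv h t = (\<Sum>j<3. ?g j True t - ?g j False t)"
      using AE_lebesgue_not_in[OF one'] AE_lebesgue_not_in[OF N] AE_lebesgue_not_in[OF negh]
        AE_lebesgue_not_in[OF iso3] AE_lebesgue_not_in[OF negligible_finite[OF fin1]]
    proof eventually_elim
      case (elim t)
      show ?case
      proof (cases "t \<in> k")
        case False
        then have "t \<notin> A j \<sigma>" for j \<sigma> using A_sub kk_sub by blast
        with False show ?thesis by simp
      next
        case True
        have "e t \<noteq> 0" "e t \<noteq> 1/2" using elim(5) True c_in[OF True] e[OF True] by auto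
        then obtain i where i: "i < 3" "t \<in> kk i" using kk_cases[OF True] by blast
        then have lim: "t islimpt kk i" and eD: "e t \<notin> D" using elim(4) by auto
        have th1: "\<bar>\<theta>' t\<bar> = 1" using elim(1) True by blast
        have eder: "(e has_field_derivative deriv e t) (at t)" using elim(2) by (simp add: N_def)
        \<comment> \<open>The extensions \<open>h\<close> and \<open>e\<close> were chosen
          independently, so \<open>h\<close> and the composition of \<open>F\<close> with
          \<open>e\<close> are known to agree on the chart domain only; a limit point
          suffices.\<close>
        have "deriv h t = w (e t) * deriv e t"
        proof (rule derivative_eq_at_limit_point[where S="kk i"])
          show "(h has_field_derivative deriv h t) (at t)" using elim(3) by simp
          show "((\<lambda>t. F (e t)) has_field_derivative w (e t) * deriv e t) (at t)"
            using DERIV_chain2[OF Fw[OF eD] eder] by simp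
          show "h s = F (e s)" if "s \<in> kk i" for s
          proof -
            have "s \<in> k" using that kk_sub by blast
            then show ?thesis using h[of s] e[of s] by simp
          qed
        qed (use i lim in auto)
        then have lhs: "indicator k t * of_int (\<theta>' t) * deriv h t = (of_int (\<theta>' t) * deriv e t) * w (e t)"
          using True by simp
        have gi: "?g i True t - ?g i False t = (of_int (\<theta>' t) * deriv e t) * w (e t)"
        proof -
          have th: "\<bar>of_int (\<theta>' t)\<bar> = (1::real)" using th1 by (metis of_int_1 of_int_abs)
          then have ab: "\<bar>of_int (\<theta>' t) * deriv e t\<bar> = \<bar>deriv e t\<bar>" by (simp add: abs_mult)
          show ?thesis
            using good[OF i(2) lim elim(2) th1]
          proof
            assume a: "t \<in> A i True"
            then have p: "0 < of_int (\<theta>' t) * deriv e t" by (simp add: A_def pos_def)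
            then have "t \<notin> A i False" by (simp add: A_def pos_def)
            with a p ab show ?thesis by (simp only: indicator_simps) simp
          next
            assume a: "t \<in> A i False"
            then have p: "of_int (\<theta>' t) * deriv e t < 0" by (simp add: A_def pos_def)
            then have "t \<notin> A i True" by (simp add: A_def pos_def)
            moreover have "\<bar>deriv e t\<bar> = - (of_int (\<theta>' t) * deriv e t)" using p ab by linarith
            ultimately show ?thesis using a by simp
          qed
        qed
        have "?g j True t - ?g j False t = (if j = i then (of_int (\<theta>' t) * deriv e t) * w (e t) else 0)"
          if "j \<in> {..<3}" for j
        proof (cases "j = i")
          case False
          then have "t \<notin> A j \<sigma>" for \<sigma> using kk_disj[of t i j] i that A_sub by auto
          with False show ?thesis by simp
        qed (use gi in simp)
        then have "(\<Sum>j<3. ?g j True t - ?g j False t) =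
            (\<Sum>j<3. if j = i then (of_int (\<theta>' t) * deriv e t) * w (e t) else 0)"
          by (intro sum.cong refl)
        also have "\<dots> = (of_int (\<theta>' t) * deriv e t) * w (e t)"
          using i(1) by (simp add: sum.delta)
        finally show ?thesis using lhs by simp
      qed
    qed
    moreover have "(\<lambda>t. \<Sum>j<3. ?g j True t - ?g j False t) \<in> borel_measurable lebesgue"
      using area(2) by (intro borel_measurable_sum borel_measurable_diff borel_measurable_integrable)
    ultimately have "(\<integral>t. indicator k t * of_int (\<theta>' t) * deriv h t \<partial>lebesgue) =
        (\<integral>t. (\<Sum>j<3. ?g j True t - ?g j False t) \<partial>lebesgue)"
      using measurable_completion[OF meas1] by (intro integral_cong_AE)
    also have "\<dots> = (\<Sum>j<3. (\<integral>t. ?g j True t \<partial>lebesgue) - (\<integral>t. ?g j False t \<partial>lebesgue))"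
      using area(2) by (subst Bochner_Integration.integral_sum) auto
    also have "\<dots> = (\<Sum>j<3. (\<integral>s. indicator (W j True) s * w s \<partial>lebesgue) - (\<integral>s. indicator (W j False) s * w s \<partial>lebesgue))"
      by (simp only: a3)
    also have "(\<integral>t. indicator k t * of_int (\<theta>' t) * deriv h t \<partial>lebesgue) = (LBINT t. indicator k t * of_int (\<theta>' t) * deriv h t)"
      using meas1 by (rule integral_completion)
    finally show ?thesis unfolding ch .
  qed
  show ?thesis
    unfolding chart_folds_def using W1 W2 W3 W4 W5 by (intro exI[of _ W]) blast
qed

section \<open>Ramp functions and the parity contradiction\<close>

lemma integrable_indicator_Icc: "integrable lebesgue (\<lambda>s. C * indicator {a..b::real} s :: real)"
  by (intro integrable_mult_right integrable_real_indicator) (auto simp: emeasure_lborel_Icc_eq)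

lemma ramp_lipschitz:
  assumes "0 < h"
  shows "(1/h)-lipschitz_on UNIV (\<lambda>x::real. max 0 (min 1 ((x - a) / h)))"
proof (rule lipschitz_onI)
  fix x y :: real
  have "\<bar>max 0 (min 1 ((x - a) / h)) - max 0 (min 1 ((y - a) / h))\<bar> \<le> \<bar>(x - a) / h - (y - a) / h\<bar>"
    by linarith
  also have "\<dots> = (1/h) * \<bar>x - y\<bar>"
  proof -
    have "(x - a) / h - (y - a) / h = (x - y) / h" by (simp add: diff_divide_distrib)
    then show ?thesis using assms by (simp add: abs_divide)
  qed
  finally show "dist (max 0 (min 1 ((x - a) / h))) (max 0 (min 1 ((y - a) / h))) \<le> (1/h) * dist x y"
    unfolding dist_real_def .
qed (use assms in simp)

lemma ramp_derivative:
  assumes h: "0 < h" and x: "x \<noteq> a" "x \<noteq> a + h"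
  shows "((\<lambda>x::real. max 0 (min 1 ((x - a) / h))) has_field_derivative indicator {a..a + h} x / h) (at x)"
proof -
  consider "x < a" | "a < x" "x < a + h" | "a + h < x" using x by linarith
  then show ?thesis
  proof cases
    case 1
    have "((\<lambda>x::real. max 0 (min 1 ((x - a) / h))) has_field_derivative 0) (at x)"
      by (rule has_field_derivative_transform_within_open[where S="{..<a}" and f="\<lambda>_. 0"])
        (use 1 h in \<open>auto simp: max_def min_def divide_le_0_iff zero_le_divide_iff\<close>)
    with 1 show ?thesis by simp
  next
    case 2
    have "((\<lambda>x::real. max 0 (min 1 ((x - a) / h))) has_field_derivative 1 / h) (at x)"
      by (rule has_field_derivative_transform_within_open[where S="{a<..<a + h}" and f="\<lambda>x. (x - a) / h"])
        (use 2 h in \<open>auto intro!: derivative_eq_intros simp: max_def min_def field_simps\<close>)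
    with 2 show ?thesis by simp
  next
    case 3
    have "((\<lambda>x::real. max 0 (min 1 ((x - a) / h))) has_field_derivative 0) (at x)"
      by (rule has_field_derivative_transform_within_open[where S="{a + h<..}" and f="\<lambda>_. 1"])
        (use 3 h in \<open>auto simp: max_def min_def field_simps\<close>)
    with 3 show ?thesis by simp
  qed
qed

lemma negligible_interval_avoid:
  fixes a b :: real
  assumes "negligible N" "a < b"
  obtains x where "a < x" "x < b" "x \<notin> N"
proof -
  have "\<not> {a<..<b} \<subseteq> N"
  proof
    assume "{a<..<b} \<subseteq> N"
    then have "negligible {a<..<b}" using assms(1) negligible_subset by blast
    then show False using assms(2) open_not_negligible[of "{a<..<b}"] by auto
  qed
  then obtain x where "x \<in> {a<..<b}" "x \<notin> N" by blast
  then show ?thesis using that[of x] by simp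
qed

text \<open>Below, \<open>b\<close> is the signed number of sheets of \<open>S\<close> over the fold. Testing \<open>\<partial>S\<close> with trapezoids
  around the end \<open>v\<close> of a gap shows that \<open>b\<close> has the same averages on both sides of \<open>v\<close>.\<close>

theorem double_circle_no_multiplicity_one:
  assumes S: "S \<in> integral_currents 1 double_circle"
    and mult: "multiplicity_one_ae 1 double_circle S (mspace double_circle)"
  shows False
proof -
  obtain \<Theta> where \<Theta>: "is_multiplicity 1 double_circle S \<Theta>"
    and \<Theta>_null: "hausdorff 1 double_circle {x \<in> double_carrier. \<Theta> x \<noteq> 1} = 0"
    using mult unfolding multiplicity_one_ae_def by auto
  obtain K \<phi> \<theta> where rep: "rectifiable_representation 1 double_circle S K \<phi> \<theta>"
    and \<Theta>1: "\<And>i y. y \<in> K i \<Longrightarrow> \<Theta> (\<phi> i y) = nat \<bar>\<theta> i y\<bar>"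
    and \<Theta>0: "\<And>x. x \<in> double_carrier \<Longrightarrow> x \<notin> (\<Union>i. \<phi> i ` K i) \<Longrightarrow> \<Theta> x = 0"
    using \<Theta> unfolding is_multiplicity_def mspace_double_circle by (metis Diff_iff)
  have K: "compactin (mtopology_of (euclid 1)) (K i)" and bl: "bilipschitz_on (euclid 1) double_circle (K i) (\<phi> i)"
    and \<theta>: "integrable (leb 1) (\<lambda>x. of_int (\<theta> i x) :: real)" for i
    using rep unfolding rectifiable_representation_def by auto
  have disj: "disjoint_family (\<lambda>i. \<phi> i ` K i)"
    and sums: "\<And>f \<pi>. test_form 1 double_circle f \<pi> \<Longrightarrow> (\<lambda>i. chart_current 1 (K i) (\<phi> i) (\<theta> i) f \<pi>) sums S f \<pi>"
    using rep unfolding rectifiable_representation_def by auto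
  have \<phi>_in: "\<phi> i ` K i \<subseteq> double_carrier" for i
    using bl[of i] unfolding bilipschitz_on_def by simp
  \<comment> \<open>The lower bi-Lipschitz bound pulls the Hausdorff null set of wrong multiplicity
    back to a negligible set of parameters.\<close>
  have one: "negligible {t. euclid_pt t \<in> K i \<and> \<bar>\<theta> i (euclid_pt t)\<bar> \<noteq> 1}" for i
  proof -
    obtain L where L: "L > 0" "\<And>x y. x \<in> K i \<Longrightarrow> y \<in> K i \<Longrightarrow> mdist (euclid 1) x y / L \<le> mdist double_circle (\<phi> i x) (\<phi> i y)"
      using bl[of i] unfolding bilipschitz_on_def by blast
    show ?thesis
    proof (rule hausdorff_null_negligible_preimage[OF _ _ _ \<Theta>_null, where L=L and g="\<lambda>t. \<phi> i (euclid_pt t)"])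
      fix s t assume "s \<in> {t. euclid_pt t \<in> K i \<and> \<bar>\<theta> i (euclid_pt t)\<bar> \<noteq> 1}"
        "t \<in> {t. euclid_pt t \<in> K i \<and> \<bar>\<theta> i (euclid_pt t)\<bar> \<noteq> 1}"
      then show "\<bar>s - t\<bar> \<le> L * mdist double_circle (\<phi> i (euclid_pt s)) (\<phi> i (euclid_pt t))"
        using L(2)[of "euclid_pt s" "euclid_pt t"] L(1)
        by (simp add: mdist_euclid_1 divide_le_eq mult.commute del: mdist_euclid)
    next
      show "(\<lambda>t. \<phi> i (euclid_pt t)) ` {t. euclid_pt t \<in> K i \<and> \<bar>\<theta> i (euclid_pt t)\<bar> \<noteq> 1} \<subseteq> {x \<in> double_carrier. \<Theta> x \<noteq> 1}"
        using \<phi>_in[of i] \<Theta>1[of _ i] by (auto simp: nat_eq_iff)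
    qed (use L(1) in simp)
  qed
  obtain W where W: "\<And>i. chart_folds (K i) (\<phi> i) (\<theta> i) (W i)"
    using chart_folds_exist[OF K bl \<theta> one] by metis
  have Wm: "W i j \<sigma> \<in> sets lebesgue" for i j \<sigma>
    using W[of i] unfolding chart_folds_def by blast
  have Win: "0 < s" "s < 1/2" "piece j s \<in> \<phi> i ` K i" if "s \<in> W i j \<sigma>" for i j \<sigma> s
    using W[of i] that unfolding chart_folds_def by blast+
  have Wdisj: "W i j True \<inter> W i j False = {}" for i j
    using W[of i] unfolding chart_folds_def by blast
  have Wneg: "negligible {s. 0 < s \<and> s < 1/2 \<and> piece j s \<in> \<phi> i ` K i \<and> s \<notin> W i j True \<union> W i j False}" for i j
    using W[of i] unfolding chart_folds_def by blast
  have Wint: "chart_current 1 (K i) (\<phi> i) (\<theta> i) (\<lambda>_. 1) [\<lambda>x. F (circ x 0)] =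
      (\<Sum>j<3. (\<integral>s. indicator (W i j True) s * w s \<partial>lebesgue) - (\<integral>s. indicator (W i j False) s * w s \<partial>lebesgue))"
    if "L-lipschitz_on UNIV F" "finite D" "\<And>x. x \<notin> D \<Longrightarrow> (F has_field_derivative w x) (at x)"
      "w \<in> borel_measurable borel" "\<And>x. \<bar>w x\<bar> \<le> B" for i F w D B L
    using W[of i] that unfolding chart_folds_def by blast
  have Wi: "i = i'" if "s \<in> W i j \<sigma>" "s \<in> W i' j \<sigma>'" for i i' j \<sigma> \<sigma>' s
    using disj Win(3)[OF that(1)] Win(3)[OF that(2)] unfolding disjoint_family_on_def by blast
  \<comment> \<open>The part of sheet \<open>j\<close> that \<open>S\<close> covers with orientation
    \<open>\<sigma>\<close>. Since chart images are disjoint, a position belongs to at most one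
    chart per sheet, so orientations of different charts do not conflict either.\<close>
  define V where "V j \<sigma> = (\<Union>i. W i j \<sigma>)" for j \<sigma>
  have Vm[measurable]: "V j \<sigma> \<in> sets lebesgue" for j \<sigma>
    unfolding V_def using Wm by auto
  have V_disj: "V j True \<inter> V j False = {}" for j
    using Wi Wdisj unfolding V_def by blast
  have V_sub: "V j \<sigma> \<subseteq> {0<..<1/2}" for j \<sigma>
    using Win unfolding V_def by auto
  define b where "b s = (\<Sum>j<3. indicator (V j True) s - indicator (V j False) s :: real)" for s
  have bm[measurable]: "b \<in> borel_measurable lebesgue"
    unfolding b_def by measurable
  have b_le: "\<bar>b s\<bar> \<le> 3" for s
  proof -
    have "\<bar>b s\<bar> \<le> (\<Sum>j<3. \<bar>indicator (V j True) s - indicator (V j False) s :: real\<bar>)"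
      unfolding b_def by (rule sum_abs)
    also have "\<dots> \<le> (\<Sum>j<3::nat. 1)"
      by (intro sum_mono) (auto simp: indicator_def)
    finally show ?thesis by simp
  qed
  have S_eq: "S (\<lambda>_. 1) [\<lambda>x. F (circ x 0)] = (\<integral>s. b s * w s \<partial>lebesgue)"
    if F: "L-lipschitz_on UNIV F" "finite D" "\<And>x. x \<notin> D \<Longrightarrow> (F has_field_derivative w x) (at x)"
      "w \<in> borel_measurable borel" "\<And>x. \<bar>w x\<bar> \<le> B" for F w D B L
  proof -
    have wm[measurable]: "w \<in> borel_measurable lebesgue" using F(4) by (simp add: measurable_completion)
    have B0: "0 \<le> B" using F(5)[of 0] by linarith
    have sub: "indicator A s * w s = indicator {0..1/2} s * (indicator A s * w s)" if "A \<subseteq> {0<..<1/2}" for A s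
      using that by (auto simp: indicator_def)
    have int: "integrable lebesgue (\<lambda>s. indicator A s * w s)" if A: "A \<in> sets lebesgue" "A \<subseteq> {0<..<1/2}" for A
    proof (rule Bochner_Integration.integrable_bound)
      show "integrable lebesgue (\<lambda>s. B * indicator {0..1/2::real} s)"
        by (rule integrable_indicator_Icc)
      show "(\<lambda>s. indicator A s * w s) \<in> borel_measurable lebesgue"
        using A(1) by measurable
      show "AE s in lebesgue. norm (indicator A s * w s) \<le> norm (B * indicator {0..1/2} s)"
        using A(2) F(5) B0 by (intro AE_I2) (auto simp: indicator_def)
    qed
    have Wsub: "W i j \<sigma> \<subseteq> {0<..<1/2}" for i j \<sigma> using Win by auto
    define \<beta> where "\<beta> i s = (\<Sum>j<3. indicator (W i j True) s - indicator (W i j False) s :: real)" for i s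
    have \<beta>m[measurable]: "\<beta> i \<in> borel_measurable lebesgue" for i
      unfolding \<beta>_def using Wm by (intro borel_measurable_sum borel_measurable_diff borel_measurable_indicator)
    have \<beta>w: "\<beta> i s * w s = (\<Sum>j<3. indicator (W i j True) s * w s - indicator (W i j False) s * w s)" for i s
      by (simp add: \<beta>_def sum_distrib_right left_diff_distrib)
    have \<beta>int: "integrable lebesgue (\<lambda>s. \<beta> i s * w s)" for i
      unfolding \<beta>w using int[OF Wm Wsub] by (intro Bochner_Integration.integrable_sum Bochner_Integration.integrable_diff)
    have chart: "chart_current 1 (K i) (\<phi> i) (\<theta> i) (\<lambda>_. 1) [\<lambda>x. F (circ x 0)] = (\<integral>s. \<beta> i s * w s \<partial>lebesgue)" for i
    proof -
      have "(\<integral>s. \<beta> i s * w s \<partial>lebesgue) =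
          (\<Sum>j<3. (\<integral>s. indicator (W i j True) s * w s \<partial>lebesgue) - (\<integral>s. indicator (W i j False) s * w s \<partial>lebesgue))"
        unfolding \<beta>w using int[OF Wm Wsub]
        by (subst Bochner_Integration.integral_sum) (auto intro: Bochner_Integration.integrable_diff)
      also have "\<dots> = chart_current 1 (K i) (\<phi> i) (\<theta> i) (\<lambda>_. 1) [\<lambda>x. F (circ x 0)]"
        by (rule Wint[OF F, symmetric])
      finally show ?thesis by (rule sym)
    qed
    have partial: "(\<Sum>i<n. indicator (W i j \<sigma>) s) = (indicator (\<Union>i<n. W i j \<sigma>) s :: real)" for n j \<sigma> s
    proof -
      have "disjoint_family_on (\<lambda>i. W i j \<sigma>) {..<n}"
        unfolding disjoint_family_on_def using Wi by blast
      then show ?thesis by (intro indicator_UN_disjoint[symmetric]) auto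
    qed
    have partial\<beta>: "(\<Sum>i<n. \<beta> i s) = (\<Sum>j<3. indicator (\<Union>i<n. W i j True) s - indicator (\<Union>i<n. W i j False) s)" for n s
      unfolding \<beta>_def by (subst sum.swap) (simp add: sum_subtractf partial)
    \<comment> \<open>Disjointness of the charts bounds every partial sum by \<open>3\<close>, one
      for each sheet; hence dominated convergence applies without any bound on the number of
      charts.\<close>
    have "(\<lambda>n. \<integral>s. (\<Sum>i<n. \<beta> i s) * w s \<partial>lebesgue) \<longlonglongrightarrow> (\<integral>s. b s * w s \<partial>lebesgue)"
    proof (rule integral_dominated_convergence)
      show "integrable lebesgue (\<lambda>s. 3 * B * indicator {0..1/2::real} s)"
        by (rule integrable_indicator_Icc)
      show "AE s in lebesgue. (\<lambda>n. (\<Sum>i<n. \<beta> i s) * w s) \<longlonglongrightarrow> b s * w s"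
      proof (rule AE_I2)
        fix s
        have "(\<lambda>n. indicator (\<Union>i<n. W i j \<sigma>) s :: real) \<longlonglongrightarrow> indicator (V j \<sigma>) s" for j \<sigma>
          unfolding V_def by (rule LIMSEQ_indicator_UN)
        then show "(\<lambda>n. (\<Sum>i<n. \<beta> i s) * w s) \<longlonglongrightarrow> b s * w s"
          unfolding partial\<beta> b_def by (intro tendsto_intros)
      qed
      show "AE s in lebesgue. norm ((\<Sum>i<n. \<beta> i s) * w s) \<le> 3 * B * indicator {0..1/2} s" for n
      proof (rule AE_I2)
        fix s
        show "norm ((\<Sum>i<n. \<beta> i s) * w s) \<le> 3 * B * indicator {0..1/2} s"
        proof (cases "s \<in> {0..1/2}")
          case True
          have "\<bar>\<Sum>i<n. \<beta> i s\<bar> \<le> (\<Sum>j<3. \<bar>indicator (\<Union>i<n. W i j True) s - indicator (\<Union>i<n. W i j False) s :: real\<bar>)"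
            unfolding partial\<beta> by (rule sum_abs)
          also have "\<dots> \<le> (\<Sum>j<3::nat. 1)" by (intro sum_mono) (auto simp: indicator_def)
          finally have "\<bar>\<Sum>i<n. \<beta> i s\<bar> \<le> 3" by simp
          then have "\<bar>\<Sum>i<n. \<beta> i s\<bar> * \<bar>w s\<bar> \<le> 3 * B" using F(5) by (intro mult_mono) auto
          with True show ?thesis by (simp add: abs_mult)
        next
          case False
          then have "s \<notin> W i j \<sigma>" for i j \<sigma> using Wsub[of i j \<sigma>] by auto
          then have "\<beta> i s = 0" for i by (simp add: \<beta>_def)
          with False show ?thesis by simp
        qed
      qed
    qed measurable
    moreover have "(\<integral>s. (\<Sum>i<n. \<beta> i s) * w s \<partial>lebesgue) = (\<Sum>i<n. \<integral>s. \<beta> i s * w s \<partial>lebesgue)" for n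
      unfolding sum_distrib_right using \<beta>int by (intro Bochner_Integration.integral_sum)
    ultimately have "(\<lambda>i. \<integral>s. \<beta> i s * w s \<partial>lebesgue) sums (\<integral>s. b s * w s \<partial>lebesgue)"
      by (simp add: sums_def)
    moreover have "test_form 1 double_circle (\<lambda>_. 1) [\<lambda>x. F (circ x 0)]"
      using lipschitz_comp_circ[OF F(1)] by (auto simp: test_form_1_iff image_constant_conv)
    from sums[OF this] have "(\<lambda>i. \<integral>s. \<beta> i s * w s \<partial>lebesgue) sums S (\<lambda>_. 1) [\<lambda>x. F (circ x 0)]"
      unfolding chart .
    ultimately show ?thesis using sums_unique2 by blast
  qed
  \<comment> \<open>Positions over which an existing sheet has multiplicity other than one, or is
    reached by a chart without being recorded with an orientation.\<close>
  define Bad where "Bad = (\<Union>j<3::nat. {s \<in> {0<..<1/2}. piece j s \<in> double_carrier \<and> \<Theta> (piece j s) \<noteq> 1} \<union>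
      (\<Union>i. {s. 0 < s \<and> s < 1/2 \<and> piece j s \<in> \<phi> i ` K i \<and> s \<notin> W i j True \<union> W i j False}))"
  have Bad: "negligible Bad"
    unfolding Bad_def
  proof (rule negligible_Union)
    have "negligible {s \<in> {0<..<1/2}. piece j s \<in> double_carrier \<and> \<Theta> (piece j s) \<noteq> 1}" for j
      by (rule hausdorff_null_negligible_preimage[OF _ _ _ \<Theta>_null, where L=1 and g="piece j"])
        (auto simp: mdist_piece)
    then have "negligible ({s \<in> {0<..<1/2}. piece j s \<in> double_carrier \<and> \<Theta> (piece j s) \<noteq> 1} \<union>
      (\<Union>i. {s. 0 < s \<and> s < 1/2 \<and> piece j s \<in> \<phi> i ` K i \<and> s \<notin> W i j True \<union> W i j False}))" for j
      by (intro negligible_Un negligible_Union_nat Wneg)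
    then show "negligible t" if "t \<in> (\<lambda>j::nat. {s \<in> {0<..<1/2}. piece j s \<in> double_carrier \<and> \<Theta> (piece j s) \<noteq> 1} \<union>
      (\<Union>i. {s. 0 < s \<and> s < 1/2 \<and> piece j s \<in> \<phi> i ` K i \<and> s \<notin> W i j True \<union> W i j False})) ` {..<3}" for t
      using that by blast
  qed simp
  have sheet: "\<bar>indicator (V j True) s - indicator (V j False) s\<bar> = (1::real)"
    if s: "0 < s" "s < 1/2" "s \<notin> Bad" "j < 3" and j: "piece j s \<in> double_carrier" for j s
  proof -
    have "\<Theta> (piece j s) = 1" using s j by (auto simp: Bad_def)
    then have "piece j s \<in> (\<Union>i. \<phi> i ` K i)" using \<Theta>0[OF j] by auto
    then obtain i where i: "piece j s \<in> \<phi> i ` K i" by blast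
    then have "s \<in> W i j True \<or> s \<in> W i j False" using s by (auto simp: Bad_def)
    then have "s \<in> V j True \<or> s \<in> V j False" by (auto simp: V_def)
    then show ?thesis using V_disj[of j] by (auto simp: indicator_def)
  qed
  \<comment> \<open>Two signs have an even sum and three signs an odd one, whatever the orientations
    are, so the two values differ by at least 1.\<close>
  have b_parity: "1 \<le> \<bar>b s - b t\<bar>"
    if s: "0 < s" "s < 1/2" "s \<notin> Bad" "s \<in> junction" and t: "0 < t" "t < 1/2" "t \<notin> Bad" "t \<notin> junction" for s t
  proof -
    have b3: "b u = (indicator (V 0 True) u - indicator (V 0 False) u) +
        (indicator (V 1 True) u - indicator (V 1 False) u) + (indicator (V 2 True) u - indicator (V 2 False) u)" for u
      by (simp add: b_def numeral_3_eq_3 numeral_2_eq_2)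
    \<comment> \<open>Over a glued position \<open>1 + s\<close> is not a code, so no chart can
      reach this sheet.\<close>
    have "s \<notin> V 1 \<sigma>" for \<sigma>
      using Win(3)[of s _ 1 \<sigma>] \<phi>_in piece_in[OF s(1,2), of 1] s(4) unfolding V_def by blast
    then have "indicator (V 1 True) s - indicator (V 1 False) s = (0::real)" by simp
    moreover have "\<bar>indicator (V 0 True) s - indicator (V 0 False) s\<bar> = (1::real)"
      "\<bar>indicator (V 2 True) s - indicator (V 2 False) s\<bar> = (1::real)"
      using s piece_in[OF s(1,2)] by (intro sheet; simp)+
    moreover have "\<bar>indicator (V 0 True) t - indicator (V 0 False) t\<bar> = (1::real)"
      "\<bar>indicator (V 1 True) t - indicator (V 1 False) t\<bar> = (1::real)"
      "\<bar>indicator (V 2 True) t - indicator (V 2 False) t\<bar> = (1::real)"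
      using t piece_in[OF t(1,2)] by (intro sheet; simp)+
    ultimately show ?thesis unfolding b3 by (smt (verit))
  qed
  have "integer_rectifiable 0 double_circle (current_boundary S)"
    using S by (simp add: integral_currents_def)
  then obtain P m where P: "finite P" "P \<subseteq> double_carrier"
    and bd: "\<And>f. test_form 0 double_circle f [] \<Longrightarrow> current_boundary S f [] = (\<Sum>x\<in>P. of_int (m x) * f x)"
    unfolding integer_rectifiable_def by auto
  define R where "R = (\<lambda>x. circ x 0) ` P"
  have "finite R" using P(1) by (simp add: R_def)
  have "inj (\<lambda>k. (1/4::real)^Suc k)"
    by (intro injI) (simp add: power_inject_exp')
  then have "infinite (range (\<lambda>k. (1/4::real)^Suc k))" by (rule range_inj_infinite)
  then have "\<not> range (\<lambda>k. (1/4::real)^Suc k) \<subseteq> R" using \<open>finite R\<close> finite_subset by blast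
  then obtain k where k: "(1/4)^Suc k \<notin> R" by blast
  define v where "v = (1/4::real)^Suc k"
  have v: "0 < v" "v \<le> 1/4" unfolding v_def by (rule gap_width)+
  obtain d where d: "d > 0" "\<And>x. x \<in> R \<Longrightarrow> x \<noteq> v \<Longrightarrow> d \<le> dist v x"
    using finite_set_avoid[OF \<open>finite R\<close>, of v] by blast
  \<comment> \<open>The bound \<open>v / 2\<close> keeps the left window above the next smaller gap
    and the right window inside the gap, which ends at \<open>2 * v\<close>. The bound
    \<open>d\<close> keeps the window free of folded atoms of the boundary.\<close>
  define \<epsilon> where "\<epsilon> = min (v / 2) d"
  have \<epsilon>: "0 < \<epsilon>" "\<epsilon> \<le> v / 2" using d(1) v by (auto simp: \<epsilon>_def)
  have R_far: "\<epsilon> \<le> \<bar>x - v\<bar>" if "x \<in> R" for x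
  proof -
    have "x \<noteq> v" using k that unfolding v_def by metis
    then have "d \<le> \<bar>x - v\<bar>" using d(2)[OF that] by (simp add: dist_real_def abs_minus_commute)
    then show ?thesis by (simp add: \<epsilon>_def)
  qed
  have b_abs: "b absolutely_integrable_on {x..y}" for x y
    unfolding set_integrable_def
  proof (rule Bochner_Integration.integrable_bound)
    show "integrable lebesgue (\<lambda>s. 3 * indicator {x..y} s :: real)"
      by (rule integrable_indicator_Icc)
    show "(\<lambda>s. indicat_real {x..y} s *\<^sub>R b s) \<in> borel_measurable lebesgue"
      using bm by (intro borel_measurable_scaleR borel_measurable_indicator) auto
    show "AE s in lebesgue. norm (indicat_real {x..y} s *\<^sub>R b s) \<le> norm (3 * indicator {x..y} s :: real)"
      using b_le by (intro AE_I2) (auto simp: indicator_def)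
  qed
  then have b_int: "b integrable_on cbox x y" for x y
    by (simp add: set_lebesgue_integral_eq_integral(1))
  obtain N where N: "negligible N" and leb: "\<And>x e. x \<notin> N \<Longrightarrow> 0 < e \<Longrightarrow>
      \<exists>d>0. \<forall>h. 0 < h \<and> h < d \<longrightarrow> norm (integral (cbox x (x + h *\<^sub>R One)) b /\<^sub>R h ^ DIM(real) - b x) < e"
    using integrable_ccontinuous_explicit[of b, OF b_int] by blast
  have NB: "negligible (N \<union> Bad)" using N Bad by (rule negligible_Un)
  \<comment> \<open>Lebesgue points of \<open>b\<close> on either side of \<open>v\<close>. Short
    averages at them deviate by less than \<open>1/2\<close> from values that differ by at least 1,
    so the two averages cannot coincide.\<close>
  obtain a where a: "v - \<epsilon> < a" "a < v" "a \<notin> N \<union> Bad"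
    using negligible_interval_avoid[OF NB, of "v - \<epsilon>" v] \<epsilon>(1) by auto
  obtain c where c: "v < c" "c < v + \<epsilon>" "c \<notin> N \<union> Bad"
    using negligible_interval_avoid[OF NB, of v "v + \<epsilon>"] \<epsilon>(1) by auto
  have "a \<in> junction" using junction_left[of k a] a \<epsilon> by (simp add: v_def)
  moreover have "c \<notin> junction" using not_junction_right[of k c] c \<epsilon> v by (simp add: v_def)
  ultimately have par: "1 \<le> \<bar>b a - b c\<bar>" using a c \<epsilon> v by (intro b_parity) auto
  have leb': "\<exists>d>0. \<forall>h. 0 < h \<longrightarrow> h < d \<longrightarrow> \<bar>integral {x..x + h} b / h - b x\<bar> < 1/2" if x: "x \<notin> N" for x
  proof -
    have eq: "integral (cbox x (x + h *\<^sub>R One)) b /\<^sub>R h ^ DIM(real) = integral {x..x + h} b / h" for h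
      by (simp add: divide_inverse mult.commute)
    show ?thesis
      using leb[OF x, of "1/2"] unfolding eq real_norm_def by (auto simp del: less_divide_eq_numeral1)
  qed
  obtain d1 where d1: "d1 > 0" "\<And>h. 0 < h \<Longrightarrow> h < d1 \<Longrightarrow> \<bar>integral {a..a + h} b / h - b a\<bar> < 1/2"
    using leb'[of a] a(3) by blast
  obtain d2 where d2: "d2 > 0" "\<And>h. 0 < h \<Longrightarrow> h < d2 \<Longrightarrow> \<bar>integral {c..c + h} b / h - b c\<bar> < 1/2"
    using leb'[of c] c(3) by blast
  define h where "h = min (min d1 d2) (min (v - a) (v + \<epsilon> - c)) / 2"
  have h: "0 < h" "h < d1" "h < d2" "a + h < v" "c + h < v + \<epsilon>"
    using d1(1) d2(1) a c by (auto simp: h_def min_def field_simps)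
  \<comment> \<open>The difference of two ramps rises over \<open>{a..a + h}\<close>, is
    \<open>1\<close> up to \<open>c\<close>, and falls over \<open>{c..c + h}\<close>. It vanishes
    at distance at least \<open>\<epsilon>\<close> from \<open>v\<close>, hence at all folded atoms,
    and its derivative compares an average of \<open>b\<close> near \<open>a\<close> with one near
    \<open>c\<close>.\<close>
  define F where "F x = max 0 (min 1 ((x - a) / h)) - max 0 (min 1 ((x - c) / h))" for x
  define w where "w x = indicator {a..a + h} x / h - indicator {c..c + h} x / h" for x :: real
  have FL: "(1/h + 1/h)-lipschitz_on UNIV F"
    unfolding F_def using ramp_lipschitz[OF h(1)] by (intro lipschitz_on_diff)
  have Fw: "(F has_field_derivative w x) (at x)" if "x \<notin> {a, a + h, c, c + h}" for x
    unfolding F_def w_def using that by (intro DERIV_diff ramp_derivative[OF h(1)]) auto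
  have wm: "w \<in> borel_measurable borel" unfolding w_def by measurable
  have w_le: "\<bar>w x\<bar> \<le> 1 / h" for x
    using h(1) by (auto simp: w_def indicator_def)
  have F0: "F x = 0" if x: "\<epsilon> \<le> \<bar>x - v\<bar>" for x
  proof (cases "x \<le> a")
    case True
    then have "(x - a) / h \<le> 0" "(x - c) / h \<le> 0" using h a c by (auto simp: divide_le_0_iff)
    then show ?thesis by (simp add: F_def max_def min_def)
  next
    case False
    then have "1 \<le> (x - a) / h" "1 \<le> (x - c) / h" using h a c x by (auto simp: le_divide_eq abs_if split: if_splits)
    then show ?thesis by (simp add: F_def max_def min_def)
  qed
  have "test_form 0 double_circle (\<lambda>x. F (circ x 0)) []"
  proof -
    have "\<bar>F x\<bar> \<le> 1" for x unfolding F_def by linarith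
    then show ?thesis
      using lipschitz_comp_circ[OF FL] by (auto simp: test_form_def bounded_iff)
  qed
  then have "S (\<lambda>_. 1) [\<lambda>x. F (circ x 0)] = (\<Sum>x\<in>P. of_int (m x) * F (circ x 0))"
    using bd[of "\<lambda>x. F (circ x 0)"] by (simp add: current_boundary_def)
  also have "\<dots> = 0"
    by (intro sum.neutral ballI) (simp add: F0 R_far R_def)
  finally have "(\<integral>s. b s * w s \<partial>lebesgue) = 0"
    using S_eq[of _ F "{a, a + h, c, c + h}" w, OF FL _ Fw wm w_le] by simp
  moreover have "(\<integral>s. b s * w s \<partial>lebesgue) = (integral {a..a + h} b - integral {c..c + h} b) / h"
  proof -
    have "(\<lambda>s. b s * w s) = (\<lambda>s. (indicator {a..a + h} s *\<^sub>R b s - indicator {c..c + h} s *\<^sub>R b s) / h)"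
      by (auto simp: w_def fun_eq_iff diff_divide_distrib right_diff_distrib mult.commute)
    then have "(\<integral>s. b s * w s \<partial>lebesgue) =
        ((\<integral>s. indicator {a..a + h} s *\<^sub>R b s \<partial>lebesgue) - (\<integral>s. indicator {c..c + h} s *\<^sub>R b s \<partial>lebesgue)) / h"
      using b_abs[of a "a + h"] b_abs[of c "c + h"] by (simp add: set_integrable_def)
    then show ?thesis
      using set_lebesgue_integral_eq_integral(2)[OF b_abs] by (simp add: set_lebesgue_integral_def)
  qed
  ultimately have "integral {a..a + h} b / h = integral {c..c + h} b / h"
    using h(1) by simp
  then show False
    using d1(2)[of h] d2(2)[of h] h par by linarith
qed

section \<open>The counterexample and the negative answer\<close>

lemma metric_completion_refl:
  assumes "mcomplete_of Z"
  shows "metric_completion Z Z id"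
  using assms closure_of_topspace[of "mtopology_of Z"] by (simp add: metric_completion_def)

theorem theorem1p2:
  shows "(\<exists>(G :: real metric) (T :: real functional).
            compact_space (mtopology_of G) \<and> T \<in> integral_currents 1 G \<and>
            geodesic_metric G \<and> doubling_metric G \<and> ahlfors_regular 1 G \<and>
            zero_current 0 G (current_boundary T) \<and> current_set 1 G T = mspace G \<and>
            \<not> (\<exists>S\<in>integral_currents 1 G.
                  current_set 1 G S = mspace G \<and> multiplicity_one_ae 1 G S (mspace G)))
         \<and> \<not> basso_question TYPE(real) 1"
proof
  have "zero_current 0 double_circle (current_boundary double_current)"
    using double.curve_current_boundary_zero by (simp add: zero_current_def)
  then show "\<exists>(G :: real metric) (T :: real functional).
            compact_space (mtopology_of G) \<and> T \<in> integral_currents 1 G \<and>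
            geodesic_metric G \<and> doubling_metric G \<and> ahlfors_regular 1 G \<and>
            zero_current 0 G (current_boundary T) \<and> current_set 1 G T = mspace G \<and>
            \<not> (\<exists>S\<in>integral_currents 1 G.
                  current_set 1 G S = mspace G \<and> multiplicity_one_ae 1 G S (mspace G))"
    using compact_double_circle double.curve_current_integral geodesic_double_circle
      doubling_double_circle ahlfors_double_circle current_set_double_current
      double_circle_no_multiplicity_one by blast
  \<comment> \<open>Compactness makes the space complete, hence its own completion with embedding
    \<open>id\<close>, so it is an instance of the question.\<close>
  have "mcomplete_of double_circle"
    using compact_double_circle Metric_space.compact_space_imp_mcomplete[OF Metric_space_mspace_mdist[of double_circle]]
    by (simp add: mcomplete_of_def mtopology_of_def)
  then have "integral_current_space 1 double_circle double_circle id double_current"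
    unfolding integral_current_space_def
    using metric_completion_refl double.curve_current_integral current_set_double_current by simp
  then show "\<not> basso_question TYPE(real) 1"
    unfolding basso_question_def using double_circle_no_multiplicity_one by (metis image_id id_apply)
qed

end
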